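(* The map $\mathbf{Zie}^*\twoheadrightarrow\check{\mathbf{Zie}}^*$, $\mathtt{c}_p\mapsto\check{\mathtt{c}}_p$ (equivalently $\mathtt{p}_F\mapsto\check{\mathtt{p}}_F$, or $\mathtt{m}_F\mapsto\check{\mathtt{m}}_F$) is an isomorphism of Lie coalgebras in cospecies.
   Context: Let $\mathbb{k}$ be a field of characteristic zero. $\mathbf{\Sigma}^*[I]$ is the space of $\mathbb{k}$-valued functions on compositions of the finite set $I$, a commutative Hopf algebra in cospecies (monomial basis $\mathtt{M}_F$, multiplication by quasishuffling, comultiplication by deconcatenation); its cone basis is $\mathtt{C}_p=\sum_{F\le p}\mathtt{M}_F$ for preposets $p$ (sum over compositions $F$ whose total preorder contains $p$), and $\mathtt{P}_F=\sum_{G\le F}\frac{1}{(F/G)!}\mathtt{M}_G$. $\mathbf{Zie}^*$ is the indecomposable quotient of $\mathbf{\Sigma}^*$ (the quotient by the image of the multiplication; dual of the primitive part $\mathbf{Zie}=\mathbf{Lie}\circ\mathbf{E}^*_+$ of $\mathbf{\Sigma}$), and $\mathtt{c}_p,\mathtt{p}_F,\mathtt{m}_F$ are the images of $\mathtt{C}_p,\mathtt{P}_F,\mathtt{M}_F$. Its Lie cobracket is the cocommutator of deconcatenation: $\partial_{[S,T]}(\mathtt{c}_F)=\mathtt{c}_{F|_S}\otimes\mathtt{c}_{F|_T}-\mathtt{c}_{F|_T}\otimes\mathtt{c}_{F|_S}$, where the first (resp. second) term is taken to be $0$ unless $S$ (resp. $T$) is a union of an initial segment of lumps of $F$. On the adjoint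 side: $\mathrm{T}^\vee_I=\{h\in\mathbb{R}I:\sum_ih_i=0\}$ with special hyperplanes $\mathcal H_{(S|T)}=\{\sum_{i\in S}h_i=0\}$ and adjoint chambers; $\sigma^\vee_p$ is the cone generated by $e_{i_1}-e_{i_2}$, $i_1\ge_p i_2$, $i_1\ne i_2$; $\check{\mathtt{c}}_p$ is the function on adjoint chambers equal to $1$ on chambers inside $\sigma^\vee_p$ and $0$ otherwise; $\check{\mathbf{Zie}}^*[I]$ is the span of the $\check{\mathtt{c}}_p$, with $\check{\mathtt{p}}_F,\check{\mathtt{m}}_F$ the corresponding images of $\mathtt{P}_F,\mathtt{M}_F$ (via $\mathtt{C}_p\mapsto\check{\mathtt{c}}_p$). The cobracket of $\check{\mathbf{Zie}}^*$ is discrete differentiation across special hyperplanes, $\partial_{[S,T]}f(X)=f(X^{[S,T]})-f(X^{[T,S]})$ for codimension-one faces $X\subset\mathcal H_{(S|T)}$ with adjacent chambers $X^{[S,T]}$ (side $\sum_{i\in S}h_i>0$) and $X^{[T,S]}$, read as a function of the pair of adjoint chambers over $S$ and $T$ whose product in $\mathcal H_{(S|T)}\cong\mathrm{T}^\vee_S\times\mathrm{T}^\vee_T$ contains $X$. The map $\mathtt{c}_p\mapsto\check{\mathtt{c}}_p$ is well defined because $\check{\mathtt{c}}_p=0$ whenever $p$ has at least two blocks. *)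

theory Defs
  imports
    Complex_Main
    "HOL-Library.FuncSet"
    "HOL-Library.Disjoint_Sets"
    "HOL-Library.Function_Algebras"
    "HOL-Library.Set_Algebras"
begin

section \<open>Vector spaces, quotients and tensor products\<close>

text \<open>
  The spaces below (quotients, tensor products) depend on a finite set \<open>I\<close>, so they are
  given by explicit carriers and operations; scalars range over the type class \<open>field\<close>.
\<close>

record ('v, 'k) vspace =
  vcar :: "'v set"
  vzero :: "'v"
  vadd :: "'v \<Rightarrow> 'v \<Rightarrow> 'v"
  vscale :: "'k \<Rightarrow> 'v \<Rightarrow> 'v"

definition is_vspace :: "('v, 'k::field) vspace \<Rightarrow> bool" where
  "is_vspace V \<longleftrightarrow>
     vzero V \<in> vcar V \<and>
     (\<forall>x\<in>vcar V. \<forall>y\<in>vcar V. vadd V x y \<in> vcar V \<and> vadd V x y = vadd V y x) \<and>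
     (\<forall>x\<in>vcar V. \<forall>y\<in>vcar V. \<forall>z\<in>vcar V. vadd V (vadd V x y) z = vadd V x (vadd V y z)) \<and>
     (\<forall>x\<in>vcar V. vadd V (vzero V) x = x \<and> (\<exists>y\<in>vcar V. vadd V x y = vzero V)) \<and>
     (\<forall>c. \<forall>x\<in>vcar V. vscale V c x \<in> vcar V) \<and>
     (\<forall>c. \<forall>x\<in>vcar V. \<forall>y\<in>vcar V.
        vscale V c (vadd V x y) = vadd V (vscale V c x) (vscale V c y)) \<and>
     (\<forall>c d. \<forall>x\<in>vcar V. vscale V (c + d) x = vadd V (vscale V c x) (vscale V d x)) \<and>
     (\<forall>c d. \<forall>x\<in>vcar V. vscale V (c * d) x = vscale V c (vscale V d x)) \<and>
     (\<forall>x\<in>vcar V. vscale V 1 x = x)"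

definition linear_on ::
    "('v, 'k::field) vspace \<Rightarrow> ('w, 'k) vspace \<Rightarrow> ('v \<Rightarrow> 'w) \<Rightarrow> bool" where
  "linear_on V W f \<longleftrightarrow>
     (\<forall>x\<in>vcar V. f x \<in> vcar W) \<and>
     (\<forall>x\<in>vcar V. \<forall>y\<in>vcar V. f (vadd V x y) = vadd W (f x) (f y)) \<and>
     (\<forall>c. \<forall>x\<in>vcar V. f (vscale V c x) = vscale W c (f x))"

definition fscale :: "'k::field \<Rightarrow> ('x \<Rightarrow> 'k) \<Rightarrow> 'x \<Rightarrow> 'k" where
  "fscale c f = (\<lambda>x. c * f x)"

interpretation fun_vs: vector_space "fscale :: 'k::field \<Rightarrow> ('x \<Rightarrow> 'k) \<Rightarrow> 'x \<Rightarrow> 'k"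
  by unfold_locales (auto simp: fscale_def fun_eq_iff algebra_simps)

definition fun_space :: "('x \<Rightarrow> 'k::field) set \<Rightarrow> ('x \<Rightarrow> 'k, 'k) vspace" where
  "fun_space U = \<lparr>vcar = U, vzero = 0, vadd = (+), vscale = fscale\<rparr>"

text \<open>The quotient \<open>U / D\<close> of subspaces \<open>D \<subseteq> U\<close> of a function space; its elements are cosets.
  Adding \<open>D\<close> in the scalar multiplication matters only for the scalar \<open>0\<close>.\<close>

definition quotient_space ::
    "('x \<Rightarrow> 'k::field) set \<Rightarrow> ('x \<Rightarrow> 'k) set \<Rightarrow> (('x \<Rightarrow> 'k) set, 'k) vspace" where
  "quotient_space U D =
     \<lparr>vcar = (\<lambda>f. f +o D) ` U, vzero = D, vadd = (+), vscale = (\<lambda>c X. fscale c ` X + D)\<rparr>"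

definition dual :: "('v, 'k::field) vspace \<Rightarrow> ('v \<Rightarrow> 'k) set" where
  "dual V = {\<xi>.
     (\<forall>x\<in>vcar V. \<forall>y\<in>vcar V. \<xi> (vadd V x y) = \<xi> x + \<xi> y) \<and>
     (\<forall>c. \<forall>x\<in>vcar V. \<xi> (vscale V c x) = c * \<xi> x) \<and>
     (\<forall>x. x \<notin> vcar V \<longrightarrow> \<xi> x = 0)}"

text \<open>
  Over a field, the canonical map from \<open>V \<otimes> W\<close> to the bilinear forms on \<open>V\<^sup>* \<times> W\<^sup>*\<close>
  is injective. The tensor product is taken to be its image: the span of the pure tensors
  \<open>v \<otimes> w = (\<lambda>(\<xi>, \<eta>). \<xi> v * \<eta> w)\<close>.
\<close>

type_synonym ('v, 'w, 'k) tens = "('v \<Rightarrow> 'k) \<times> ('w \<Rightarrow> 'k) \<Rightarrow> 'k"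

definition pure_tensor ::
    "('v, 'k::field) vspace \<Rightarrow> ('w, 'k) vspace \<Rightarrow> 'v \<Rightarrow> 'w \<Rightarrow> ('v, 'w, 'k) tens" where
  "pure_tensor V W v w = (\<lambda>(\<xi>, \<eta>). if \<xi> \<in> dual V \<and> \<eta> \<in> dual W then \<xi> v * \<eta> w else 0)"

definition tensor ::
    "('v, 'k::field) vspace \<Rightarrow> ('w, 'k) vspace \<Rightarrow> (('v, 'w, 'k) tens, 'k) vspace" where
  "tensor V W = fun_space (fun_vs.span {pure_tensor V W v w | v w. v \<in> vcar V \<and> w \<in> vcar W})"

definition pullback :: "('v, 'k::field) vspace \<Rightarrow> ('v \<Rightarrow> 'w) \<Rightarrow> ('w \<Rightarrow> 'k) \<Rightarrow> 'v \<Rightarrow> 'k" where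
  "pullback V f \<xi> = (\<lambda>v. if v \<in> vcar V then \<xi> (f v) else 0)"

text \<open>For linear \<open>f : V \<rightarrow> V'\<close> and \<open>g : W \<rightarrow> W'\<close>, this is \<open>f \<otimes> g\<close>: it sends
  \<open>v \<otimes> w\<close> to \<open>f v \<otimes> g w\<close>.\<close>

definition tensor_map ::
    "('v, 'k::field) vspace \<Rightarrow> ('w, 'k) vspace \<Rightarrow> ('v', 'k) vspace \<Rightarrow> ('w', 'k) vspace \<Rightarrow>
     ('v \<Rightarrow> 'v') \<Rightarrow> ('w \<Rightarrow> 'w') \<Rightarrow> ('v, 'w, 'k) tens \<Rightarrow> ('v', 'w', 'k) tens" where
  "tensor_map V W V' W' f g t =
     (\<lambda>(\<xi>, \<eta>). if \<xi> \<in> dual V' \<and> \<eta> \<in> dual W' then t (pullback V f \<xi>, pullback W g \<eta>) else 0)"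

definition tensor_swap :: "('v, 'w, 'k) tens \<Rightarrow> ('w, 'v, 'k) tens" where
  "tensor_swap t = (\<lambda>(\<eta>, \<xi>). t (\<xi>, \<eta>))"


section \<open>Lie coalgebras in cospecies\<close>

text \<open>
  (Positive) cospecies are contravariant functors on nonempty finite sets and bijections. An
  injection \<open>\<sigma>\<close> on \<open>I\<close> stands for the bijection \<open>I \<rightarrow> \<sigma> ` I\<close>, and \<open>act A I \<sigma>\<close> is the
  induced map from the component at \<open>\<sigma> ` I\<close> to the component at \<open>I\<close>.
\<close>

record ('a, 'v, 'k) cobracket_data =
  comp :: "'a set \<Rightarrow> ('v, 'k) vspace"
  act :: "'a set \<Rightarrow> ('a \<Rightarrow> 'a) \<Rightarrow> 'v \<Rightarrow> 'v"
  cobr :: "'a set \<Rightarrow> 'a set \<Rightarrow> 'v \<Rightarrow> ('v, 'v, 'k) tens"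

definition fin_ne :: "'a set \<Rightarrow> bool" where
  "fin_ne I \<longleftrightarrow> finite I \<and> I \<noteq> {}"

definition is_cospecies :: "('a, 'v, 'k::field) cobracket_data \<Rightarrow> bool" where
  "is_cospecies A \<longleftrightarrow>
     (\<forall>I. fin_ne I \<longrightarrow> is_vspace (comp A I)) \<and>
     (\<forall>I \<sigma>. fin_ne I \<and> inj_on \<sigma> I \<longrightarrow> linear_on (comp A (\<sigma> ` I)) (comp A I) (act A I \<sigma>)) \<and>
     (\<forall>I \<sigma> \<tau>. fin_ne I \<and> inj_on \<sigma> I \<and> (\<forall>i\<in>I. \<sigma> i = \<tau> i) \<longrightarrow>
        (\<forall>x\<in>vcar (comp A (\<sigma> ` I)). act A I \<sigma> x = act A I \<tau> x)) \<and>
     (\<forall>I. fin_ne I \<longrightarrow> (\<forall>x\<in>vcar (comp A I). act A I id x = x)) \<and>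
     (\<forall>I \<sigma> \<tau>. fin_ne I \<and> inj_on \<sigma> I \<and> inj_on \<tau> (\<sigma> ` I) \<longrightarrow>
        (\<forall>x\<in>vcar (comp A (\<tau> ` \<sigma> ` I)). act A I (\<tau> \<circ> \<sigma>) x = act A I \<sigma> (act A (\<sigma> ` I) \<tau> x)))"

text \<open>The bracket of functionals \<open>\<xi>\<close> over \<open>S\<close> and \<open>\<eta>\<close> over \<open>T\<close>, i.e. \<open>(\<xi> \<otimes> \<eta>) \<circ> \<partial>\<^sub>S\<^sub>,\<^sub>T\<close>.\<close>

definition dual_bracket ::
    "('a, 'v, 'k::field) cobracket_data \<Rightarrow> 'a set \<Rightarrow> 'a set \<Rightarrow> ('v \<Rightarrow> 'k) \<Rightarrow> ('v \<Rightarrow> 'k) \<Rightarrow> 'v \<Rightarrow> 'k" where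
  "dual_bracket A S T \<xi> \<eta> = (\<lambda>x. if x \<in> vcar (comp A (S \<union> T)) then cobr A S T x (\<xi>, \<eta>) else 0)"

text \<open>The last condition is the co-Jacobi identity: its three summands are the values at
  \<open>\<xi> \<otimes> \<eta> \<otimes> \<zeta>\<close> of \<open>(\<partial> \<otimes> id) \<circ> \<partial>\<close> and of its two cyclic rotations.\<close>

definition is_lie_coalgebra :: "('a, 'v, 'k::field) cobracket_data \<Rightarrow> bool" where
  "is_lie_coalgebra A \<longleftrightarrow>
     is_cospecies A \<and>
     (\<forall>S T. fin_ne S \<and> fin_ne T \<and> S \<inter> T = {} \<longrightarrow>
        linear_on (comp A (S \<union> T)) (tensor (comp A S) (comp A T)) (cobr A S T)) \<and>
     (\<forall>S T \<sigma>. fin_ne S \<and> fin_ne T \<and> S \<inter> T = {} \<and> inj_on \<sigma> (S \<union> T) \<longrightarrow>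
        (\<forall>x\<in>vcar (comp A (\<sigma> ` (S \<union> T))).
           cobr A S T (act A (S \<union> T) \<sigma> x) =
           tensor_map (comp A (\<sigma> ` S)) (comp A (\<sigma> ` T)) (comp A S) (comp A T)
             (act A S \<sigma>) (act A T \<sigma>) (cobr A (\<sigma> ` S) (\<sigma> ` T) x))) \<and>
     (\<forall>S T. fin_ne S \<and> fin_ne T \<and> S \<inter> T = {} \<longrightarrow>
        (\<forall>x\<in>vcar (comp A (S \<union> T)). cobr A T S x = - tensor_swap (cobr A S T x))) \<and>
     (\<forall>R S T. fin_ne R \<and> fin_ne S \<and> fin_ne T \<and> R \<inter> S = {} \<and> R \<inter> T = {} \<and> S \<inter> T = {} \<longrightarrow>
        (\<forall>x\<in>vcar (comp A (R \<union> S \<union> T)).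
         \<forall>\<xi>\<in>dual (comp A R). \<forall>\<eta>\<in>dual (comp A S). \<forall>\<zeta>\<in>dual (comp A T).
           cobr A (R \<union> S) T x (dual_bracket A R S \<xi> \<eta>, \<zeta>) +
           cobr A (S \<union> T) R x (dual_bracket A S T \<eta> \<zeta>, \<xi>) +
           cobr A (T \<union> R) S x (dual_bracket A T R \<zeta> \<xi>, \<eta>) = 0))"

definition lie_coalgebra_iso ::
    "('a, 'v, 'k::field) cobracket_data \<Rightarrow> ('a, 'w, 'k) cobracket_data \<Rightarrow>
     ('a set \<Rightarrow> 'v \<Rightarrow> 'w) \<Rightarrow> bool" where
  "lie_coalgebra_iso A B \<phi> \<longleftrightarrow>
     (\<forall>I. fin_ne I \<longrightarrow>
        linear_on (comp A I) (comp B I) (\<phi> I) \<and> bij_betw (\<phi> I) (vcar (comp A I)) (vcar (comp B I))) \<and>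
     (\<forall>I \<sigma>. fin_ne I \<and> inj_on \<sigma> I \<longrightarrow>
        (\<forall>x\<in>vcar (comp A (\<sigma> ` I)). \<phi> I (act A I \<sigma> x) = act B I \<sigma> (\<phi> (\<sigma> ` I) x))) \<and>
     (\<forall>S T. fin_ne S \<and> fin_ne T \<and> S \<inter> T = {} \<longrightarrow>
        (\<forall>x\<in>vcar (comp A (S \<union> T)).
           cobr B S T (\<phi> (S \<union> T) x) =
           tensor_map (comp A S) (comp A T) (comp B S) (comp B T) (\<phi> S) (\<phi> T) (cobr A S T x)))"


section \<open>Compositions and preposets\<close>

definition compositions :: "'a set \<Rightarrow> 'a set list set" where
  "compositions I = {F. distinct F \<and> partition_on I (set F)}"

text \<open>A pair \<open>(i, j) \<in> p\<close> of a preposet \<open>p\<close> is read as \<open>i \<ge>\<^sub>p j\<close>. For a composition, the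
  elements of earlier lumps are the larger ones.\<close>

definition total_preorder :: "'a set list \<Rightarrow> ('a \<times> 'a) set" where
  "total_preorder F = {(i, j). \<exists>m n. m \<le> n \<and> n < length F \<and> i \<in> F ! m \<and> j \<in> F ! n}"

definition restr :: "'a set list \<Rightarrow> 'a set \<Rightarrow> 'a set list" where
  "restr F S = filter (\<lambda>B. B \<noteq> {}) (map (\<lambda>B. B \<inter> S) F)"

text \<open>\<open>G \<le> F\<close>, i.e. \<open>F\<close> refines \<open>G\<close>, amounts to \<open>total_preorder F \<subseteq> total_preorder G\<close>;
  then \<open>(F/G)!\<close> is the product over the lumps \<open>B\<close> of \<open>G\<close> of the factorials of the
  number of lumps of \<open>F\<close> inside \<open>B\<close>.\<close>

definition quot_fact :: "'a set list \<Rightarrow> 'a set list \<Rightarrow> nat" where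
  "quot_fact F G = (\<Prod>B\<in>set G. fact (length (restr F B)))"


section \<open>The Hopf algebra of compositions and its indecomposable quotient\<close>

definition Sig :: "'a set \<Rightarrow> ('a set list \<Rightarrow> 'k::field) set" where
  "Sig I = {f. \<forall>F. F \<notin> compositions I \<longrightarrow> f F = 0}"

definition bM :: "'a set list \<Rightarrow> 'a set list \<Rightarrow> 'k::field" where
  "bM F = (\<lambda>G. if G = F then 1 else 0)"

definition bC :: "'a set \<Rightarrow> ('a \<times> 'a) set \<Rightarrow> 'a set list \<Rightarrow> 'k::field" where
  "bC I p = (\<Sum>F | F \<in> compositions I \<and> p \<subseteq> total_preorder F. bM F)"

definition bP :: "'a set \<Rightarrow> 'a set list \<Rightarrow> 'a set list \<Rightarrow> 'k::field_char_0" where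
  "bP I F = (\<Sum>G | G \<in> compositions I \<and> total_preorder F \<subseteq> total_preorder G.
      fscale (1 / of_nat (quot_fact F G)) (bM G))"

text \<open>Quasishuffling \<open>M\<^sub>F \<cdot> M\<^sub>G = \<Sum> {M\<^sub>H | H. H|\<^sub>S = F \<and> H|\<^sub>T = G}\<close>, extended bilinearly.\<close>

definition Sig_mult ::
    "'a set \<Rightarrow> 'a set \<Rightarrow> ('a set list \<Rightarrow> 'k::field) \<Rightarrow> ('a set list \<Rightarrow> 'k) \<Rightarrow> 'a set list \<Rightarrow> 'k" where
  "Sig_mult S T f g =
     (\<lambda>H. if H \<in> compositions (S \<union> T) then f (restr H S) * g (restr H T) else 0)"

text \<open>Deconcatenation: \<open>M\<^sub>H \<mapsto> M\<^sub>F \<otimes> M\<^sub>G\<close> if \<open>H\<close> is the concatenation of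
  compositions \<open>F\<close> of \<open>S\<close> and \<open>G\<close> of \<open>T\<close>, and \<open>M\<^sub>H \<mapsto> 0\<close> otherwise.\<close>

definition deconcat ::
    "'a set \<Rightarrow> 'a set \<Rightarrow> ('a set list \<Rightarrow> 'k::field) \<Rightarrow>
     ('a set list \<Rightarrow> 'k, 'a set list \<Rightarrow> 'k, 'k) tens" where
  "deconcat S T f = (\<Sum>F\<in>compositions S. \<Sum>G\<in>compositions T.
      fscale (f (F @ G)) (pure_tensor (fun_space (Sig S)) (fun_space (Sig T)) (bM F) (bM G)))"

definition decomposables :: "'a set \<Rightarrow> ('a set list \<Rightarrow> 'k::field) set" where
  "decomposables I = fun_vs.span {Sig_mult S T f g | S T f g.
      S \<noteq> {} \<and> T \<noteq> {} \<and> S \<inter> T = {} \<and> S \<union> T = I \<and> f \<in> Sig S \<and> g \<in> Sig T}"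

definition zproj :: "'a set \<Rightarrow> ('a set list \<Rightarrow> 'k::field) \<Rightarrow> ('a set list \<Rightarrow> 'k) set" where
  "zproj I f = f +o decomposables I"

definition Zie_space :: "'a set \<Rightarrow> (('a set list \<Rightarrow> 'k::field) set, 'k) vspace" where
  "Zie_space I = quotient_space (Sig I) (decomposables I)"

definition zc :: "'a set \<Rightarrow> ('a \<times> 'a) set \<Rightarrow> ('a set list \<Rightarrow> 'k::field) set" where
  "zc I p = zproj I (bC I p)"

definition zp :: "'a set \<Rightarrow> 'a set list \<Rightarrow> ('a set list \<Rightarrow> 'k::field_char_0) set" where
  "zp I F = zproj I (bP I F)"

definition zm :: "'a set \<Rightarrow> 'a set list \<Rightarrow> ('a set list \<Rightarrow> 'k::field) set" where
  "zm I F = zproj I (bM F)"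

definition Sig_act :: "'a set \<Rightarrow> ('a \<Rightarrow> 'a) \<Rightarrow> ('a set list \<Rightarrow> 'k::field) \<Rightarrow> 'a set list \<Rightarrow> 'k" where
  "Sig_act I \<sigma> f = (\<lambda>F. if F \<in> compositions I then f (map ((`) \<sigma>) F) else 0)"

text \<open>The cocommutator of deconcatenation, passed to the quotients.\<close>

definition Zie_cobr ::
    "'a set \<Rightarrow> 'a set \<Rightarrow> ('a set list \<Rightarrow> 'k::field) set \<Rightarrow>
     (('a set list \<Rightarrow> 'k) set, ('a set list \<Rightarrow> 'k) set, 'k) tens" where
  "Zie_cobr S T X = (THE t. \<exists>f\<in>X. t =
      tensor_map (fun_space (Sig S)) (fun_space (Sig T)) (Zie_space S) (Zie_space T)
        (zproj S) (zproj T) (deconcat S T f - tensor_swap (deconcat T S f)))"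

definition Zie :: "('a, ('a set list \<Rightarrow> 'k::field) set, 'k) cobracket_data" where
  "Zie = \<lparr>comp = Zie_space, act = (\<lambda>I \<sigma> X. Sig_act I \<sigma> ` X), cobr = Zie_cobr\<rparr>"


section \<open>The adjoint braid arrangement\<close>

text \<open>\<open>\<real>I\<close> is modelled by the functions \<open>'a \<Rightarrow> real\<close> vanishing outside \<open>I\<close>.\<close>

definition adj_space :: "'a set \<Rightarrow> ('a \<Rightarrow> real) set" where
  "adj_space I = {h. (\<forall>i. i \<notin> I \<longrightarrow> h i = 0) \<and> (\<Sum>i\<in>I. h i) = 0}"

definition special_hyperplane :: "'a set \<Rightarrow> 'a set \<Rightarrow> ('a \<Rightarrow> real) set" where
  "special_hyperplane S T = {h \<in> adj_space (S \<union> T). (\<Sum>i\<in>S. h i) = 0}"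

text \<open>The face containing \<open>x\<close>: the points on the same side as \<open>x\<close> of every special hyperplane
  (or on it, if \<open>x\<close> is).\<close>

definition adj_face :: "'a set \<Rightarrow> ('a \<Rightarrow> real) \<Rightarrow> ('a \<Rightarrow> real) set" where
  "adj_face I x = {h \<in> adj_space I. \<forall>R. R \<noteq> {} \<and> R \<subset> I \<longrightarrow> sgn (\<Sum>i\<in>R. h i) = sgn (\<Sum>i\<in>R. x i)}"

definition adj_chambers :: "'a set \<Rightarrow> ('a \<Rightarrow> real) set set" where
  "adj_chambers I = {adj_face I x | x. x \<in> adj_space I \<and>
      (\<forall>R. R \<noteq> {} \<and> R \<subset> I \<longrightarrow> x \<notin> special_hyperplane R (I - R))}"

text \<open>Codimension-one faces inside \<open>special_hyperplane S T\<close>: no other special hyperplane contains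
  them.\<close>

definition adj_walls :: "'a set \<Rightarrow> 'a set \<Rightarrow> ('a \<Rightarrow> real) set set" where
  "adj_walls S T = {adj_face (S \<union> T) x | x. x \<in> special_hyperplane S T \<and>
      (\<forall>R. R \<noteq> {} \<and> R \<subset> S \<union> T \<and> R \<noteq> S \<and> R \<noteq> T \<longrightarrow> x \<notin> special_hyperplane R (S \<union> T - R))}"

text \<open>\<open>X\<^bsup>[S,T]\<^esup>\<close>: the chamber on the positive side for \<open>S\<close> that is not separated from the wall
  \<open>X\<close> by any other special hyperplane.\<close>

definition adj_side :: "'a set \<Rightarrow> 'a set \<Rightarrow> ('a \<Rightarrow> real) set \<Rightarrow> ('a \<Rightarrow> real) set" where
  "adj_side S T X = {h \<in> adj_space (S \<union> T). (\<Sum>i\<in>S. h i) > 0 \<and>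
      (\<forall>R. R \<noteq> {} \<and> R \<subset> S \<union> T \<and> R \<noteq> S \<and> R \<noteq> T \<longrightarrow>
         (\<forall>x\<in>X. sgn (\<Sum>i\<in>R. h i) = sgn (\<Sum>i\<in>R. x i)))}"

text \<open>\<open>X \<subseteq> C \<times> D\<close> under the identification of \<open>special_hyperplane S T\<close> with
  \<open>adj_space S \<times> adj_space T\<close>.\<close>

definition in_product ::
    "'a set \<Rightarrow> 'a set \<Rightarrow> ('a \<Rightarrow> real) set \<Rightarrow> ('a \<Rightarrow> real) set \<Rightarrow> ('a \<Rightarrow> real) set \<Rightarrow> bool" where
  "in_product S T X C D \<longleftrightarrow>
     (\<forall>x\<in>X. (\<lambda>i. if i \<in> S then x i else 0) \<in> C \<and> (\<lambda>i. if i \<in> T then x i else 0) \<in> D)"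

definition adj_cone :: "('a \<times> 'a) set \<Rightarrow> ('a \<Rightarrow> real) set" where
  "adj_cone p = {h. \<exists>a. (\<forall>i j. a i j \<ge> 0) \<and>
      h = (\<lambda>k. \<Sum>(i, j) | (i, j) \<in> p \<and> i \<noteq> j. a i j * (of_bool (k = i) - of_bool (k = j)))}"


section \<open>The adjoint realization\<close>

definition ac :: "'a set \<Rightarrow> ('a \<times> 'a) set \<Rightarrow> ('a \<Rightarrow> real) set \<Rightarrow> 'k::field" where
  "ac I p = (\<lambda>C. if C \<in> adj_chambers I \<and> C \<subseteq> adj_cone p then 1 else 0)"

definition adjZie_space :: "'a set \<Rightarrow> (('a \<Rightarrow> real) set \<Rightarrow> 'k::field, 'k) vspace" where
  "adjZie_space I = fun_space (fun_vs.span {ac I p | p. preorder_on I p})"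

text \<open>The linear map \<open>C\<^sub>p \<mapsto> ac\<^sub>p\<close> on \<open>Sig I\<close>. Its existence is a theorem (the \<open>C\<^sub>p\<close>
  are linearly dependent); its uniqueness holds because the \<open>C\<^sub>p\<close> span.\<close>

definition is_adj_map ::
    "'a set \<Rightarrow> (('a set list \<Rightarrow> 'k::field) \<Rightarrow> (('a \<Rightarrow> real) set \<Rightarrow> 'k)) \<Rightarrow> bool" where
  "is_adj_map I L \<longleftrightarrow>
     linear_on (fun_space (Sig I)) (adjZie_space I) L \<and> L \<in> extensional (Sig I) \<and>
     (\<forall>p. preorder_on I p \<longrightarrow> L (bC I p) = ac I p)"

definition adj_map ::
    "'a set \<Rightarrow> ('a set list \<Rightarrow> 'k::field) \<Rightarrow> (('a \<Rightarrow> real) set \<Rightarrow> 'k)" where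
  "adj_map I = (THE L. is_adj_map I L)"

definition ap :: "'a set \<Rightarrow> 'a set list \<Rightarrow> ('a \<Rightarrow> real) set \<Rightarrow> 'k::field_char_0" where
  "ap I F = adj_map I (bP I F)"

definition am :: "'a set \<Rightarrow> 'a set list \<Rightarrow> ('a \<Rightarrow> real) set \<Rightarrow> 'k::field" where
  "am I F = adj_map I (bM F)"

definition push :: "'a set \<Rightarrow> ('a \<Rightarrow> 'a) \<Rightarrow> ('a \<Rightarrow> real) \<Rightarrow> 'a \<Rightarrow> real" where
  "push I \<sigma> h = (\<lambda>j. if j \<in> \<sigma> ` I then h (inv_into I \<sigma> j) else 0)"

definition adjZie_act ::
    "'a set \<Rightarrow> ('a \<Rightarrow> 'a) \<Rightarrow> (('a \<Rightarrow> real) set \<Rightarrow> 'k::field) \<Rightarrow> ('a \<Rightarrow> real) set \<Rightarrow> 'k" where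
  "adjZie_act I \<sigma> f = (\<lambda>C. if C \<in> adj_chambers I then f (push I \<sigma> ` C) else 0)"

definition chamber_eval ::
    "'a set \<Rightarrow> ('a \<Rightarrow> real) set \<Rightarrow> (('a \<Rightarrow> real) set \<Rightarrow> 'k::field) \<Rightarrow> 'k" where
  "chamber_eval I C = (\<lambda>f. if f \<in> vcar (adjZie_space I) then f C else 0)"

text \<open>Discrete differentiation across \<open>special_hyperplane S T\<close>. A tensor is read as a function of
  pairs of chambers \<open>(C, D)\<close> by evaluating its factors at \<open>C\<close> and \<open>D\<close>.\<close>

definition adjZie_cobr ::
    "'a set \<Rightarrow> 'a set \<Rightarrow> (('a \<Rightarrow> real) set \<Rightarrow> 'k::field) \<Rightarrow>
     (('a \<Rightarrow> real) set \<Rightarrow> 'k, ('a \<Rightarrow> real) set \<Rightarrow> 'k, 'k) tens" where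
  "adjZie_cobr S T f = (THE t. t \<in> vcar (tensor (adjZie_space S) (adjZie_space T)) \<and>
      (\<forall>X\<in>adj_walls S T. \<forall>C\<in>adj_chambers S. \<forall>D\<in>adj_chambers T. in_product S T X C D \<longrightarrow>
         t (chamber_eval S C, chamber_eval T D) = f (adj_side S T X) - f (adj_side T S X)))"

definition adjZie :: "('a, ('a \<Rightarrow> real) set \<Rightarrow> 'k::field, 'k) cobracket_data" where
  "adjZie = \<lparr>comp = adjZie_space, act = adjZie_act, cobr = adjZie_cobr\<rparr>"

end

theory Submission
  imports Defs
begin

text \<open>
  A generic vector \<open>v\<close> of an adjoint chamber defines the Dynkin functional, which sends \<open>M\<^sub>F\<close> to
  \<open>(- 1)\<^bsup>l(F) + 1\<^esup>\<close> if \<open>sum v U < 0\<close> for all proper initial segments \<open>U\<close> of \<open>F\<close>, and to \<open>0\<close> otherwise. Its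
  value on \<open>C\<^sub>p\<close> is a reduced Euler characteristic, equal to \<open>1\<close> or \<open>0\<close> according to whether \<open>v\<close> lies
  in the cone of \<open>p\<close>. So the Dynkin functionals of all chambers together form the linear map
  \<open>C\<^sub>p \<mapsto> ac\<^sub>p\<close>, and it vanishes on products because a product of cone functions is the
  function of a cone inside a special hyperplane.

  Modulo products, the \<open>M\<^sub>F\<close> whose last lump contains a fixed \<open>i0\<close> span. Their images are linearly
  independent: at a wall \<open>sum v S = 0\<close>, the Dynkin functionals of the two adjacent chambers differ by
  the tensor product of two Dynkin functionals applied to the cocommutator of deconcatenation, and
  for \<open>i0 \<notin> S\<close> this isolates the coefficients of the compositions with first lump \<open>S\<close>. Hence the
  kernel consists of the decomposables. The same wall formula says that discrete
  differentiation corresponds to the cobracket, and it shows that the cobracket is well defined on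
  the quotient. The Lie coalgebra axioms are checked in the quotient and transported along the
  isomorphism.
\<close>

section \<open>Compositions\<close>

text \<open>The \<open>C_p\<close> are linearly dependent, so prescribing their images defines no
  map; values on the \<open>M_F\<close> have to be given instead, and these are forced. Moebius
  inversion over the compositions coarser than \<open>F\<close>, which correspond to the subsets of
  its set of proper initial segments, writes \<open>M_F\<close> as an alternating sum of functions
  \<open>C_G\<close>. A generic \<open>v\<close> lies in the cone of \<open>G\<close> if and only if
  \<open>sum v U > 0\<close> for all proper initial segments \<open>U\<close> of \<open>G\<close>.
  So the alternating sum at \<open>v\<close> runs over the subsets of the set of those
  \<open>U\<close> with \<open>sum v U > 0\<close>, and it vanishes unless that set is empty; what
  then remains is the sign. The real content is the identity for an arbitrary preposet.

  Both cobrackets are definite descriptions: one needs independence of a representative, the other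
  needs exactly one tensor with given values at pairs of chambers over walls. Both rest on one fact:
  chamber evaluations separate the points of each factor, hence pairs of chambers separate tensors,
  and every pair of chambers lies over some wall.\<close>

lemma finite_compositions: "finite I \<Longrightarrow> finite (compositions I)"
  by (rule finite_subset[OF _ finite_subset_distinct[of "Pow I"]])
    (auto simp: compositions_def partition_on_def)

lemma Union_composition: "F \<in> compositions I \<Longrightarrow> \<Union>(set F) = I"
  by (simp add: compositions_def partition_on_def)

lemma block_composition: "F \<in> compositions I \<Longrightarrow> B \<in> set F \<Longrightarrow> B \<noteq> {} \<and> B \<subseteq> I"
  by (auto simp: compositions_def partition_on_def)

lemma Nil_in_compositions: "[] \<in> compositions I \<longleftrightarrow> I = {}"
  by (auto simp: compositions_def partition_on_def)

lemma compositions_empty: "compositions {} = {[]}"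
proof (intro equalityI subsetI)
  fix F :: "'a set list" assume "F \<in> compositions {}"
  then have "B \<noteq> {} \<and> B \<subseteq> {}" if "B \<in> set F" for B using that by (rule block_composition)
  then have "set F = {}" by (metis ex_in_conv subset_empty)
  then show "F \<in> {[]}" by simp
qed (simp add: Nil_in_compositions)

lemma single_in_compositions: "[B] \<in> compositions I \<longleftrightarrow> B = I \<and> I \<noteq> {}"
  by (auto simp: compositions_def partition_on_def)

lemma append_in_compositions:
  "F @ G \<in> compositions I \<longleftrightarrow>
     (\<exists>S T. F \<in> compositions S \<and> G \<in> compositions T \<and> S \<inter> T = {} \<and> S \<union> T = I)"
proof
  assume *: "F @ G \<in> compositions I"
  have "\<Union>(set F) \<inter> \<Union>(set G) = {}"
  proof (rule ccontr)
    assume "\<Union>(set F) \<inter> \<Union>(set G) \<noteq> {}"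
    then obtain x A B where "x \<in> A" "x \<in> B" "A \<in> set F" "B \<in> set G" by auto
    moreover from this * have "A = B"
      by (auto simp: compositions_def partition_on_def disjoint_def)
    ultimately show False using * by (auto simp: compositions_def)
  qed
  then have "F \<in> compositions (\<Union>(set F)) \<and> G \<in> compositions (\<Union>(set G)) \<and>
    \<Union>(set F) \<inter> \<Union>(set G) = {} \<and> \<Union>(set F) \<union> \<Union>(set G) = I"
    using * by (auto simp: compositions_def partition_on_def disjoint_def)
  then show "\<exists>S T. F \<in> compositions S \<and> G \<in> compositions T \<and> S \<inter> T = {} \<and> S \<union> T = I"
    by blast
next
  assume "\<exists>S T. F \<in> compositions S \<and> G \<in> compositions T \<and> S \<inter> T = {} \<and> S \<union> T = I"
  then obtain S T where *: "F \<in> compositions S" "G \<in> compositions T" "S \<inter> T = {}" "S \<union> T = I"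
    by blast
  have **: "A \<inter> B = {}" if "A \<in> set F" "B \<in> set G" for A B
    using *(3) block_composition[OF *(1) that(1)] block_composition[OF *(2) that(2)] by blast
  have "set F \<inter> set G = {}"
    using ** block_composition[OF *(1)] by (metis disjoint_iff inf.idem)
  then have "distinct (F @ G)" using * by (simp add: compositions_def)
  moreover have "disjoint (set F)" "disjoint (set G)"
    using * by (auto simp: compositions_def partition_on_def)
  then have "disjoint (set (F @ G))"
    using *(3) by (simp add: disjoint_union Union_composition[OF *(1)] Union_composition[OF *(2)])
  moreover have "{} \<notin> set (F @ G)"
    using block_composition[OF *(1), of "{}"] block_composition[OF *(2), of "{}"] by auto
  moreover have "\<Union>(set (F @ G)) = I"
    using *(4) by (simp add: Union_composition[OF *(1)] Union_composition[OF *(2)])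
  ultimately show "F @ G \<in> compositions I"
    by (simp add: compositions_def partition_on_def)
qed

lemma append_in_compositions_iff:
  assumes "F \<in> compositions S" "S \<subseteq> I"
  shows "F @ G \<in> compositions I \<longleftrightarrow> G \<in> compositions (I - S)"
proof
  assume "F @ G \<in> compositions I"
  then obtain S' T where *: "F \<in> compositions S'" "G \<in> compositions T" "S' \<inter> T = {}" "S' \<union> T = I"
    unfolding append_in_compositions by auto
  have "S' = S" using Union_composition[OF *(1)] Union_composition[OF assms(1)] by simp
  then have "I - S = T" using *(3,4) by blast
  then show "G \<in> compositions (I - S)" using *(2) by simp
next
  assume "G \<in> compositions (I - S)"
  then show "F @ G \<in> compositions I"
    unfolding append_in_compositions using assms
    by (intro exI[of _ S] exI[of _ "I - S"]) auto
qed

lemma append_compositions_disjoint: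
  "F \<in> compositions S \<Longrightarrow> G \<in> compositions T \<Longrightarrow> S \<inter> T = {} \<Longrightarrow> F @ G \<in> compositions (S \<union> T)"
  unfolding append_in_compositions by blast

lemma Cons_in_compositions:
  "B # F \<in> compositions I \<longleftrightarrow> B \<noteq> {} \<and> B \<subseteq> I \<and> F \<in> compositions (I - B)"
proof -
  have "[B] \<in> compositions B \<longleftrightarrow> B \<noteq> {}" by (simp add: single_in_compositions)
  then show ?thesis
    using append_in_compositions_iff[of "[B]" B I F] block_composition[of "B # F" I B] by auto
qed

text \<open>The bounds on \<open>k\<close> leave out the empty set and the whole ground set, on
  which every vector of \<open>adj_space\<close> sums to zero.\<close>

definition inits :: "'a set list \<Rightarrow> 'a set set" where
  "inits F = {\<Union>(set (take k F)) |k. 0 < k \<and> k < length F}"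

lemma inits_single [simp]: "inits [B] = {}" "inits [] = {}"
  by (auto simp: inits_def)

lemma inits_append:
  assumes "F \<noteq> []" "G \<noteq> []"
  shows "inits (F @ G) = insert (\<Union>(set F)) (inits F \<union> (\<lambda>U. \<Union>(set F) \<union> U) ` inits G)"
    (is "_ = ?R")
proof (intro set_eqI iffI)
  fix X assume "X \<in> inits (F @ G)"
  then obtain k where k: "0 < k" "k < length F + length G" "X = \<Union>(set (take k (F @ G)))"
    by (auto simp: inits_def)
  consider "k < length F" | "k = length F" | "k > length F" by linarith
  then show "X \<in> ?R"
  proof cases
    case 1 then show ?thesis using k by (auto simp: inits_def)
  next
    case 2 then show ?thesis using k by simp
  next
    case 3
    then have "X = \<Union>(set F) \<union> \<Union>(set (take (k - length F) G))" "\<Union>(set (take (k - length F) G)) \<in> inits G"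
      using k by (auto simp: inits_def)
    then show ?thesis by blast
  qed
next
  fix X assume "X \<in> ?R"
  then consider "X = \<Union>(set F)" | "X \<in> inits F" | U where "U \<in> inits G" "X = \<Union>(set F) \<union> U" by auto
  then show "X \<in> inits (F @ G)"
  proof cases
    case 1 then show ?thesis using assms unfolding inits_def
      by (intro CollectI exI[of _ "length F"]) simp
  next
    case 2
    then obtain k where "0 < k" "k < length F" "X = \<Union>(set (take k F))" by (auto simp: inits_def)
    then show ?thesis unfolding inits_def by (intro CollectI exI[of _ k]) simp
  next
    case 3
    then obtain k where "0 < k" "k < length G" "U = \<Union>(set (take k G))" by (auto simp: inits_def)
    then show ?thesis unfolding inits_def using 3 by (intro CollectI exI[of _ "length F + k"]) auto
  qed
qed

lemma inits_split:
  assumes "F \<in> compositions I" "U \<in> inits F"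
  obtains G H where "F = G @ H" "G \<in> compositions U" "H \<in> compositions (I - U)" "U \<noteq> {}" "U \<subset> I"
proof -
  obtain k where k: "0 < k" "k < length F" "U = \<Union>(set (take k F))"
    using assms by (auto simp: inits_def)
  have F: "F = take k F @ drop k F" by simp
  obtain S T where *: "take k F \<in> compositions S" "drop k F \<in> compositions T" "S \<inter> T = {}" "S \<union> T = I"
    using assms(1) F append_in_compositions by metis
  have "S = U" using * k Union_composition by blast
  moreover have "T = I - S" using * by blast
  moreover have "S \<noteq> {}" "T \<noteq> {}" using * k by (auto simp: compositions_empty)
  ultimately show ?thesis using that[OF F] * by auto
qed

section \<open>Sums over compositions, split at the last lump or at a fixed initial segment\<close>

lemma sum_compositions_last:
  assumes "finite I" "I \<noteq> {}"
  shows "(\<Sum>F\<in>compositions I. g F :: 'b::comm_monoid_add) =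
    g [I] + (\<Sum>X | X \<noteq> {} \<and> X \<subset> I. \<Sum>F\<in>compositions X. g (F @ [I - X]))"
proof -
  let ?P = "Sigma {X. X \<noteq> {} \<and> X \<subset> I} compositions"
  let ?h = "\<lambda>(X, F). F @ [I - X]"
  have inj: "inj_on ?h ?P"
    by (auto simp: inj_on_def)
  have img: "compositions I = insert [I] (?h ` ?P)"
  proof (intro set_eqI iffI)
    fix H assume H: "H \<in> compositions I"
    then have "H \<noteq> []" using assms by (auto simp: Nil_in_compositions)
    then obtain F B where FB: "H = F @ [B]" by (metis rev_exhaust)
    then obtain S T where *: "F \<in> compositions S" "[B] \<in> compositions T" "S \<inter> T = {}" "S \<union> T = I"
      using H append_in_compositions by metis
    then have BT: "B = T" "T \<noteq> {}" by (auto simp: single_in_compositions)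
    then have T: "B = I - S" "S \<subset> I" using * by auto
    show "H \<in> insert [I] (?h ` ?P)"
    proof (cases "S = {}")
      case True then show ?thesis using * FB T by (auto simp: compositions_empty)
    next
      case False
      then have "(S, F) \<in> ?P" using *(1) T(2) by simp
      moreover have "H = ?h (S, F)" using FB T(1) by simp
      ultimately show ?thesis by blast
    qed
  next
    fix H assume "H \<in> insert [I] (?h ` ?P)"
    then show "H \<in> compositions I"
    proof
      assume "H = [I]" then show ?thesis using assms by (simp add: single_in_compositions)
    next
      assume "H \<in> ?h ` ?P"
      then obtain X F where "X \<subset> I" "F \<in> compositions X" "H = F @ [I - X]" by auto
      then show ?thesis
        using append_in_compositions_iff[of F X I "[I - X]"] by (auto simp: single_in_compositions)
    qed
  qed
  have notin: "[I] \<notin> ?h ` ?P"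
  proof
    assume "[I] \<in> ?h ` ?P"
    then obtain p where p: "p \<in> ?P" "[I] = ?h p" by (elim imageE)
    obtain X F where XF: "p = (X, F)" by (cases p)
    then have "length [I] = length F + 1" using p(2) by (simp only:) simp
    then show False using p(1) XF by (auto simp: Nil_in_compositions)
  qed
  have fins: "finite {X. X \<noteq> {} \<and> X \<subset> I}" using assms by (auto intro: finite_subset[of _ "Pow I"])
  have finc: "\<forall>X\<in>{X. X \<noteq> {} \<and> X \<subset> I}. finite (compositions X)"
    using finite_subset[OF _ assms(1)] by (auto intro!: finite_compositions)
  then have fin: "finite ?P" using fins by (auto intro!: finite_SigmaI)
  have "sum g (?h ` ?P) = (\<Sum>X | X \<noteq> {} \<and> X \<subset> I. \<Sum>F\<in>compositions X. g (F @ [I - X]))"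
    unfolding sum.reindex[OF inj] sum.Sigma[OF fins finc] by (simp add: comp_def split_beta)
  moreover have "sum g (compositions I) = g [I] + sum g (?h ` ?P)"
    by (subst img, rule sum.insert) (use fin notin in auto)
  ultimately show ?thesis by simp
qed

text \<open>One of \<open>F\<close> and \<open>F'\<close> is a prefix of the other, and the
  remainder would be a composition of the empty set. This makes the splitting of a composition at a
  given initial segment unique.\<close>

lemma append_composition_eqD:
  assumes "F \<in> compositions S" "F' \<in> compositions S" "F @ G = F' @ G'"
  shows "F = F'"
proof -
  have *: "H = []" if "A @ H \<in> compositions S" "A \<in> compositions S" for A H
    using append_in_compositions_iff[OF that(2), of S H] that(1) by (simp add: compositions_empty)
  obtain H where "F = F' @ H \<and> H @ G = G' \<or> F @ H = F' \<and> G = H @ G'"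
    using assms(3) unfolding append_eq_append_conv2 by auto
  then show ?thesis
  proof (elim disjE conjE)
    assume "F = F' @ H" then show ?thesis using *[of F' H] assms(1,2) by simp
  next
    assume "F @ H = F'" then show ?thesis using *[of F H] assms(1,2) by auto
  qed
qed

text \<open>Concatenation is a bijection onto the compositions that have \<open>S\<close> as an
  initial segment. The \<open>if\<close> matters because \<open>compositions {}\<close> contains
  \<open>[]\<close>, whereas \<open>inits\<close> contains only nonempty proper subsets: for empty
  \<open>S\<close> or \<open>T\<close> the left side is an empty sum.\<close>

lemma sum_compositions_append:
  assumes "finite S" "finite T" "S \<inter> T = {}"
  shows "(\<Sum>H | H \<in> compositions (S \<union> T) \<and> S \<in> inits H. g H :: 'b::comm_monoid_add) =
    (\<Sum>F\<in>compositions S. \<Sum>G\<in>compositions T. if S \<noteq> {} \<and> T \<noteq> {} then g (F @ G) else 0)"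
proof (cases "S \<noteq> {} \<and> T \<noteq> {}")
  case False
  have "{H. H \<in> compositions (S \<union> T) \<and> S \<in> inits H} = {}"
  proof -
    have "S \<noteq> {} \<and> S \<subset> S \<union> T" if "H \<in> compositions (S \<union> T)" "S \<in> inits H" for H
      using inits_split[OF that] by metis
    then show ?thesis using False by blast
  qed
  then show ?thesis using False by (simp only:) simp
next
  case True
  let ?P = "compositions S \<times> compositions T"
  have "inj_on (\<lambda>(F, G). F @ G) ?P"
  proof (rule inj_onI)
    fix p q assume *: "p \<in> ?P" "q \<in> ?P" "(\<lambda>(F, G). F @ G) p = (\<lambda>(F, G). F @ G) q"
    have "fst p = fst q"
      by (rule append_composition_eqD[of _ S _ "snd p" "snd q"]) (use * in auto)
    then show "p = q" using *(3) by (simp add: split_beta prod_eq_iff)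
  qed
  moreover have "{H. H \<in> compositions (S \<union> T) \<and> S \<in> inits H} = (\<lambda>(F, G). F @ G) ` ?P"
  proof (intro set_eqI iffI)
    fix H assume "H \<in> {H. H \<in> compositions (S \<union> T) \<and> S \<in> inits H}"
    then have H: "H \<in> compositions (S \<union> T)" "S \<in> inits H" by simp_all
    have "S \<union> T - S = T" using assms(3) by blast
    with inits_split[OF H] obtain F G where "H = F @ G" "F \<in> compositions S" "G \<in> compositions T"
      by metis
    then show "H \<in> (\<lambda>(F, G). F @ G) ` ?P" by auto
  next
    fix H assume "H \<in> (\<lambda>(F, G). F @ G) ` ?P"
    then obtain F G where *: "F \<in> compositions S" "G \<in> compositions T" "H = F @ G" by auto
    then have "F \<noteq> []" "G \<noteq> []" using True by (auto simp: Nil_in_compositions)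
    then have "S \<in> inits H" by (simp add: *(3) inits_append Union_composition[OF *(1)])
    then show "H \<in> {H. H \<in> compositions (S \<union> T) \<and> S \<in> inits H}"
      using *(3) append_compositions_disjoint[OF *(1,2) assms(3)] by simp
  qed
  ultimately have "(\<Sum>H | H \<in> compositions (S \<union> T) \<and> S \<in> inits H. g H) =
      sum (g \<circ> (\<lambda>(F, G). F @ G)) ?P"
    by (simp add: sum.reindex del: mem_Collect_eq)
  then show ?thesis using True
    by (simp add: sum.cartesian_product comp_def split_beta)
qed

section \<open>Total preorders of compositions\<close>

lemma total_preorder_Nil [simp]: "total_preorder [] = {}"
  by (auto simp: total_preorder_def)

lemma total_preorder_Cons:
  "total_preorder (B # F) = B \<times> (B \<union> \<Union>(set F)) \<union> total_preorder F" (is "_ = ?R")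
proof (rule equalityI; rule subrelI)
  fix i j assume "(i, j) \<in> total_preorder (B # F)"
  then obtain m n where "m \<le> n" "n < length (B # F)" "i \<in> (B # F) ! m" "j \<in> (B # F) ! n"
    by (auto simp: total_preorder_def)
  then show "(i, j) \<in> ?R"
    by (cases m; cases n) (auto simp: total_preorder_def)
next
  fix i j assume "(i, j) \<in> ?R"
  then consider "i \<in> B" "j \<in> B" | "i \<in> B" "j \<in> \<Union>(set F)" | "(i, j) \<in> total_preorder F" by auto
  then show "(i, j) \<in> total_preorder (B # F)"
  proof cases
    case 1 then show ?thesis by (auto simp: total_preorder_def intro!: exI[of _ 0])
  next
    case 2
    then obtain n where "n < length F" "j \<in> F ! n" by (auto simp: in_set_conv_nth)
    with 2 have "0 \<le> Suc n \<and> Suc n < length (B # F) \<and> i \<in> (B # F) ! 0 \<and> j \<in> (B # F) ! Suc n"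
      by simp
    then show ?thesis unfolding total_preorder_def by blast
  next
    case 3
    then obtain m n where "m \<le> n" "n < length F" "i \<in> F ! m" "j \<in> F ! n"
      by (auto simp: total_preorder_def)
    then have "Suc m \<le> Suc n \<and> Suc n < length (B # F) \<and> i \<in> (B # F) ! Suc m \<and> j \<in> (B # F) ! Suc n"
      by simp
    then show ?thesis unfolding total_preorder_def by blast
  qed
qed

lemma total_preorder_append:
  "total_preorder (F @ G) = total_preorder F \<union> total_preorder G \<union> \<Union>(set F) \<times> \<Union>(set G)"
  by (induction F) (auto simp: total_preorder_Cons)

lemma total_preorder_subset: "total_preorder F \<subseteq> \<Union>(set F) \<times> \<Union>(set F)"
  by (induction F) (auto simp: total_preorder_Cons)

lemma preorder_on_total_preorder:
  assumes "F \<in> compositions I" shows "preorder_on I (total_preorder F)"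
  using assms
proof (induction F arbitrary: I)
  case Nil then show ?case
    by (auto simp: Nil_in_compositions preorder_on_def refl_on_def trans_def)
next
  case (Cons B F)
  then have B: "B \<subseteq> I" "F \<in> compositions (I - B)" by (auto simp: Cons_in_compositions)
  then have IH: "preorder_on (I - B) (total_preorder F)" and U: "\<Union>(set F) = I - B"
    using Cons.IH Union_composition by blast+
  have "B \<union> \<Union>(set F) = I" using U B by auto
  then have tp: "total_preorder (B # F) = B \<times> I \<union> total_preorder F"
    by (simp only: total_preorder_Cons)
  have r: "total_preorder F \<subseteq> (I - B) \<times> (I - B)" using total_preorder_subset[of F] U by simp
  have t: "trans (total_preorder F)" "refl_on (I - B) (total_preorder F)"
    using IH by (auto simp: preorder_on_def)
  show ?case unfolding preorder_on_def tp
  proof (intro conjI)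
    show "refl_on I (B \<times> I \<union> total_preorder F)" using t B by (auto simp: refl_on_def)
    show "trans (B \<times> I \<union> total_preorder F)"
      using r by (intro transI) (use t(1)[THEN transD] in blast)
    show "B \<times> I \<union> total_preorder F \<subseteq> I \<times> I" using r B by auto
  qed
qed

text \<open>The first lump consists of the elements that lie above all others, and the tail has the
  preorder restricted to the remaining elements. Injectivity makes proper coarsening strictly
  enlarge the preorder, which is what triangular arguments over the refinement order need.\<close>

lemma total_preorder_inj:
  assumes "F \<in> compositions I" "G \<in> compositions I" "total_preorder F = total_preorder G"
  shows "F = G"
  using assms
proof (induction F arbitrary: I G)
  case Nil then show ?case by (auto simp: Nil_in_compositions compositions_empty)
next
  case (Cons B F)
  then obtain C G' where G: "G = C # G'"
    by (cases G) (auto simp: Nil_in_compositions Cons_in_compositions)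
  have first: "D = {i\<in>I. \<forall>j\<in>I. (i, j) \<in> total_preorder (D # H)} \<and> 
     total_preorder H = total_preorder (D # H) \<inter> (I - D) \<times> (I - D)"
    if "D # H \<in> compositions I" for D H
  proof -
    have *: "D \<subseteq> I" "D \<noteq> {}" "\<Union>(set H) = I - D" 
      using that Union_composition by (auto simp: Cons_in_compositions)
    then have "total_preorder (D # H) = D \<times> I \<union> total_preorder H"
      by (auto simp: total_preorder_Cons)
    then show ?thesis using * total_preorder_subset[of H] by auto
  qed
  have "B = C" "total_preorder F = total_preorder G'"
    using first[of B F] first[of C G'] Cons.prems G by auto
  then show ?case using Cons G by (auto simp: Cons_in_compositions)
qed

lemma closed_inits:
  assumes "F \<in> compositions I" "U \<in> inits F" "(i, j) \<in> total_preorder F" "j \<in> U"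
  shows "i \<in> U"
proof -
  obtain G H where *: "F = G @ H" "G \<in> compositions U" "H \<in> compositions (I - U)"
    using inits_split[OF assms(1,2)] by metis
  then have "total_preorder F = total_preorder G \<union> total_preorder H \<union> U \<times> (I - U)"
    using Union_composition by (metis total_preorder_append)
  moreover have "total_preorder G \<subseteq> U \<times> U" "total_preorder H \<subseteq> (I - U) \<times> (I - U)"
    using * total_preorder_subset Union_composition by blast+
  ultimately show ?thesis using assms by auto
qed

lemma inits_psubset:
  assumes "F \<in> compositions I" "U \<in> inits F" shows "U \<noteq> {} \<and> U \<subset> I"
  using inits_split[OF assms] by metis

section \<open>Cones and Dynkin functionals\<close>

text \<open>These are the upward closed sets. The inequalities \<open>sum v U \<ge> 0\<close> for
  closed \<open>U \<subseteq> I\<close> cut out the cone of \<open>p\<close> inside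
  \<open>adj_space I\<close>; the next lemmas prove both halves of this duality.\<close>

definition closed_under :: "('a \<times> 'a) set \<Rightarrow> 'a set \<Rightarrow> bool" where
  "closed_under p U \<longleftrightarrow> (\<forall>(i, j)\<in>p. j \<in> U \<longrightarrow> i \<in> U)"

lemma zero_in_adj_cone: "(\<lambda>_. 0) \<in> adj_cone p"
  unfolding adj_cone_def by (intro CollectI exI[of _ "\<lambda>_ _. 0"]) simp

lemma adj_cone_insert:
  assumes "finite q" "(i, j) \<notin> q" "x \<in> adj_cone q" "t \<ge> 0"
  shows "(\<lambda>k. x k + t * (of_bool (k = i) - of_bool (k = j))) \<in> adj_cone (insert (i, j) q)"
proof -
  obtain a where a: "\<And>i j. a i j \<ge> 0"
    "x = (\<lambda>k. \<Sum>(i, j) | (i, j) \<in> q \<and> i \<noteq> j. a i j * (of_bool (k = i) - of_bool (k = j)))"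
    using assms(3) unfolding adj_cone_def by auto
  define b where "b = (\<lambda>i' j'. if (i', j') = (i, j) then t else a i' j')"
  let ?A = "{(i, j). (i, j) \<in> q \<and> i \<noteq> j}"
  have fin: "finite ?A" by (rule finite_subset[OF _ assms(1)]) auto
  have x: "x k = (\<Sum>(i, j)\<in>?A. b i j * (of_bool (k = i) - of_bool (k = j)))" for k
    unfolding a(2) by (rule sum.cong) (use assms(2) in \<open>auto simp: b_def\<close>)
  have "x k + t * (of_bool (k = i) - of_bool (k = j)) =
      (\<Sum>(i', j') | (i', j') \<in> insert (i, j) q \<and> i' \<noteq> j'. b i' j' * (of_bool (k = i') - of_bool (k = j')))" for k
  \<comment> \<open>A loop is left out of the sum over the edges, and its vector is zero
    anyway.\<close>
  proof (cases "i = j")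
    case True
    then have "{(i', j'). (i', j') \<in> insert (i, j) q \<and> i' \<noteq> j'} = ?A" by auto
    moreover have "x k + t * (of_bool (k = i) - of_bool (k = j)) = x k" using True by simp
    ultimately show ?thesis by (simp only: x)
  next
    case False
    then have *: "{(i', j'). (i', j') \<in> insert (i, j) q \<and> i' \<noteq> j'} = insert (i, j) ?A" by auto
    have "(i, j) \<notin> ?A" using assms(2) by simp
    then show ?thesis unfolding * using fin x by (simp add: b_def)
  qed
  moreover have "b i j \<ge> 0" for i j using a(1) assms(4) by (simp add: b_def)
  ultimately show ?thesis unfolding adj_cone_def by blast
qed

text \<open>An edge \<open>(i, j)\<close> contributes its weight times the difference of the
  memberships of \<open>i\<close> and \<open>j\<close> in \<open>U\<close>, and a closed set
  contains \<open>i\<close> whenever it contains \<open>j\<close>.\<close>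

lemma adj_cone_sum_nonneg:
  assumes "x \<in> adj_cone p" "closed_under p U" "finite U"
  shows "sum x U \<ge> 0"
proof -
  obtain a where a: "\<And>i j. a i j \<ge> 0"
    "x = (\<lambda>k. \<Sum>(i, j) | (i, j) \<in> p \<and> i \<noteq> j. a i j * (of_bool (k = i) - of_bool (k = j)))"
    using assms(1) unfolding adj_cone_def by auto
  have "sum x U = (\<Sum>(i, j) | (i, j) \<in> p \<and> i \<noteq> j. \<Sum>k\<in>U. a i j * (of_bool (k = i) - of_bool (k = j)))"
    unfolding a(2) by (subst sum.swap) (simp add: split_beta)
  also have "\<dots> = (\<Sum>(i, j) | (i, j) \<in> p \<and> i \<noteq> j. a i j * (of_bool (i \<in> U) - of_bool (j \<in> U)))"
    using assms(3) by (intro sum.cong) (auto simp: sum_distrib_left[symmetric] sum_subtractf of_bool_def)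
  also have "\<dots> \<ge> 0"
    using a(1) assms(2) by (intro sum_nonneg) (auto simp: closed_under_def of_bool_def)
  finally show ?thesis .
qed

text \<open>Induction on the edges: the amount transported along the edge \<open>(i, j)\<close> has to be at
  least the deficit \<open>- sum v U\<close> of every set \<open>U\<close> that is closed for the remaining edges and
  contains \<open>j\<close> but not \<open>i\<close>. Taking the maximal deficit is possible because deficits and
  surpluses are modular.\<close>

lemma adj_cone_if_sums_nonneg:
  assumes "finite I" "finite p" "p \<subseteq> I \<times> I" "v \<in> adj_space I"
    "\<And>U. U \<subseteq> I \<Longrightarrow> closed_under p U \<Longrightarrow> sum v U \<ge> 0"
  shows "v \<in> adj_cone p"
  using assms(2-)
proof (induction p arbitrary: v rule: finite_induct)
  case empty
  \<comment> \<open>Without edges every singleton is closed, and nonnegative entries with sum zero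
    vanish.\<close>
  have "v i \<ge> 0" if "i \<in> I" for i
    using empty(3)[of "{i}"] that by (simp add: closed_under_def)
  then have "v i = 0" if "i \<in> I" for i
    using empty(2) that assms(1) by (simp add: adj_space_def sum_nonneg_eq_0_iff)
  then have "v = (\<lambda>_. 0)" using empty(2) by (fastforce simp: adj_space_def)
  then show ?case by (simp add: zero_in_adj_cone)
next
  case (insert e q)
  obtain i j where e: "e = (i, j)" by (cases e)
  have ij: "i \<in> I" "j \<in> I" "q \<subseteq> I \<times> I" using insert e by auto
  define W where "W = {U. U \<subseteq> I \<and> closed_under q U \<and> j \<in> U \<and> i \<notin> U}"
  define t where "t = Max (insert 0 ((\<lambda>U. - sum v U) ` W))"
  have finW: "finite W" unfolding W_def using assms(1) by auto
  have t0: "t \<ge> 0" unfolding t_def using finW by (intro Max_ge) auto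
  have tW: "t \<ge> - sum v U" if "U \<in> W" for U
    unfolding t_def using finW that by (intro Max_ge) auto
  have "t \<in> insert 0 ((\<lambda>U. - sum v U) ` W)" unfolding t_def using finW by (intro Max_in) auto
  then have t_cases: "t = 0 \<or> (\<exists>U\<in>W. t = - sum v U)" by auto
  define w where "w = (\<lambda>k. v k - t * (of_bool (k = i) - of_bool (k = j)))"
  have sum_w: "sum w U = sum v U - t * (of_bool (i \<in> U) - of_bool (j \<in> U))" if "U \<subseteq> I" for U
    using finite_subset[OF that assms(1)]
    by (simp add: w_def sum_subtractf sum_distrib_left[symmetric] of_bool_def)
  have "w \<in> adj_cone q"
  proof (rule insert.IH)
    show "q \<subseteq> I \<times> I" by fact
    have "w k = 0" if "k \<notin> I" for k
      using that ij insert.prems(2) by (auto simp: w_def adj_space_def)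
    then show "w \<in> adj_space I"
      using sum_w[of I] ij insert.prems(2) by (simp add: adj_space_def)
    fix U assume U: "U \<subseteq> I" "closed_under q U"
    show "0 \<le> sum w U"
    proof (cases "j \<in> U")
      case True
      show ?thesis
      proof (cases "i \<in> U")
        case True
        then have "closed_under (insert e q) U" using U by (auto simp: closed_under_def e)
        then show ?thesis using insert.prems(3) U \<open>j \<in> U\<close> True sum_w by auto
      next
        case False
        then have "U \<in> W" using U True by (simp add: W_def)
        then show ?thesis using tW sum_w U True False by fastforce
      qed
    next
      case jU: False
      then have clU: "closed_under (insert e q) U" using U by (auto simp: closed_under_def e)
      then have vU: "sum v U \<ge> 0" using insert.prems(3) U by blast
      show ?thesis
      proof (cases "i \<in> U")
        case iU: True
        from t_cases have "sum v U \<ge> t"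
        proof
          assume "t = 0" then show ?thesis using vU by simp
        next
          assume "\<exists>U\<in>W. t = - sum v U"
          then obtain V where V: "V \<in> W" "t = - sum v V" by blast
          then have "V \<subseteq> I" by (simp add: W_def)
          \<comment> \<open>The new edge holds in both sets: the union contains \<open>i\<close>,
            and the intersection does not contain \<open>j\<close>.\<close>
          have "closed_under (insert e q) (U \<union> V)" "closed_under (insert e q) (U \<inter> V)"
            using V U iU jU by (auto simp: closed_under_def e W_def)
          then have "sum v (U \<union> V) \<ge> 0" "sum v (U \<inter> V) \<ge> 0"
            using insert.prems(3) U \<open>V \<subseteq> I\<close> by (meson le_infI1 le_supI)+
          moreover have "sum v (U \<union> V) + sum v (U \<inter> V) = sum v U + sum v V"
            using finite_subset[OF U(1) assms(1)] finite_subset[OF \<open>V \<subseteq> I\<close> assms(1)]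
            by (rule sum.union_inter)
          ultimately show ?thesis using V by simp
        qed
        then show ?thesis using sum_w U iU jU by simp
      next
        case False then show ?thesis using vU sum_w U jU by simp
      qed
    qed
  qed
  moreover have "v = (\<lambda>k. w k + t * (of_bool (k = i) - of_bool (k = j)))"
    by (simp add: w_def)
  ultimately show ?case
    using adj_cone_insert[of q i j w t] insert.hyps t0 e by simp
qed

section \<open>Dynkin functionals and their values on cone functions\<close>

definition neg_inits :: "('a \<Rightarrow> real) \<Rightarrow> 'a set list \<Rightarrow> bool" where
  "neg_inits v F \<longleftrightarrow> (\<forall>U\<in>inits F. sum v U < 0)"

definition dynkin :: "('a \<Rightarrow> real) \<Rightarrow> 'a set \<Rightarrow> ('a set list \<Rightarrow> 'k::field) \<Rightarrow> 'k" where
  "dynkin v I f = (\<Sum>F\<in>compositions I. if neg_inits v F then (-1) ^ (length F + 1) * f F else 0)"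

lemma dynkin_add: "dynkin v I (f + g) = dynkin v I f + dynkin v I g"
  unfolding dynkin_def sum.distrib[symmetric] by (rule sum.cong) (auto simp: algebra_simps)

lemma dynkin_fscale: "dynkin v I (fscale c f) = c * dynkin v I f"
  unfolding dynkin_def sum_distrib_left by (rule sum.cong) (auto simp: fscale_def)

lemma dynkin_bM:
  assumes "finite I" "F \<in> compositions I"
  shows "dynkin v I (bM F) = (if neg_inits v F then (-1) ^ (length F + 1) else 0)"
proof -
  have "dynkin v I (bM F) =
      (\<Sum>G\<in>compositions I. if G = F then (if neg_inits v F then (-1) ^ (length F + 1) else 0) else 0)"
    unfolding dynkin_def by (rule sum.cong) (auto simp: bM_def)
  then show ?thesis using finite_compositions[OF assms(1)] assms(2) by simp
qed

lemma dynkin_expand: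
  "finite I \<Longrightarrow> dynkin v I f = (\<Sum>F\<in>compositions I. f F * dynkin v I (bM F))"
  unfolding dynkin_def[of v I f] by (rule sum.cong) (auto simp: dynkin_bM)

lemma sum_fun_apply: "(\<Sum>a\<in>A. g a) x = (\<Sum>a\<in>A. g a x)"
  by (induction A rule: infinite_finite_induct) auto

lemma bC_apply:
  assumes "finite I"
  shows "bC I p F = of_bool (F \<in> compositions I \<and> p \<subseteq> total_preorder F)"
proof -
  have "finite {F. F \<in> compositions I \<and> p \<subseteq> total_preorder F}"
    using finite_compositions[OF assms] by simp
  then show ?thesis by (simp add: bC_def sum_fun_apply bM_def)
qed

lemma inits_empty_iff:
  assumes "F \<in> compositions I" "I \<noteq> {}"
  shows "inits F = {} \<longleftrightarrow> F = [I]"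
proof
  assume *: "inits F = {}"
  obtain B G where F: "F = B # G" using assms by (cases F) (auto simp: Nil_in_compositions)
  have "G = []" using * inits_append[of "[B]" G] F by auto
  then show "F = [I]" using F assms by (simp add: single_in_compositions)
qed simp

text \<open>Only the one-lump composition \<open>[I]\<close> survives: an initial segment of a
  composition whose preorder contains \<open>p\<close> is closed under \<open>p\<close>, so its sum
  cannot be negative on the cone.\<close>

lemma dynkin_bC_in_cone:
  assumes "finite I" "I \<noteq> {}" "p \<subseteq> I \<times> I" "v \<in> adj_cone p"
  shows "dynkin v I (bC I p) = (1 :: 'k::field)"
proof -
  have *: "F = [I]" if "F \<in> compositions I" "neg_inits v F" "p \<subseteq> total_preorder F" for F
  proof -
    have "U \<notin> inits F" for U
    proof
      assume U: "U \<in> inits F"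
      then have "closed_under p U"
        using closed_inits[OF that(1) U] that(3) by (auto simp: closed_under_def)
      moreover have "finite U" using inits_psubset[OF that(1) U] finite_subset[OF _ assms(1)] by blast
      ultimately have "sum v U \<ge> 0" using adj_cone_sum_nonneg assms(4) by blast
      then show False using that(2) U by (auto simp: neg_inits_def)
    qed
    then show ?thesis using inits_empty_iff that(1) assms(2) by blast
  qed
  have "dynkin v I (bC I p) = (\<Sum>F\<in>compositions I. if F = [I] then 1 else (0::'k))"
    unfolding dynkin_def
  proof (rule sum.cong[OF refl])
    fix F assume F: "F \<in> compositions I"
    show "(if neg_inits v F then (-1) ^ (length F + 1) * bC I p F else 0) =
        (if F = [I] then 1 else (0::'k))"
    proof (cases "F = [I]")
      case True
      then show ?thesis using assms by (simp add: bC_apply neg_inits_def total_preorder_Cons single_in_compositions)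
    next
      case False
      then have "\<not> (neg_inits v F \<and> p \<subseteq> total_preorder F)" using *[OF F] by blast
      then show ?thesis using False by (simp add: bC_apply[OF assms(1)])
    qed
  qed
  then show ?thesis
    using finite_compositions[OF assms(1)] assms(2) by (simp add: single_in_compositions)
qed

text \<open>The compositions of \<open>X\<close> are sorted by the union \<open>Y\<close> of all
  lumps but the last. The preorder of \<open>F @ [X - Y]\<close> contains \<open>p\<close> on
  \<open>X\<close> exactly if \<open>Y\<close> is closed and the preorder of \<open>F\<close>
  contains \<open>p\<close> on \<open>Y\<close>. The new initial segment \<open>Y\<close> adds the
  condition \<open>sum v Y < 0\<close>, and the additional lump flips the sign. The composition
  \<open>[X]\<close> gives the 1. This is the recursion for a reduced Euler characteristic, up to
  sign.\<close>

lemma dynkin_bC_recursion: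
  assumes "finite X" "X \<noteq> {}" "closed_under p X"
  shows "(dynkin v X (bC X (p \<inter> X \<times> X)) :: 'k::field) =
    1 - (\<Sum>Y | Y \<noteq> {} \<and> Y \<subset> X \<and> closed_under p Y \<and> sum v Y < 0. dynkin v Y (bC Y (p \<inter> Y \<times> Y)))"
proof -
  let ?t = "\<lambda>X F. if neg_inits v F then (-1) ^ (length F + 1) * bC X (p \<inter> X \<times> X) F else (0::'k)"
  have step: "?t X (F @ [X - Y]) = (if closed_under p Y \<and> sum v Y < 0 then - ?t Y F else 0)"
    if Y: "Y \<noteq> {}" "Y \<subset> X" and F: "F \<in> compositions Y" for Y F
  proof -
    have finY: "finite Y" using Y assms finite_subset by blast
    have "F \<noteq> []" using F Y by (auto simp: Nil_in_compositions)
    then have n: "neg_inits v (F @ [X - Y]) \<longleftrightarrow> neg_inits v F \<and> sum v Y < 0"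
      using Union_composition[OF F] by (auto simp: neg_inits_def inits_append)
    have FX: "F @ [X - Y] \<in> compositions X"
      using append_in_compositions_iff[OF F, of X "[X - Y]"] Y by (auto simp: single_in_compositions)
    have tp: "total_preorder (F @ [X - Y]) = total_preorder F \<union> (X - Y) \<times> (X - Y) \<union> Y \<times> (X - Y)"
      using Union_composition[OF F] by (simp add: total_preorder_append total_preorder_Cons)
    have tpF: "total_preorder F \<subseteq> Y \<times> Y" using total_preorder_subset[of F] Union_composition[OF F] by simp
    have "p \<inter> X \<times> X \<subseteq> total_preorder (F @ [X - Y]) \<longleftrightarrow>
        closed_under p Y \<and> p \<inter> Y \<times> Y \<subseteq> total_preorder F" (is "?L \<longleftrightarrow> ?R")
    proof
      assume L: ?L
      have *: "(i, j) \<in> total_preorder F" if "(i, j) \<in> p" "j \<in> Y" for i j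
      proof -
        have "j \<in> X" using that Y by auto
        then have "i \<in> X" using assms(3) that by (auto simp: closed_under_def)
        then have "(i, j) \<in> total_preorder (F @ [X - Y])" using L that \<open>j \<in> X\<close> by blast
        then show ?thesis using that by (simp add: tp)
      qed
      then show ?R using tpF by (auto simp: closed_under_def)
    next
      assume R: ?R
      show ?L
      proof (rule subrelI)
        fix i j assume "(i, j) \<in> p \<inter> X \<times> X"
        moreover have "i \<in> Y" if "j \<in> Y" using R that calculation by (auto simp: closed_under_def)
        ultimately show "(i, j) \<in> total_preorder (F @ [X - Y])" using R by (auto simp: tp)
      qed
    qed
    then show ?thesis using F FX finY assms(1) by (simp add: n bC_apply)
  qed
  have "dynkin v X (bC X (p \<inter> X \<times> X)) = ?t X [X] +
      (\<Sum>Y | Y \<noteq> {} \<and> Y \<subset> X. \<Sum>F\<in>compositions Y. ?t X (F @ [X - Y]))"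
    unfolding dynkin_def by (rule sum_compositions_last[OF assms(1,2)])
  also have "?t X [X] = 1"
    using assms by (simp add: neg_inits_def bC_apply single_in_compositions total_preorder_Cons)
  also have "(\<Sum>Y | Y \<noteq> {} \<and> Y \<subset> X. \<Sum>F\<in>compositions Y. ?t X (F @ [X - Y])) =
      (\<Sum>Y | Y \<noteq> {} \<and> Y \<subset> X. if closed_under p Y \<and> sum v Y < 0
         then - dynkin v Y (bC Y (p \<inter> Y \<times> Y)) else 0)"
  proof (rule sum.cong[OF refl])
    fix Y assume "Y \<in> {Y. Y \<noteq> {} \<and> Y \<subset> X}"
    then have eq: "(\<Sum>F\<in>compositions Y. ?t X (F @ [X - Y])) =
        (\<Sum>F\<in>compositions Y. if closed_under p Y \<and> sum v Y < 0 then - ?t Y F else 0)"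
      by (intro sum.cong[OF refl] step) auto
    show "(\<Sum>F\<in>compositions Y. ?t X (F @ [X - Y])) = (if closed_under p Y \<and> sum v Y < 0
         then - dynkin v Y (bC Y (p \<inter> Y \<times> Y)) else 0)"
    proof (cases "closed_under p Y \<and> sum v Y < 0")
      case True then show ?thesis unfolding eq dynkin_def by (simp add: sum_negf)
    next
      case False show ?thesis unfolding eq if_not_P[OF False] by simp
    qed
  qed
  also have "\<dots> = - (\<Sum>Y | Y \<noteq> {} \<and> Y \<subset> X \<and> closed_under p Y \<and> sum v Y < 0. dynkin v Y (bC Y (p \<inter> Y \<times> Y)))"
  proof -
    have "finite {Y. Y \<noteq> {} \<and> Y \<subset> X}" using assms by (auto intro: finite_subset[of _ "Pow X"])
    then show ?thesis unfolding sum_negf[symmetric]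
      by (simp add: sum.inter_filter[symmetric] conj_assoc)
  qed
  finally show ?thesis by simp
qed

text \<open>The sum is a reduced Euler characteristic of the poset of closed sets \<open>X\<close> with
  \<open>sum v X < 0\<close>. This poset is conically contractible through \<open>X \<supseteq> X \<inter> U \<subseteq> U\<close> for a
  minimizer \<open>U\<close> of \<open>sum v\<close>, by modularity of \<open>sum v\<close>.\<close>

lemma dynkin_bC_not_in_cone:
  assumes I: "finite I" "I \<noteq> {}" "p \<subseteq> I \<times> I" and v: "v \<in> adj_space I" "v \<notin> adj_cone p"
  shows "(dynkin v I (bC I p) :: 'k::field) = 0"
proof -
  define E where "E X = (dynkin v X (bC X (p \<inter> X \<times> X)) :: 'k)" for X
  define N where "N X = {Y. Y \<noteq> {} \<and> Y \<subset> X \<and> closed_under p Y \<and> sum v Y < 0}" for X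
  have fin: "finite X" if "X \<subseteq> I" for X using that I finite_subset by blast
  have finN: "finite (N X)" if "X \<subseteq> I" for X
    unfolding N_def by (rule finite_subset[of _ "Pow X"]) (use fin[OF that] in auto)
  have rec: "E X = 1 - sum E (N X)" if "X \<subseteq> I" "X \<noteq> {}" "closed_under p X" for X
    using dynkin_bC_recursion[OF fin[OF that(1)] that(2,3), where 'k='k] unfolding E_def N_def .
  have "finite p" by (rule finite_subset[OF I(3)]) (simp add: I(1))
  then have "\<not> (\<forall>U. U \<subseteq> I \<longrightarrow> closed_under p U \<longrightarrow> sum v U \<ge> 0)"
    using adj_cone_if_sums_nonneg[OF I(1) _ I(3) v(1)] v(2) by blast
  then obtain U1 where U1: "U1 \<subseteq> I" "closed_under p U1" "sum v U1 < 0"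
    unfolding not_all not_imp not_le by blast
  let ?C = "{U. U \<subseteq> I \<and> closed_under p U}"
  have finC: "finite ?C" "?C \<noteq> {}"
    using finite_subset[of ?C "Pow I"] I(1) U1(1,2) by blast+
  define U where "U = arg_min_on (sum v) ?C"
  have U: "U \<subseteq> I" "closed_under p U" "\<And>X. X \<subseteq> I \<Longrightarrow> closed_under p X \<Longrightarrow> sum v U \<le> sum v X"
    using arg_min_if_finite[OF finC, of "sum v"] unfolding U_def by (auto simp: not_less)
  have vU: "sum v U < 0" using U(3)[OF U1(1,2)] U1(3) by simp
  \<comment> \<open>By induction the members of \<open>N X\<close> that are not contained in
    \<open>U\<close> contribute zero. The members contained in \<open>U\<close> are
    \<open>X \<inter> U\<close> itself and the elements of \<open>N (X \<inter> U)\<close>, and the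
    recursion at \<open>X \<inter> U\<close> says that these contribute exactly 1. Hence the
    recursion at \<open>X\<close> gives \<open>1 - 1\<close>.\<close>
  have main: "X \<subseteq> I \<Longrightarrow> closed_under p X \<Longrightarrow> \<not> X \<subseteq> U \<Longrightarrow> X = I \<or> sum v X < 0 \<Longrightarrow> E X = 0"
    if "finite X" for X
    using that
  proof (induction X rule: finite_psubset_induct)
    case (psubset X)
    let ?Y = "X \<inter> U"
    have cl: "closed_under p ?Y" "closed_under p (X \<union> U)"
      using psubset.prems U by (auto simp: closed_under_def)
    have "sum v ?Y < 0"
    proof (cases "X = I")
      case True then show ?thesis using U(1) vU by (simp add: inf.absorb2)
    next
      case False
      have "sum v (X \<union> U) + sum v ?Y = sum v X + sum v U"
        using psubset.hyps fin[OF U(1)] by (rule sum.union_inter)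
      moreover have "sum v U \<le> sum v (X \<union> U)" using U psubset.prems cl by auto
      ultimately show ?thesis using psubset.prems False by auto
    qed
    then have Y: "?Y \<noteq> {}" "?Y \<subset> X" "?Y \<subseteq> I" using psubset.prems by auto
    have NX: "{Z \<in> N X. Z \<subseteq> U} = insert ?Y (N ?Y)"
      using Y cl \<open>sum v ?Y < 0\<close> by (auto simp: N_def)
    have "E Z = 0" if "Z \<in> N X - {Z \<in> N X. Z \<subseteq> U}" for Z
      using that psubset.prems by (intro psubset.IH) (auto simp: N_def)
    then have "sum E (N X) = sum E {Z \<in> N X. Z \<subseteq> U}"
      using finN psubset.prems by (intro sum.mono_neutral_right) auto
    also have "\<dots> = E ?Y + sum E (N ?Y)"
      unfolding NX using finN[OF Y(3)] by (subst sum.insert) (auto simp: N_def)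
    also have "\<dots> = 1" using rec[OF Y(3,1) cl(1)] by simp
    finally have "sum E (N X) = 1" .
    moreover have "X \<noteq> {}" using Y by blast
    ultimately show "E X = 0" using rec[of X] psubset.prems(1,2) by simp
  qed
  have "sum v I = 0" using v by (simp add: adj_space_def)
  then have "\<not> I \<subseteq> U" using U(1) vU by auto
  moreover have "closed_under p I" using I by (auto simp: closed_under_def)
  moreover have "p \<inter> I \<times> I = p" using I by blast
  ultimately show ?thesis using main[of I] I unfolding E_def by simp
qed

section \<open>Chambers and walls of the adjoint arrangement\<close>

definition generic :: "'a set \<Rightarrow> ('a \<Rightarrow> real) \<Rightarrow> bool" where
  "generic I v \<longleftrightarrow> v \<in> adj_space I \<and> (\<forall>R. R \<noteq> {} \<and> R \<subset> I \<longrightarrow> sum v R \<noteq> 0)"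

definition generic_wall :: "'a set \<Rightarrow> 'a set \<Rightarrow> ('a \<Rightarrow> real) \<Rightarrow> bool" where
  "generic_wall S T x \<longleftrightarrow> x \<in> adj_space (S \<union> T) \<and> sum x S = 0 \<and>
     (\<forall>R. R \<noteq> {} \<and> R \<subset> S \<union> T \<and> R \<noteq> S \<and> R \<noteq> T \<longrightarrow> sum x R \<noteq> 0)"

text \<open>For a generic point \<open>x\<close> of a wall this describes the points of the adjacent
  chamber on the side \<open>sum v S > 0\<close>. The opposite chamber is
  \<open>beside T S x\<close>, because on \<open>adj_space (S \<union> T)\<close> the sum over
  \<open>T\<close> is minus the sum over \<open>S\<close>.\<close>

definition beside :: "'a set \<Rightarrow> 'a set \<Rightarrow> ('a \<Rightarrow> real) \<Rightarrow> ('a \<Rightarrow> real) \<Rightarrow> bool" where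
  "beside S T x v \<longleftrightarrow> v \<in> adj_space (S \<union> T) \<and> sum v S > 0 \<and>
     (\<forall>R. R \<noteq> {} \<and> R \<subset> S \<union> T \<and> R \<noteq> S \<and> R \<noteq> T \<longrightarrow> sgn (sum v R) = sgn (sum x R))"

lemma mem_special_hyperplane_Diff:
  "R \<subseteq> I \<Longrightarrow> x \<in> special_hyperplane R (I - R) \<longleftrightarrow> x \<in> adj_space I \<and> sum x R = 0"
  by (simp add: special_hyperplane_def Un_absorb1)

lemma adj_chambers_eq: "adj_chambers I = {adj_face I v | v. generic I v}"
proof -
  have "v \<in> adj_space I \<and> (\<forall>R. R \<noteq> {} \<and> R \<subset> I \<longrightarrow> v \<notin> special_hyperplane R (I - R)) \<longleftrightarrow> generic I v" for v
    unfolding generic_def by (metis mem_special_hyperplane_Diff psubset_imp_subset)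
  then show ?thesis unfolding adj_chambers_def by simp
qed

lemma adj_walls_eq: "adj_walls S T = {adj_face (S \<union> T) x | x. generic_wall S T x}"
proof -
  have "x \<in> special_hyperplane S T \<and>
      (\<forall>R. R \<noteq> {} \<and> R \<subset> S \<union> T \<and> R \<noteq> S \<and> R \<noteq> T \<longrightarrow> x \<notin> special_hyperplane R (S \<union> T - R)) \<longleftrightarrow>
      generic_wall S T x" for x
    unfolding generic_wall_def
    using mem_special_hyperplane_Diff[of _ "S \<union> T" x] unfolding special_hyperplane_def[of S T]
    by (simp only: mem_Collect_eq) (metis psubset_imp_subset)
  then show ?thesis unfolding adj_walls_def by simp
qed

lemma adj_face_self: "v \<in> adj_space I \<Longrightarrow> v \<in> adj_face I v"
  by (simp add: adj_face_def)

lemma adj_face_eq: "w \<in> adj_face I v \<Longrightarrow> adj_face I w = adj_face I v"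
  by (simp add: adj_face_def)

lemma adj_face_sgn: "w \<in> adj_face I v \<Longrightarrow> R \<noteq> {} \<Longrightarrow> R \<subset> I \<Longrightarrow> sgn (sum w R) = sgn (sum v R)"
  by (simp add: adj_face_def)

lemma adj_face_space: "w \<in> adj_face I v \<Longrightarrow> w \<in> adj_space I"
  by (simp add: adj_face_def)

lemma chamberD:
  assumes "C \<in> adj_chambers I" "w \<in> C"
  shows "generic I w" "C = adj_face I w"
proof -
  obtain v where v: "C = adj_face I v" "generic I v" using assms(1) by (auto simp: adj_chambers_eq)
  then have "sum w R \<noteq> 0" if "R \<noteq> {}" "R \<subset> I" for R
    using adj_face_sgn[of w I v R] assms(2) that by (auto simp: generic_def sgn_zero_iff)
  then show "generic I w" using assms(2) v(1) adj_face_space by (auto simp: generic_def)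
  show "C = adj_face I w" using adj_face_eq assms(2) v(1) by blast
qed

lemma chamber_nonempty: "C \<in> adj_chambers I \<Longrightarrow> \<exists>w. w \<in> C"
  using adj_face_self by (fastforce simp: adj_chambers_eq generic_def)

lemma adj_face_in_chambers: "generic I v \<Longrightarrow> adj_face I v \<in> adj_chambers I"
  by (auto simp: adj_chambers_eq)

lemma dynkin_cong:
  assumes "\<And>R. R \<noteq> {} \<Longrightarrow> R \<subset> I \<Longrightarrow> sum v R < 0 \<longleftrightarrow> sum w R < 0"
  shows "dynkin v I f = dynkin w I f"
proof -
  have "neg_inits v F \<longleftrightarrow> neg_inits w F" if "F \<in> compositions I" for F
    unfolding neg_inits_def using inits_psubset[OF that] assms by meson
  then show ?thesis unfolding dynkin_def by (intro sum.cong[OF refl]) (simp only:)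
qed

lemma dynkin_adj_face:
  assumes "w \<in> adj_face I v" shows "dynkin w I f = dynkin v I f"
proof (rule dynkin_cong)
  fix R assume "R \<noteq> {}" "R \<subset> I"
  then show "sum w R < 0 \<longleftrightarrow> sum v R < 0" using adj_face_sgn[OF assms, of R] by (metis sgn_less)
qed

text \<open>A wall point \<open>x\<close> is not itself a vector over \<open>S\<close>; its
  truncation to \<open>S\<close> is. This allows the functional over \<open>S\<close> to be written
  with \<open>x\<close> in place of the truncation.\<close>

lemma dynkin_restrict:
  assumes "\<And>i. i \<in> S \<Longrightarrow> x i = y i" shows "dynkin x S f = dynkin y S f"
proof (rule dynkin_cong)
  fix R assume "R \<subset> S"
  then have "sum x R = sum y R" using assms by (intro sum.cong) auto
  then show "sum x R < 0 \<longleftrightarrow> sum y R < 0" by simp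
qed

lemma sum_adj_space:
  assumes "finite R" "x \<in> adj_space S" shows "sum x R = sum x (R \<inter> S)"
  using assms by (intro sum.mono_neutral_right) (auto simp: adj_space_def)

text \<open>The point is \<open>u + e * w\<close> for a suitable \<open>e > 0\<close>. If
  \<open>R\<close> meets \<open>T\<close> in a nonempty proper subset, then the sum over
  \<open>R\<close> vanishes for only one value of \<open>e\<close>. Otherwise \<open>R\<close> meets
  \<open>S\<close> in a nonempty proper subset, because \<open>R\<close> is none of the empty set,
  \<open>S\<close>, \<open>T\<close> and \<open>S \<union> T\<close>, and then the sum is that of
  \<open>u\<close>, which is nonzero for every \<open>e\<close>.\<close>

lemma wall_point_exists:
  assumes fin: "finite S" "finite T" and ne: "S \<noteq> {}" "T \<noteq> {}" "S \<inter> T = {}"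
    and u: "generic S u" and w: "generic T w"
  obtains x where "generic_wall S T x" "(\<lambda>i. if i \<in> S then x i else 0) \<in> adj_face S u"
    "(\<lambda>i. if i \<in> T then x i else 0) \<in> adj_face T w"
proof -
  \<comment> \<open>The value of \<open>e\<close> excluded by each \<open>R\<close>. A quotient with
    denominator zero evaluates to 0, which is harmless since \<open>e\<close> is chosen positive;
    positivity also keeps \<open>e * w\<close> in the face of \<open>w\<close>.\<close>
  define bad where "bad = (\<lambda>R. - sum u (R \<inter> S) / sum w (R \<inter> T)) ` Pow (S \<union> T)"
  have "finite bad" unfolding bad_def using fin by simp
  then have "infinite ({0<..} - bad)" using infinite_Ioi[of "0::real"] by (simp add: Diff_infinite_finite)
  then obtain e where e: "e > 0" "e \<notin> bad" using not_finite_existsD by (metis Diff_iff all_not_in_conv finite.emptyI greaterThan_iff)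
  define x where "x = (\<lambda>i. u i + e * w i)"
  have sp: "u \<in> adj_space S" "w \<in> adj_space T" using u w by (auto simp: generic_def)
  have sum_x: "sum x R = sum u (R \<inter> S) + e * sum w (R \<inter> T)" if "R \<subseteq> S \<union> T" for R
  proof -
    have "finite R" using that fin finite_subset by blast
    then show ?thesis
      unfolding x_def sum.distrib sum_distrib_left[symmetric] using sum_adj_space sp by metis
  qed
  have u0: "u i = 0" if "i \<notin> S" for i using sp that by (simp add: adj_space_def)
  have w0: "w i = 0" if "i \<notin> T" for i using sp that by (simp add: adj_space_def)
  have xS: "(\<lambda>i. if i \<in> S then x i else 0) = u"
    using u0 w0 ne(3) by (auto simp: x_def fun_eq_iff)
  have xT: "(\<lambda>i. if i \<in> T then x i else 0) = (\<lambda>i. e * w i)"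
    using u0 w0 ne(3) by (auto simp: x_def fun_eq_iff)
  have "generic_wall S T x"
    unfolding generic_wall_def
  proof (intro conjI allI impI)
    have "sum u S = 0" "sum w T = 0" using sp by (auto simp: adj_space_def)
    moreover have "(S \<union> T) \<inter> S = S" "(S \<union> T) \<inter> T = T" "S \<inter> S = S" by auto
    ultimately have "sum x (S \<union> T) = 0" "sum x S = 0"
      using sum_x[of "S \<union> T"] sum_x[of S] ne(3) by simp_all
    moreover have "x i = 0" if "i \<notin> S \<union> T" for i using that u0 w0 by (simp add: x_def)
    ultimately show "x \<in> adj_space (S \<union> T)" "sum x S = 0" by (simp_all add: adj_space_def)
    fix R assume R: "R \<noteq> {} \<and> R \<subset> S \<union> T \<and> R \<noteq> S \<and> R \<noteq> T"
    then have sub: "R \<subseteq> S \<union> T" by blast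
    show "sum x R \<noteq> 0"
    proof (cases "R \<inter> T = {} \<or> R \<inter> T = T")
      case True
      then have "R \<inter> S \<noteq> {}" "R \<inter> S \<subset> S" using R by auto
      then have "sum u (R \<inter> S) \<noteq> 0" using u by (simp add: generic_def)
      moreover have "sum w (R \<inter> T) = 0" using True sp by (auto simp: adj_space_def)
      ultimately show ?thesis using sum_x[OF sub] by simp
    next
      case False
      then have "R \<inter> T \<noteq> {}" "R \<inter> T \<subset> T" by auto
      then have nz: "sum w (R \<inter> T) \<noteq> 0" using w by (simp add: generic_def)
      have "e \<noteq> - sum u (R \<inter> S) / sum w (R \<inter> T)" using e(2) sub by (auto simp: bad_def)
      then show ?thesis using sum_x[OF sub] nz by (simp add: field_simps) 
    qed
  qed
  moreover have "(\<lambda>i. if i \<in> S then x i else 0) \<in> adj_face S u"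
    unfolding xS by (rule adj_face_self[OF sp(1)])
  moreover have "(\<lambda>i. if i \<in> T then x i else 0) \<in> adj_face T w"
    unfolding xT using sp(2) e(1)
    by (simp add: adj_face_def adj_space_def sum_distrib_left[symmetric] sgn_mult)
  ultimately show ?thesis using that by blast
qed

text \<open>Moving from \<open>x\<close> in the direction \<open>e_s - e_t\<close> with
  \<open>s \<in> S\<close> and \<open>t \<in> T\<close> makes the sum over \<open>S\<close>
  positive. A step shorter than every \<open>\<bar>sum x R\<bar>\<close> for the other sets
  \<open>R\<close> changes no other sign.\<close>

lemma beside_exists:
  assumes fin: "finite S" "finite T" and ne: "S \<noteq> {}" "T \<noteq> {}" "S \<inter> T = {}"
    and x: "generic_wall S T x"
  obtains v where "beside S T x v"
proof -
  obtain s t where st: "s \<in> S" "t \<in> T" using ne by blast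
  define A where "A = (\<lambda>R. \<bar>sum x R\<bar>) ` {R. R \<noteq> {} \<and> R \<subset> S \<union> T \<and> R \<noteq> S \<and> R \<noteq> T}"
  have "finite {R. R \<noteq> {} \<and> R \<subset> S \<union> T \<and> R \<noteq> S \<and> R \<noteq> T}"
    by (rule finite_subset[of _ "Pow (S \<union> T)"]) (use fin in auto)
  then have "finite A" by (simp add: A_def)
  \<comment> \<open>The element 1 makes the minimum range over a nonempty set even if there are no
    other sets \<open>R\<close>. Halving makes \<open>d\<close> strictly smaller than every member
    of \<open>A\<close>.\<close>
  define d where "d = Min (insert 1 A) / 2"
  have "0 < Min (insert 1 A)"
    using \<open>finite A\<close> x by (subst Min_gr_iff) (auto simp: A_def generic_wall_def)
  then have d0: "d > 0" by (simp add: d_def)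
  have dA: "d < a" if "a \<in> A" for a
  proof -
    have "Min (insert 1 A) \<le> a" using that \<open>finite A\<close> by simp
    then show ?thesis using d0 by (simp add: d_def)
  qed
  define v where "v = (\<lambda>k. x k + d * (of_bool (k = s) - of_bool (k = t)))"
  have sum_v: "sum v R = sum x R + d * (of_bool (s \<in> R) - of_bool (t \<in> R))" if "R \<subseteq> S \<union> T" for R
  proof -
    have "finite R" using that fin finite_subset by blast
    then show ?thesis
      by (simp add: v_def sum.distrib sum_subtractf sum_distrib_left[symmetric] of_bool_def)
  qed
  have "t \<notin> S" using st ne(3) by blast
  have "beside S T x v"
    unfolding beside_def
  proof (intro conjI allI impI)
    have "v i = 0" if "i \<notin> S \<union> T" for i
      using that st x by (auto simp: v_def generic_wall_def adj_space_def)
    then show "v \<in> adj_space (S \<union> T)"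
      using sum_v[of "S \<union> T"] st x by (simp add: generic_wall_def adj_space_def)
    show "sum v S > 0" using sum_v[of S] st \<open>t \<notin> S\<close> x d0 by (simp add: generic_wall_def)
    fix R assume R: "R \<noteq> {} \<and> R \<subset> S \<union> T \<and> R \<noteq> S \<and> R \<noteq> T"
    then have "d < \<bar>sum x R\<bar>" by (intro dA) (simp add: A_def)
    moreover have "\<bar>sum v R - sum x R\<bar> \<le> d" using sum_v[of R] psubset_imp_subset[of R] R d0
      by (cases "s \<in> R"; cases "t \<in> R") simp_all
    ultimately show "sgn (sum v R) = sgn (sum x R)" by (auto simp: sgn_if abs_if split: if_splits)
  qed
  then show ?thesis using that by blast
qed

lemma sum_adj_space_Un:
  assumes "finite S" "finite T" "S \<inter> T = {}" "v \<in> adj_space (S \<union> T)"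
  shows "sum v T = - sum v S"
  using assms sum.union_disjoint[of S T v] by (simp add: adj_space_def)

lemma generic_wall_commute:
  assumes "finite S" "finite T" "S \<inter> T = {}" "generic_wall S T x"
  shows "generic_wall T S x"
  using assms sum_adj_space_Un[of S T x] by (simp add: generic_wall_def Un_commute)

lemma beside_generic:
  assumes fin: "finite S" "finite T" "S \<inter> T = {}"
    and x: "generic_wall S T x" and v: "beside S T x v"
  shows "generic (S \<union> T) v"
  unfolding generic_def
proof (intro conjI allI impI)
  show sp: "v \<in> adj_space (S \<union> T)" using v by (simp add: beside_def)
  fix R assume R: "R \<noteq> {} \<and> R \<subset> S \<union> T"
  have "sum v S > 0" "sum v T < 0" using v sum_adj_space_Un[OF fin sp] by (simp_all add: beside_def)
  moreover have "sum v R \<noteq> 0" if "R \<noteq> S" "R \<noteq> T"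
  proof -
    have "sgn (sum v R) = sgn (sum x R)" "sum x R \<noteq> 0"
      using v x R that by (auto simp: beside_def generic_wall_def)
    then show ?thesis by (auto simp: sgn_zero_iff)
  qed
  ultimately show "sum v R \<noteq> 0" by fastforce
qed

text \<open>The sign of the sum over \<open>T\<close> is forced to be opposite to the one over
  \<open>S\<close>, so the conditions in \<open>adj_side\<close> fix the signs on all proper
  nonempty subsets. The side of a wall is thereby a face with a known representative.\<close>

lemma adj_side_eq:
  assumes fin: "finite S" "finite T" "S \<inter> T = {}"
    and x: "generic_wall S T x" and v: "beside S T x v"
  shows "adj_side S T (adj_face (S \<union> T) x) = adj_face (S \<union> T) v"
proof (intro equalityI subsetI)
  have xsp: "x \<in> adj_space (S \<union> T)" using x by (simp add: generic_wall_def)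
  have vsp: "v \<in> adj_space (S \<union> T)" using v by (simp add: beside_def)
  have vS: "sum v S > 0" "sum v T < 0"
    using v sum_adj_space_Un[OF fin vsp] by (simp_all add: beside_def)
  have vR: "sgn (sum v R) = sgn (sum x R)" if "R \<noteq> {} \<and> R \<subset> S \<union> T \<and> R \<noteq> S \<and> R \<noteq> T" for R
    using v that by (simp add: beside_def)
  {
    fix h assume h: "h \<in> adj_side S T (adj_face (S \<union> T) x)"
    then have hsp: "h \<in> adj_space (S \<union> T)" and hS: "sum h S > 0" by (auto simp: adj_side_def)
    have hT: "sum h T < 0" using hS sum_adj_space_Un[OF fin hsp] by simp
    have "sgn (sum h R) = sgn (sum v R)" if R: "R \<noteq> {} \<and> R \<subset> S \<union> T" for R
    proof (cases "R = S \<or> R = T")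
      case True then show ?thesis using vS hS hT by auto
    next
      case False
      then have "sgn (sum h R) = sgn (sum x R)"
        using h R adj_face_self[OF xsp] by (simp add: adj_side_def)
      then show ?thesis using vR False R by simp
    qed
    then show "h \<in> adj_face (S \<union> T) v" using hsp by (simp add: adj_face_def)
  next
    fix h assume h: "h \<in> adj_face (S \<union> T) v"
    have "S \<noteq> {}" "T \<noteq> {}" using vS by auto
    then have S: "S \<noteq> {} \<and> S \<subset> S \<union> T" using fin(3) by blast
    have "sgn (sum h S) = sgn (sum v S)" using adj_face_sgn[OF h] S by blast
    then have "sum h S > 0" using vS by (simp add: sgn_if split: if_splits)
    moreover have "sgn (sum h R) = sgn (sum y R)"
      if "R \<noteq> {} \<and> R \<subset> S \<union> T \<and> R \<noteq> S \<and> R \<noteq> T" "y \<in> adj_face (S \<union> T) x" for R y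
      using adj_face_sgn[OF h, of R] adj_face_sgn[OF that(2), of R] vR[OF that(1)] that(1) by simp
    ultimately show "h \<in> adj_side S T (adj_face (S \<union> T) x)"
      using adj_face_space[OF h] by (simp add: adj_side_def)
  }
qed

text \<open>Over a singleton the zero vector is generic. To add an element \<open>a\<close>, a wall
  point is taken over the singleton chamber and a chamber of the rest, and a point beside this wall
  is generic.\<close>

lemma generic_exists:
  assumes "finite I" "I \<noteq> {}" obtains v where "generic I v"
proof -
  have "\<exists>v. generic I v" using assms
  proof (induction rule: finite_ne_induct)
    case (singleton a)
    have "generic {a} (\<lambda>_. 0)" by (auto simp: generic_def adj_space_def)
    then show ?case by blast
  next
    case (insert a F)
    have a: "generic {a} (\<lambda>_. 0)" by (auto simp: generic_def adj_space_def)
    obtain w where w: "generic F w" using insert by blast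
    have d: "{a} \<inter> F = {}" using insert by simp
    obtain x where x: "generic_wall {a} F x"
      by (rule wall_point_exists[OF _ insert.hyps(1) _ insert.hyps(2) d a w]) auto
    obtain v where "beside {a} F x v"
      by (rule beside_exists[OF _ insert.hyps(1) _ insert.hyps(2) d x]) auto
    then have "generic ({a} \<union> F) v" using beside_generic[OF _ insert.hyps(1) d x] by simp
    then show ?case by auto
  qed
  then show ?thesis using that by blast
qed

text \<open>On this side the sum over \<open>S\<close> is negative, so the initial segment
  \<open>S\<close> satisfies its condition. Initial segments of \<open>F\<close> have the same sign
  as at \<open>x\<close>, and those of the form \<open>S \<union> U\<close> have the sign of
  \<open>sum x U\<close> because \<open>sum x S = 0\<close>. Hence the condition splits into one
  over \<open>S\<close> and one over \<open>T\<close>.\<close>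

lemma neg_inits_append_beside:
  assumes fin: "finite S" "finite T" and ne: "S \<noteq> {}" "T \<noteq> {}" "S \<inter> T = {}"
    and x: "generic_wall S T x" and w: "beside T S x w"
    and F: "F \<in> compositions S" and G: "G \<in> compositions T"
  shows "neg_inits w (F @ G) \<longleftrightarrow> neg_inits x F \<and> neg_inits x G"
proof -
  have wsp: "w \<in> adj_space (T \<union> S)" and wT: "sum w T > 0" using w by (auto simp: beside_def)
  have wS: "sum w S < 0" using sum_adj_space_Un[of T S w] fin ne wsp wT by (simp add: Int_commute)
  have xS: "sum x S = 0" using x by (simp add: generic_wall_def)
  have sg: "sum w R < 0 \<longleftrightarrow> sum x R < 0" if "R \<noteq> {} \<and> R \<subset> S \<union> T \<and> R \<noteq> S \<and> R \<noteq> T" for R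
  proof -
    have "sgn (sum w R) = sgn (sum x R)" using w that by (auto simp: beside_def Un_commute)
    then show ?thesis by (metis sgn_less)
  qed
  have F_in: "sum w U < 0 \<longleftrightarrow> sum x U < 0" if "U \<in> inits F" for U
    using inits_psubset[OF F that] ne by (intro sg) blast
  have G_in: "sum w (S \<union> U) < 0 \<longleftrightarrow> sum x U < 0" if "U \<in> inits G" for U
  proof -
    have U: "U \<noteq> {}" "U \<subset> T" using inits_psubset[OF G that] by auto
    have "sum w (S \<union> U) < 0 \<longleftrightarrow> sum x (S \<union> U) < 0" using U ne by (intro sg) blast
    moreover have "sum x (S \<union> U) = sum x S + sum x U"
      using U ne(3) fin finite_subset[of U T] by (intro sum.union_disjoint) auto
    ultimately show ?thesis using xS by simp
  qed
  have "F \<noteq> []" "G \<noteq> []" using F G ne by (auto simp: Nil_in_compositions)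
  then have "inits (F @ G) = insert S (inits F \<union> (\<lambda>U. S \<union> U) ` inits G)"
    by (simp add: inits_append Union_composition[OF F])
  then show ?thesis using wS F_in G_in by (simp add: neg_inits_def ball_Un)
qed

text \<open>Only compositions with initial segment \<open>S\<close> or \<open>T\<close> see the difference between the two
  sides of the wall.\<close>

lemma dynkin_wall:
  fixes f :: "'a set list \<Rightarrow> 'k::field"
  assumes fin: "finite S" "finite T" and ne: "S \<noteq> {}" "T \<noteq> {}" "S \<inter> T = {}"
    and x: "generic_wall S T x" and v: "beside S T x v" and w: "beside T S x w"
  shows "dynkin v (S \<union> T) f - dynkin w (S \<union> T) f =
    (\<Sum>F\<in>compositions S. \<Sum>G\<in>compositions T.
       (f (F @ G) - f (G @ F)) * dynkin x S (bM F) * dynkin x T (bM G))"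
proof -
  let ?t = "\<lambda>v H. if neg_inits v H then (-1) ^ (length H + 1) * f H else 0"
  have vS: "sum v S > 0" using v by (simp add: beside_def)
  have wT: "sum w T > 0" using w by (simp add: beside_def)
  have split: "?t v H - ?t w H = (if S \<in> inits H then - ?t w H else 0) + (if T \<in> inits H then ?t v H else 0)"
    if H: "H \<in> compositions (S \<union> T)" for H
  proof -
    \<comment> \<open>Initial segments of one composition are nested, but \<open>S\<close> and
      \<open>T\<close> are nonempty and disjoint.\<close>
    have "\<not> (S \<in> inits H \<and> T \<in> inits H)"
    proof
      assume *: "S \<in> inits H \<and> T \<in> inits H"
      then obtain F G where FG: "H = F @ G" "F \<in> compositions S" "G \<in> compositions (S \<union> T - S)"
        using inits_split[OF H] by metis
      have "S \<union> T - S = T" using ne by blast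
      then have "G \<in> compositions T" using FG(3) by simp
      then have "F \<noteq> []" "G \<noteq> []" using FG(2) ne(1,2) by (auto simp: Nil_in_compositions)
      then have "T \<in> insert S (inits F \<union> (\<lambda>U. S \<union> U) ` inits G)"
        using * FG(1) by (simp add: inits_append Union_composition[OF FG(2)])
      moreover have "T \<subset> S" if "T \<in> inits F" using inits_psubset[OF FG(2) that] by blast
      ultimately have "T = S \<or> T \<subset> S \<or> S \<subseteq> T" by blast
      then show False using ne by blast
    qed
    moreover have "\<not> neg_inits v H" if "S \<in> inits H" using that vS unfolding neg_inits_def by (meson not_less_iff_gr_or_eq)
    moreover have "\<not> neg_inits w H" if "T \<in> inits H" using that wT unfolding neg_inits_def by (meson not_less_iff_gr_or_eq)
    moreover have "neg_inits v H \<longleftrightarrow> neg_inits w H" if "S \<notin> inits H" "T \<notin> inits H"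
    proof -
      have "sum v U < 0 \<longleftrightarrow> sum w U < 0" if U: "U \<in> inits H" for U
      proof -
        have "U \<noteq> {} \<and> U \<subset> S \<union> T \<and> U \<noteq> S \<and> U \<noteq> T"
          using inits_psubset[OF H U] U \<open>S \<notin> inits H\<close> \<open>T \<notin> inits H\<close> by blast
        then have "sgn (sum v U) = sgn (sum x U)" "sgn (sum w U) = sgn (sum x U)"
          using v w by (auto simp: beside_def Un_commute)
        then show ?thesis by (metis sgn_less)
      qed
      then show ?thesis by (simp add: neg_inits_def)
    qed
    ultimately show ?thesis by (cases "S \<in> inits H"; cases "T \<in> inits H") simp_all
  qed
  have sumS: "(\<Sum>H\<in>compositions (S \<union> T). if S \<in> inits H then g H else 0) =
      (\<Sum>F\<in>compositions S. \<Sum>G\<in>compositions T. g (F @ G))"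
    if "finite S" "finite T" "S \<noteq> {}" "T \<noteq> {}" "S \<inter> T = {}" for S T and g :: "'a set list \<Rightarrow> 'k"
    using sum_compositions_append[OF that(1,2,5), of g] that
    by (simp add: sum.inter_filter[symmetric] finite_compositions)
  have "dynkin v (S \<union> T) f - dynkin w (S \<union> T) f =
      (\<Sum>H\<in>compositions (S \<union> T). if S \<in> inits H then - ?t w H else 0) +
      (\<Sum>H\<in>compositions (S \<union> T). if T \<in> inits H then ?t v H else 0)"
    unfolding dynkin_def sum_subtractf[symmetric] sum.distrib[symmetric]
    by (rule sum.cong[OF refl split])
  also have "(\<Sum>H\<in>compositions (S \<union> T). if S \<in> inits H then - ?t w H else 0) =
      (\<Sum>F\<in>compositions S. \<Sum>G\<in>compositions T. - ?t w (F @ G))"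
    by (rule sumS[OF fin ne])
  \<comment> \<open>The sign of a concatenation is minus the product of the signs of its two parts.
    Here this cancels the minus sign of the subtracted term; for the concatenations
    \<open>G @ F\<close>, which come from the side \<open>v\<close>, it remains and produces the
    cocommutator.\<close>
  also have "\<dots> = (\<Sum>F\<in>compositions S. \<Sum>G\<in>compositions T.
      f (F @ G) * dynkin x S (bM F) * dynkin x T (bM G))"
    using neg_inits_append_beside[OF fin ne x w]
    by (intro sum.cong[OF refl]) (simp add: dynkin_bM fin power_add)
  also have "(\<Sum>H\<in>compositions (S \<union> T). if T \<in> inits H then ?t v H else 0) =
      (\<Sum>G\<in>compositions T. \<Sum>F\<in>compositions S. ?t v (G @ F))"
    using sumS[of T S] fin ne by (simp add: Un_commute Int_commute)
  also have "\<dots> = (\<Sum>G\<in>compositions T. \<Sum>F\<in>compositions S.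
      - (f (G @ F) * dynkin x S (bM F) * dynkin x T (bM G)))"
    using neg_inits_append_beside[of T S x v] fin ne v generic_wall_commute[OF fin ne(3) x]
    by (intro sum.cong[OF refl]) (simp add: dynkin_bM fin power_add Int_commute)
  also have "\<dots> = (\<Sum>F\<in>compositions S. \<Sum>G\<in>compositions T.
      - (f (G @ F) * dynkin x S (bM F) * dynkin x T (bM G)))"
    by (rule sum.swap)
  finally show ?thesis
    by (simp add: sum.distrib[symmetric] left_diff_distrib)
qed

section \<open>The kernel of the adjoint realization\<close>

lemma dynkin_zero: "dynkin v I 0 = 0"
  unfolding dynkin_def by (rule sum.neutral) (simp add: zero_fun_def)

text \<open>An outer induction on \<open>I\<close> and an inner one on the first lump
  \<open>U\<close> show that \<open>a\<close> vanishes on all compositions with at least two lumps.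
  At the wall of \<open>U\<close> and \<open>I - U\<close> with \<open>i0 \<notin> U\<close>,
  everything in the wall formula cancels except the terms with first lump \<open>U\<close>, and
  these form a Dynkin functional over \<open>I - U\<close> applied to
  \<open>\<lambda>G. a (U # G)\<close>.\<close>

lemma dynkin_independent:
  fixes a :: "'a set list \<Rightarrow> 'k::field"
  assumes "finite I" "i0 \<in> I"
    and "\<And>v. generic I v \<Longrightarrow> dynkin v I a = 0"
    and "\<And>F. F \<in> compositions I \<Longrightarrow> i0 \<notin> last F \<Longrightarrow> a F = 0"
    and "F \<in> compositions I"
  shows "a F = 0"
  using assms
proof (induction I arbitrary: a F rule: finite_psubset_induct)
  case (psubset I)
  note IHI = psubset.IH and PREMS = psubset.prems and finI = psubset.hyps
  have Cons_zero: "U \<noteq> {} \<Longrightarrow> U \<subset> I \<Longrightarrow> G \<in> compositions (I - U) \<Longrightarrow> a (U # G) = 0"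
    if "finite U" for U G
    using that
  proof (induction U arbitrary: G rule: finite_psubset_induct)
    case (psubset U)
    note IH_U = psubset.IH and U = psubset.prems(1,2) and G = psubset.prems(3)
    have UI: "I - U \<noteq> {}" "U \<inter> (I - U) = {}" "U \<union> (I - U) = I" "I - U \<subset> I" using U by auto
    have finIU: "finite (I - U)" using finI by simp
    have lastG: "last (U # G') = last G'" "last G' \<subseteq> I - U" if "G' \<in> compositions (I - U)" for G'
    proof -
      have "G' \<noteq> []" using that UI(1) by (auto simp: Nil_in_compositions)
      then show "last (U # G') = last G'" "last G' \<subseteq> I - U"
        using block_composition[OF that last_in_set] by simp_all
    qed
    have UG: "U # G' \<in> compositions I" if "G' \<in> compositions (I - U)" for G'
      using that U by (simp add: Cons_in_compositions psubset_imp_subset)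
    show ?case
    proof (cases "i0 \<in> U")
      case True
      then have "i0 \<notin> last (U # G)" using lastG[OF G] by auto
      then show ?thesis using PREMS(3) UG[OF G] by blast
    next
      case False
      \<comment> \<open>All Dynkin functionals over \<open>I - U\<close> kill the slice at first
        lump \<open>U\<close>, so the outer induction hypothesis applies to it. A wall over
        \<open>w\<close> and any generic \<open>u\<close> over \<open>U\<close> is used.\<close>
      have step: "dynkin w (I - U) (\<lambda>G. a (U # G)) = 0" if w: "generic (I - U) w" for w
      proof -
        obtain u where u: "generic U u" using generic_exists[OF psubset.hyps U(1)] by blast
        obtain x where x: "generic_wall U (I - U) x"
          and xw: "(\<lambda>i. if i \<in> I - U then x i else 0) \<in> adj_face (I - U) w"
          by (rule wall_point_exists[OF psubset.hyps finIU U(1) UI(1,2) u w])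
        have x': "generic_wall (I - U) U x"
          by (rule generic_wall_commute[OF psubset.hyps finIU UI(2) x])
        obtain v where v: "beside U (I - U) x v"
          by (rule beside_exists[OF psubset.hyps finIU U(1) UI(1,2) x])
        obtain v' where v': "beside (I - U) U x v'"
          by (rule beside_exists[OF finIU psubset.hyps UI(1) U(1) _ x']) (use UI in blast)
        have gv: "generic I v"
          using beside_generic[OF psubset.hyps finIU UI(2) x v] UI(3) by simp
        have "generic ((I - U) \<union> U) v'"
          by (rule beside_generic[OF finIU psubset.hyps _ x' v']) (use UI in blast)
        then have gv': "generic I v'" using UI(3) by (simp only: Un_commute)
        \<comment> \<open>The term \<open>G @ F\<close> ends in a lump inside \<open>U\<close>,
          which misses \<open>i0\<close>. If \<open>F\<close> is not \<open>[U]\<close>, then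
          \<open>F @ G\<close> starts with a smaller lump and is covered by the inner induction. On
          \<open>M\<close> at \<open>[U]\<close> the functional is 1.\<close>
        have summand: "(a (F @ G) - a (G @ F)) * dynkin x U (bM F) * dynkin x (I - U) (bM G) =
            (if F = [U] then a (U # G) * dynkin x (I - U) (bM G) else 0)"
          if F: "F \<in> compositions U" and G: "G \<in> compositions (I - U)" for F G
        proof -
          have "F \<noteq> []" using F U by (auto simp: Nil_in_compositions)
          then have "last (G @ F) \<subseteq> U" using block_composition[OF F last_in_set] by simp
          then have "i0 \<notin> last (G @ F)" using False by blast
          moreover have "(I - U) \<union> U = I" using UI by blast
          then have "G @ F \<in> compositions I"
            using append_compositions_disjoint[OF G F] UI(2) by (simp add: Int_commute)
          ultimately have GF: "a (G @ F) = 0" using PREMS(3) by blast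
          show ?thesis
          proof (cases "F = [U]")
            case True
            then have "dynkin x U (bM F) = (1::'k)"
              using F psubset.hyps by (simp add: dynkin_bM neg_inits_def)
            then show ?thesis using True GF by simp
          next
            case False
            obtain B F' where BF: "F = B # F'" using \<open>F \<noteq> []\<close> by (cases F) auto
            then have B: "B \<noteq> {}" "B \<subseteq> U" "F' \<in> compositions (U - B)"
              using F by (auto simp: Cons_in_compositions)
            have "B \<noteq> U" using B(3) False BF by (auto simp: compositions_empty)
            then have "B \<subset> U" "B \<subset> I" using B U by auto
            have "B # (F' @ G) \<in> compositions I"
              using append_compositions_disjoint[OF F G UI(2)] UI(3) BF by simp
            then have "F' @ G \<in> compositions (I - B)" by (simp add: Cons_in_compositions)
            then have "a (F @ G) = 0" using IH_U[OF \<open>B \<subset> U\<close> B(1) \<open>B \<subset> I\<close>] BF by simp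
            then show ?thesis using False GF by simp
          qed
        qed
        have "0 = dynkin v (U \<union> (I - U)) a - dynkin v' (U \<union> (I - U)) a"
          unfolding UI(3) using PREMS(2) gv gv' by simp
        also have "\<dots> = (\<Sum>F\<in>compositions U. \<Sum>G\<in>compositions (I - U).
            (a (F @ G) - a (G @ F)) * dynkin x U (bM F) * dynkin x (I - U) (bM G))"
          by (rule dynkin_wall[OF psubset.hyps finIU U(1) UI(1,2) x v v'])
        also have "\<dots> = (\<Sum>F\<in>compositions U. \<Sum>G\<in>compositions (I - U).
            if F = [U] then a (U # G) * dynkin x (I - U) (bM G) else 0)"
          by (intro sum.cong[OF refl] summand)
        also have "\<dots> = (\<Sum>G\<in>compositions (I - U). a (U # G) * dynkin x (I - U) (bM G))"
          using finite_compositions[OF psubset.hyps] U(1)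
          by (subst sum.swap) (simp add: single_in_compositions)
        also have "\<dots> = dynkin x (I - U) (\<lambda>G. a (U # G))"
          by (rule dynkin_expand[OF finIU, symmetric])
        also have "\<dots> = dynkin (\<lambda>i. if i \<in> I - U then x i else 0) (I - U) (\<lambda>G. a (U # G))"
          by (rule dynkin_restrict) simp
        also have "\<dots> = dynkin w (I - U) (\<lambda>G. a (U # G))" by (rule dynkin_adj_face[OF xw])
        finally show ?thesis by simp
      qed
      show ?thesis
      proof (rule IHI[OF UI(4) _ step _ G])
        show "i0 \<in> I - U" using False PREMS(1) by blast
        fix G' assume "G' \<in> compositions (I - U)" "i0 \<notin> last G'"
        then show "a (U # G') = 0" using PREMS(3) UG lastG(1) by metis
      qed
    qed
  qed
  have nonsingle: "a G = 0" if G: "G \<in> compositions I" "G \<noteq> [I]" for G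
  proof -
    obtain B G' where BG: "G = B # G'" 
      using G(1) psubset.prems(1) by (cases G) (auto simp: Nil_in_compositions)
    then have B: "B \<noteq> {}" "B \<subseteq> I" "G' \<in> compositions (I - B)"
      using G(1) by (auto simp: Cons_in_compositions)
    have "B \<noteq> I" using B(3) G(2) BG by (auto simp: compositions_empty)
    then have "B \<subset> I" "finite B" using B(2) psubset.hyps finite_subset by auto
    then show ?thesis using Cons_zero[of B G'] B BG by blast
  qed
  have I: "I \<noteq> {}" using psubset.prems(1) by blast
  obtain v where v: "generic I v" using generic_exists[OF psubset.hyps I] by blast
  \<comment> \<open>Any single Dynkin functional now detects the last coefficient, since its value
    on \<open>M\<close> at \<open>[I]\<close> is 1.\<close>
  have "0 = (\<Sum>G\<in>compositions I. a G * dynkin v I (bM G))"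
    using psubset.prems(2)[OF v] dynkin_expand[OF psubset.hyps, of v a] by simp
  also have "\<dots> = (\<Sum>G\<in>compositions I. if G = [I] then a [I] else 0)"
  proof (intro sum.cong[OF refl])
    fix G assume G: "G \<in> compositions I"
    show "a G * dynkin v I (bM G) = (if G = [I] then a [I] else 0)"
    proof (cases "G = [I]")
      case True then show ?thesis using G psubset.hyps by (simp add: dynkin_bM neg_inits_def)
    next
      case False then show ?thesis using nonsingle[OF G] by simp
    qed
  qed
  also have "\<dots> = a [I]"
    using finite_compositions[OF psubset.hyps] I by (simp add: single_in_compositions)
  finally show ?case using nonsingle psubset.prems(4) by metis
qed

section \<open>Spanning families of \<open>Sig I\<close>\<close>

lemma Sig_subspace: "fun_vs.subspace (Sig I)"
  by (auto simp: fun_vs.subspace_def Sig_def fscale_def)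

lemma bM_in_Sig: "F \<in> compositions I \<Longrightarrow> bM F \<in> Sig I"
  by (auto simp: Sig_def bM_def)

lemma Sig_expand:
  assumes "finite I" "f \<in> Sig I"
  shows "f = (\<Sum>F\<in>compositions I. fscale (f F) (bM F))"
proof
  fix G
  have "(\<Sum>F\<in>compositions I. fscale (f F) (bM F)) G = (\<Sum>F\<in>compositions I. if G = F then f F else 0)"
    unfolding sum_fun_apply by (rule sum.cong) (auto simp: fscale_def bM_def)
  then show "f G = (\<Sum>F\<in>compositions I. fscale (f F) (bM F)) G"
    using finite_compositions[OF assms(1)] assms(2) by (simp add: Sig_def)
qed

text \<open>This and its variants serve as induction principles: \<open>V\<close> is taken to be the
  subspace on which a linear identity holds.\<close>

lemma Sig_subset_if_bM:
  assumes "finite I" "fun_vs.subspace V" "\<And>F. F \<in> compositions I \<Longrightarrow> bM F \<in> V"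
  shows "Sig I \<subseteq> V"
proof
  fix f :: "'a set list \<Rightarrow> 'b" assume "f \<in> Sig I"
  then have "f = (\<Sum>F\<in>compositions I. fscale (f F) (bM F))" by (rule Sig_expand[OF assms(1)])
  moreover have "(\<Sum>F\<in>compositions I. fscale (f F) (bM F)) \<in> V"
    using assms by (intro fun_vs.subspace_sum fun_vs.subspace_scale)
  ultimately show "f \<in> V" by simp
qed

text \<open>A family that is unitriangular over the \<open>M\<close> basis for the refinement order
  spans. The induction runs over the number of pairs missing from the preorder of \<open>F\<close>,
  which drops under proper coarsening. Free coefficients \<open>c\<close> let one proof serve both
  the \<open>C\<close> and the \<open>P\<close> family.\<close>

lemma Sig_subset_if_triangular:
  assumes I: "finite I" and V: "fun_vs.subspace V"
    and b: "\<And>F. F \<in> compositions I \<Longrightarrow>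
      (\<Sum>G | G \<in> compositions I \<and> total_preorder F \<subseteq> total_preorder G. fscale (c F G) (bM G)) \<in> V"
    and c: "\<And>F. F \<in> compositions I \<Longrightarrow> c F F = 1"
  shows "Sig I \<subseteq> V"
proof (rule Sig_subset_if_bM[OF I V])
  fix F assume "F \<in> compositions I"
  then show "bM F \<in> V"
  proof (induction "card (I \<times> I - total_preorder F)" arbitrary: F rule: less_induct)
    case less
    let ?A = "{G. G \<in> compositions I \<and> total_preorder F \<subseteq> total_preorder G}"
    have fin: "finite ?A" using finite_compositions[OF I] by simp
    have FA: "F \<in> ?A" using less.prems by simp
    have "bM G \<in> V" if G: "G \<in> ?A - {F}" for G
    proof (rule less.hyps)
      show "G \<in> compositions I" using G by simp
      have "total_preorder F \<noteq> total_preorder G"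
        using total_preorder_inj[OF less.prems, of G] G by auto
      then have "total_preorder F \<subset> total_preorder G" using G by auto
      moreover have "total_preorder G \<subseteq> I \<times> I"
        using total_preorder_subset[of G] Union_composition[of G I] G by simp
      ultimately have "I \<times> I - total_preorder G \<subset> I \<times> I - total_preorder F" by blast
      then show "card (I \<times> I - total_preorder G) < card (I \<times> I - total_preorder F)"
        using I by (intro psubset_card_mono) auto
    qed
    then have "(\<Sum>G\<in>?A - {F}. fscale (c F G) (bM G)) \<in> V"
      using V by (intro fun_vs.subspace_sum fun_vs.subspace_scale)
    moreover have eq: "(\<Sum>G\<in>?A. fscale (c F G) (bM G)) =
        bM F + (\<Sum>G\<in>?A - {F}. fscale (c F G) (bM G))"
      using c[OF less.prems] by (simp add: sum.remove[OF fin FA])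
    ultimately have "bM F + (\<Sum>G\<in>?A - {F}. fscale (c F G) (bM G)) -
        (\<Sum>G\<in>?A - {F}. fscale (c F G) (bM G)) \<in> V"
      using b[OF less.prems] unfolding eq by (intro fun_vs.subspace_diff[OF V])
    then show ?case by simp
  qed
qed

lemma Sig_subset_if_bC:
  assumes "finite I" "fun_vs.subspace V" "\<And>p. preorder_on I p \<Longrightarrow> bC I p \<in> V"
  shows "Sig I \<subseteq> V"
proof (rule Sig_subset_if_triangular[OF assms(1,2), where c = "\<lambda>_ _. 1"])
  fix F assume "F \<in> compositions I"
  then have "bC I (total_preorder F) \<in> V" using assms(3) preorder_on_total_preorder by blast
  then show "(\<Sum>G | G \<in> compositions I \<and> total_preorder F \<subseteq> total_preorder G. fscale 1 (bM G)) \<in> V"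
    by (simp add: bC_def)
qed simp

section \<open>Restriction of compositions and products\<close>

lemma restr_append: "restr (F @ G) S = restr F S @ restr G S"
  by (simp add: restr_def)

lemma restr_Cons: "restr (B # F) S = (if B \<inter> S = {} then [] else [B \<inter> S]) @ restr F S"
  by (simp add: restr_def)

lemma restr_disjoint: "\<Union>(set F) \<inter> S = {} \<Longrightarrow> restr F S = []"
  by (induction F) (auto simp: restr_def)

lemma restr_eq_Nil: "restr F S = [] \<Longrightarrow> \<Union>(set F) \<inter> S = {}"
  by (induction F) (auto simp: restr_Cons split: if_splits)

lemma restr_self: "F \<in> compositions I \<Longrightarrow> I \<subseteq> S \<Longrightarrow> restr F S = F"
proof (induction F arbitrary: I)
  case (Cons B F)
  then have "B \<noteq> {}" "B \<inter> S = B" "F \<in> compositions (I - B)" "I - B \<subseteq> S"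
    by (auto simp: Cons_in_compositions)
  then show ?case using Cons.IH[of "I - B"] by (simp add: restr_Cons)
qed (simp add: restr_def)

lemma restr_in_compositions: "F \<in> compositions I \<Longrightarrow> restr F S \<in> compositions (I \<inter> S)"
proof (induction F arbitrary: I)
  case Nil then show ?case by (simp add: Nil_in_compositions restr_def)
next
  case (Cons B F)
  then have B: "B \<subseteq> I" and IH: "restr F S \<in> compositions ((I - B) \<inter> S)"
    by (auto simp: Cons_in_compositions)
  show ?case
  proof (cases "B \<inter> S = {}")
    case True
    then have "(I - B) \<inter> S = I \<inter> S" by blast
    then show ?thesis using IH True by (simp add: restr_Cons)
  next
    case False
    have "(I - B) \<inter> S = I \<inter> S - B \<inter> S" by blast
    then show ?thesis using IH False B by (auto simp: restr_Cons Cons_in_compositions)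
  qed
qed

lemma Union_restr: "\<Union>(set (restr F S)) = \<Union>(set F) \<inter> S"
  by (induction F) (auto simp: restr_def)

lemma total_preorder_restr: "total_preorder (restr F S) = total_preorder F \<inter> S \<times> S"
proof (induction F)
  case (Cons B F)
  then show ?case
    by (cases "B \<inter> S = {}") (auto simp: restr_Cons total_preorder_Cons Union_restr)
qed (simp add: restr_def)

text \<open>The preorder of a restriction is the restricted preorder, so \<open>H\<close> contains
  \<open>p \<union> q\<close> exactly if its two restrictions contain \<open>p\<close> and
  \<open>q\<close>. The product of two cone functions is therefore again a cone function.\<close>

lemma Sig_mult_bC:
  assumes "finite S" "finite T" "p \<subseteq> S \<times> S" "q \<subseteq> T \<times> T"
  shows "Sig_mult S T (bC S p) (bC T q) = bC (S \<union> T) (p \<union> q)"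
proof
  fix H
  show "Sig_mult S T (bC S p) (bC T q) H = bC (S \<union> T) (p \<union> q) H"
  proof (cases "H \<in> compositions (S \<union> T)")
    case True
    have "(S \<union> T) \<inter> S = S" "(S \<union> T) \<inter> T = T" by auto
    then have "restr H S \<in> compositions S" "restr H T \<in> compositions T"
      using restr_in_compositions[OF True, of S] restr_in_compositions[OF True, of T] by simp_all
    then show ?thesis
      using assms True by (simp add: Sig_mult_def bC_apply total_preorder_restr)
  next
    case False then show ?thesis using assms by (simp add: Sig_mult_def bC_apply)
  qed
qed

lemma dynkin_Sig_mult:
  assumes fin: "finite S" "finite T" and ne: "S \<noteq> {}" "T \<noteq> {}" "S \<inter> T = {}"
    and v: "generic (S \<union> T) v" and f: "f \<in> Sig S" and g: "g \<in> Sig T"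
  shows "dynkin v (S \<union> T) (Sig_mult S T f g) = 0"
proof -
  have addl: "Sig_mult S T (f + f') g = Sig_mult S T f g + Sig_mult S T f' g"
    and addr: "Sig_mult S T f (g + g') = Sig_mult S T f g + Sig_mult S T f g'"
    and scl: "Sig_mult S T (fscale c f) g = fscale c (Sig_mult S T f g)"
    and scr: "Sig_mult S T f (fscale c g) = fscale c (Sig_mult S T f g)"
    for f f' g g' :: "'a set list \<Rightarrow> 'b" and c
    by (auto simp: Sig_mult_def fun_eq_iff fscale_def algebra_simps)
  have zl: "Sig_mult S T 0 g = 0" and zr: "Sig_mult S T f 0 = 0" for f g :: "'a set list \<Rightarrow> 'b"
    by (auto simp: Sig_mult_def fun_eq_iff)
  have bC: "dynkin v (S \<union> T) (Sig_mult S T (bC S p) (bC T q)) = (0::'b)"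
    if p: "preorder_on S p" and q: "preorder_on T q" for p q
  proof -
    have pq: "p \<subseteq> S \<times> S" "q \<subseteq> T \<times> T" using p q by (auto simp: preorder_on_def)
    have vsp: "v \<in> adj_space (S \<union> T)" using v by (simp add: generic_def)
    have "closed_under (p \<union> q) S" "closed_under (p \<union> q) T"
      using pq ne(3) by (auto simp: closed_under_def)
    then have "v \<in> adj_cone (p \<union> q) \<Longrightarrow> sum v S \<ge> 0 \<and> sum v T \<ge> 0"
      using adj_cone_sum_nonneg fin by blast
    moreover have "sum v T = - sum v S" by (rule sum_adj_space_Un[OF fin ne(3) vsp])
    moreover have "sum v S \<noteq> 0"
    proof -
      have "S \<noteq> {} \<and> S \<subset> S \<union> T" using ne by blast
      then show ?thesis using v by (simp add: generic_def)
    qed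
    ultimately have "v \<notin> adj_cone (p \<union> q)" by auto
    then have "dynkin v (S \<union> T) (bC (S \<union> T) (p \<union> q)) = (0::'b)"
      using fin ne pq vsp by (intro dynkin_bC_not_in_cone) auto
    then show ?thesis by (simp add: Sig_mult_bC[OF fin pq])
  qed
  \<comment> \<open>Bilinearity is used one factor at a time: the first factor is freed while the
    second is still a cone function, then the second is freed with the first fixed.\<close>
  let ?V = "{f. \<forall>q. preorder_on T q \<longrightarrow> dynkin v (S \<union> T) (Sig_mult S T f (bC T q)) = (0::'b)}"
  have "fun_vs.subspace ?V"
    by (auto simp: fun_vs.subspace_def addl scl zl dynkin_zero dynkin_add dynkin_fscale)
  then have "Sig S \<subseteq> ?V" using bC by (intro Sig_subset_if_bC[OF fin(1)]) auto
  then have *: "dynkin v (S \<union> T) (Sig_mult S T f (bC T q)) = 0" if "preorder_on T q" for q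
    using f that by blast
  let ?W = "{g. dynkin v (S \<union> T) (Sig_mult S T f g) = (0::'b)}"
  have "fun_vs.subspace ?W"
    by (auto simp: fun_vs.subspace_def addr scr zr dynkin_zero dynkin_add dynkin_fscale)
  then have "Sig T \<subseteq> ?W" using * by (intro Sig_subset_if_bC[OF fin(2)]) auto
  then show ?thesis using g by blast
qed

lemma decomposables_subspace: "fun_vs.subspace (decomposables I)"
  by (simp add: decomposables_def)

lemma decomposables_subset_Sig: "decomposables I \<subseteq> Sig I"
  unfolding decomposables_def
  by (rule fun_vs.span_minimal[OF _ Sig_subspace]) (auto simp: Sig_mult_def Sig_def)

lemma dynkin_decomposables:
  assumes "finite I" "generic I v" "f \<in> decomposables I"
  shows "dynkin v I f = 0"
proof -
  have "fun_vs.subspace {f. dynkin v I f = 0}"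
    by (auto simp: fun_vs.subspace_def dynkin_add dynkin_fscale dynkin_zero)
  then have "decomposables I \<subseteq> {f. dynkin v I f = 0}"
    unfolding decomposables_def using assms(1,2)
    by (intro fun_vs.span_minimal) (auto intro!: dynkin_Sig_mult)
  then show ?thesis using assms(3) by blast
qed

text \<open>In the quasishuffle product of \<open>A @ [B]\<close> and \<open>D\<close> with \<open>i0 \<in> B\<close>, the part after the lump of
  \<open>i0\<close> is a suffix of \<open>D\<close>, and it is all of \<open>D\<close> only for \<open>A @ [B] @ D\<close>.\<close>

lemma quasishuffle_tail:
  assumes "H \<in> compositions (S \<union> T)" "S \<inter> T = {}"
    and S: "restr H S = A @ [B]" and T: "restr H T = D" and "i0 \<in> B"
    and H: "H = A' @ [B'] @ D'" "i0 \<in> B'" and len: "length D' \<ge> length D"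
  shows "H = A @ [B] @ D"
proof -
  have U: "\<Union>(set H) = S \<union> T" by (rule Union_composition[OF assms(1)])
  have "B \<subseteq> S" using Union_restr[of H S] S by auto
  then have i0S: "i0 \<in> S" using assms(5) by blast
  obtain X where X: "A' @ [B'] \<in> compositions X" "D' \<in> compositions (S \<union> T - X)" "X \<subseteq> S \<union> T"
  proof -
    have "(A' @ [B']) @ D' \<in> compositions (S \<union> T)" using assms(1) H by simp
    then obtain X Y where "A' @ [B'] \<in> compositions X" "D' \<in> compositions Y" "X \<inter> Y = {}" "X \<union> Y = S \<union> T"
      unfolding append_in_compositions by blast
    moreover from this have "Y = S \<union> T - X" by blast
    ultimately show ?thesis using that by auto
  qed
  have B'X: "i0 \<in> X" using X(1) H(2) Union_composition[OF X(1)] by auto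
  have H_eq: "H = (A' @ [B']) @ D'" using H(1) by simp
  have rS: "restr (A' @ [B']) S @ restr D' S = A @ [B]"
    using S unfolding H_eq restr_append[of "A' @ [B']"] .
  \<comment> \<open>Otherwise the last lump of \<open>restr H S\<close>, which is \<open>B\<close>,
    would come from \<open>D'\<close>, although \<open>i0 \<in> B\<close> already lies in the
    earlier lump \<open>B'\<close>.\<close>
  have D'S: "restr D' S = []"
  proof (rule ccontr)
    assume "restr D' S \<noteq> []"
    then have "last (restr D' S) = B" using rS by (metis last_appendR last_snoc)
    then have "i0 \<in> \<Union>(set (restr D' S))" using assms(5) last_in_set[OF \<open>restr D' S \<noteq> []\<close>] by blast
    then show False using Union_restr[of D' S] Union_composition[OF X(2)] B'X by blast
  qed
  then have "\<Union>(set D') \<inter> S = {}" by (rule restr_eq_Nil)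
  then have "S \<union> T - X \<subseteq> T" using Union_composition[OF X(2)] by blast
  then have D'T: "restr D' T = D'" by (rule restr_self[OF X(2)])
  have "restr (A' @ [B']) T @ D' = D"
    using T D'T unfolding H_eq restr_append[of "A' @ [B']"] by simp
  then have rT: "restr (A' @ [B']) T = []" and "D' = D" using len by auto
  have "\<Union>(set (A' @ [B'])) \<inter> T = {}" by (rule restr_eq_Nil[OF rT])
  then have "X \<subseteq> S" using Union_composition[OF X(1)] X(3) by blast
  then have "restr (A' @ [B']) S = A' @ [B']" by (rule restr_self[OF X(1)])
  then show ?thesis using rS D'S H(1) \<open>D' = D\<close> by simp
qed

text \<open>A straightening argument: \<open>M\<close> at \<open>A @ [B] @ D\<close> is one term of
  the quasishuffle product of \<open>A @ [B]\<close> and \<open>D\<close>, and in every other term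
  fewer lumps follow the lump of \<open>i0\<close>. Modulo products it is minus the sum of those
  terms, and the induction on \<open>length D\<close> ends at compositions whose last lump contains
  \<open>i0\<close>.\<close>

lemma Sig_subset_decomposables_plus_last:
  fixes V :: "('a set list \<Rightarrow> 'k::field) set"
  assumes I: "finite I" and i0: "i0 \<in> I" and V: "fun_vs.subspace V" "decomposables I \<subseteq> V"
    and last: "\<And>F. F \<in> compositions I \<Longrightarrow> i0 \<in> last F \<Longrightarrow> bM F \<in> V"
  shows "Sig I \<subseteq> V"
proof (rule Sig_subset_if_bM[OF I V(1)])
  have main: "bM (A @ [B] @ D) \<in> V" if "A @ [B] @ D \<in> compositions I" "i0 \<in> B" for A B D
    using that
  proof (induction "length D" arbitrary: A B D rule: less_induct)
    case less
    show ?case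
    proof (cases "D = []")
      case True
      then show ?thesis using less.prems last[of "A @ [B]"] by simp
    next
      case False
      have "(A @ [B]) @ D \<in> compositions I" using less.prems by simp
      then obtain S T where AB: "A @ [B] \<in> compositions S" and D: "D \<in> compositions T"
        and ST: "S \<inter> T = {}" "S \<union> T = I"
        unfolding append_in_compositions by blast
      have ne: "S \<noteq> {}" "T \<noteq> {}" using AB D False by (auto simp: compositions_empty)
      let ?A = "{H \<in> compositions I. restr H S = A @ [B] \<and> restr H T = D}"
      have finA: "finite ?A" using finite_compositions[OF I] by simp
      have "restr (A @ [B]) S = A @ [B]" "restr D T = D"
        using restr_self[OF AB] restr_self[OF D] by simp_all
      moreover have "restr (A @ [B]) T = []" "restr D S = []"
        using ST Union_composition[OF AB] Union_composition[OF D]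
        by (intro restr_disjoint; blast)+
      ultimately have "restr ((A @ [B]) @ D) S = A @ [B]" "restr ((A @ [B]) @ D) T = D"
        unfolding restr_append by simp_all
      then have mem: "A @ [B] @ D \<in> ?A" using less.prems(1) by simp
      have others: "bM H \<in> V" if H: "H \<in> ?A - {A @ [B] @ D}" for H
      proof -
        have HI: "H \<in> compositions (S \<union> T)" using H ST by simp
        have "i0 \<in> \<Union>(set H)" using Union_composition[OF HI] ST(2) i0 by simp
        then obtain B' where "B' \<in> set H" "i0 \<in> B'" by blast
        then obtain A' D' where H': "H = A' @ [B'] @ D'" using split_list by fastforce
        have "length D' < length D"
        proof (rule ccontr)
          assume "\<not> length D' < length D"
          then have "H = A @ [B] @ D"
            using quasishuffle_tail[OF HI ST(1) _ _ less.prems(2) H' \<open>i0 \<in> B'\<close>] H by simp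
          then show False using H by simp
        qed
        then show ?thesis using less.hyps[of D' A' B'] H' HI ST(2) \<open>i0 \<in> B'\<close> by simp
      qed
      have "Sig_mult S T (bM (A @ [B])) (bM D) \<in> decomposables I"
        unfolding decomposables_def using ne ST bM_in_Sig[OF AB] bM_in_Sig[OF D]
        by (intro fun_vs.span_base) blast
      moreover have "Sig_mult S T (bM (A @ [B])) (bM D) = (\<Sum>H\<in>?A. bM H :: _ \<Rightarrow> 'k)"
      proof
        fix H
        have "(\<Sum>H\<in>?A. bM H :: _ \<Rightarrow> 'k) H = (\<Sum>H'\<in>?A. if H = H' then 1 else 0)"
          unfolding sum_fun_apply bM_def ..
        also have "\<dots> = (if H \<in> ?A then 1 else 0)" using finA by (rule sum.delta')
        finally show "Sig_mult S T (bM (A @ [B])) (bM D) H = (\<Sum>H\<in>?A. bM H :: _ \<Rightarrow> 'k) H"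
          using ST(2) by (simp add: Sig_mult_def bM_def)
      qed
      moreover have "(\<Sum>H\<in>?A. bM H :: _ \<Rightarrow> 'k) = bM (A @ [B] @ D) + (\<Sum>H\<in>?A - {A @ [B] @ D}. bM H)"
        by (rule sum.remove[OF finA mem])
      moreover have "(\<Sum>H\<in>?A - {A @ [B] @ D}. bM H) \<in> V"
        by (rule fun_vs.subspace_sum[OF V(1) others])
      ultimately have "bM (A @ [B] @ D) + (\<Sum>H\<in>?A - {A @ [B] @ D}. bM H) -
          (\<Sum>H\<in>?A - {A @ [B] @ D}. bM H) \<in> V"
        using V by (intro fun_vs.subspace_diff[OF V(1)]) auto
      then show ?thesis by simp
    qed
  qed
  fix F assume F: "F \<in> compositions I"
  then have "i0 \<in> \<Union>(set F)" using Union_composition i0 by blast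
  then obtain B where "B \<in> set F" "i0 \<in> B" by blast
  then obtain A D where "F = A @ [B] @ D" using split_list by fastforce
  then show "bM F \<in> V" using main F \<open>i0 \<in> B\<close> by blast
qed

text \<open>Spanning and independence are combined: \<open>f\<close> is a decomposable plus an
  \<open>n\<close> supported on compositions whose last lump contains \<open>i0\<close>. The
  functionals kill the decomposable part, hence also \<open>n\<close>, and independence gives
  \<open>n = 0\<close>.\<close>

lemma decomposables_if_dynkin_zero:
  fixes f :: "'a set list \<Rightarrow> 'k::field"
  assumes I: "finite I" "I \<noteq> {}" and f: "f \<in> Sig I" "\<And>v. generic I v \<Longrightarrow> dynkin v I f = 0"
  shows "f \<in> decomposables I"
proof -
  obtain i0 where i0: "i0 \<in> I" using I by blast
  define N :: "('a set list \<Rightarrow> 'k) set" where "N = {n \<in> Sig I. \<forall>F. i0 \<notin> last F \<longrightarrow> n F = 0}"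
  have N: "fun_vs.subspace N"
    by (auto simp: fun_vs.subspace_def N_def Sig_def fscale_def)
  let ?V = "{d + n | d n. d \<in> decomposables I \<and> n \<in> N}"
  have "Sig I \<subseteq> ?V"
  proof (rule Sig_subset_decomposables_plus_last[OF I(1) i0])
    show "fun_vs.subspace ?V" by (rule fun_vs.subspace_sums[OF decomposables_subspace N])
    show "decomposables I \<subseteq> ?V"
    proof
      fix d :: "'a set list \<Rightarrow> 'k" assume "d \<in> decomposables I"
      moreover have "0 \<in> N" by (rule fun_vs.subspace_0[OF N])
      moreover have "d = d + 0" by simp
      ultimately show "d \<in> ?V" by blast
    qed
    fix F assume F: "F \<in> compositions I" "i0 \<in> last F"
    have "bM F \<in> N" using F bM_in_Sig by (auto simp: N_def bM_def)
    moreover have "0 \<in> decomposables I" by (rule fun_vs.subspace_0[OF decomposables_subspace])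
    moreover have "bM F = 0 + (bM F :: _ \<Rightarrow> 'k)" by simp
    ultimately show "bM F \<in> ?V" by blast
  qed
  then obtain d n where dn: "f = d + n" "d \<in> decomposables I" "n \<in> N" using f(1) by blast
  have "dynkin v I n = 0" if "generic I v" for v
    using f(2)[OF that] dynkin_decomposables[OF I(1) that dn(2)] dn(1) by (simp add: dynkin_add)
  then have "n F = 0" if "F \<in> compositions I" for F
    using dynkin_independent[OF I(1) i0 _ _ that, of n] dn(3) by (simp add: N_def)
  then have "n = 0" using dn(3) by (auto simp: N_def Sig_def fun_eq_iff)
  then show ?thesis using dn by simp
qed

section \<open>The adjoint realization map\<close>

lemma fscale_apply: "fscale c f x = c * f x"
  by (simp add: fscale_def)

lemma Sig_add: "f \<in> Sig I \<Longrightarrow> g \<in> Sig I \<Longrightarrow> f + g \<in> Sig I"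
  by (rule fun_vs.subspace_add[OF Sig_subspace])

lemma Sig_scale: "f \<in> Sig I \<Longrightarrow> fscale c f \<in> Sig I"
  by (rule fun_vs.subspace_scale[OF Sig_subspace])

text \<open>The chosen point is immaterial, since a Dynkin functional depends only on the signs of
  the sums and is constant on each chamber.\<close>

definition dynkin_map :: "'a set \<Rightarrow> ('a set list \<Rightarrow> 'k::field) \<Rightarrow> ('a \<Rightarrow> real) set \<Rightarrow> 'k" where
  "dynkin_map I f = (\<lambda>C. if C \<in> adj_chambers I then dynkin (SOME v. v \<in> C) I f else 0)"

lemma dynkin_map_chamber:
  assumes "C \<in> adj_chambers I" "v \<in> C"
  shows "dynkin_map I f C = dynkin v I f"
proof -
  have "(SOME v. v \<in> C) \<in> C" using assms(2) by (rule someI[of "\<lambda>v. v \<in> C"])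
  then have "(SOME v. v \<in> C) \<in> adj_face I v" using chamberD(2)[OF assms] by simp
  then show ?thesis using assms(1) by (simp add: dynkin_map_def dynkin_adj_face)
qed

lemma dynkin_map_face:
  assumes "generic I v" shows "dynkin_map I f (adj_face I v) = dynkin v I f"
proof (rule dynkin_map_chamber[OF adj_face_in_chambers[OF assms]])
  show "v \<in> adj_face I v" using assms by (intro adj_face_self) (simp add: generic_def)
qed

lemma dynkin_map_add: "dynkin_map I (f + g) = dynkin_map I f + dynkin_map I g"
  by (auto simp: dynkin_map_def fun_eq_iff dynkin_add)

lemma dynkin_map_fscale: "dynkin_map I (fscale c f) = fscale c (dynkin_map I f)"
  by (auto simp: dynkin_map_def fun_eq_iff dynkin_fscale fscale_apply)

lemma dynkin_map_zero: "dynkin_map I 0 = 0"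
  by (auto simp: dynkin_map_def fun_eq_iff dynkin_zero)

lemma dynkin_map_diff: "dynkin_map I (f - g) = dynkin_map I f - dynkin_map I g"
proof -
  have "dynkin_map I (f - g) + dynkin_map I g = dynkin_map I f"
    by (simp add: dynkin_map_add[symmetric])
  then show ?thesis by (simp add: eq_diff_eq)
qed

lemma dynkin_map_bC:
  assumes "fin_ne I" "preorder_on I p"
  shows "dynkin_map I (bC I p) = (ac I p :: _ \<Rightarrow> 'k::field)"
proof
  fix C
  have I: "finite I" "I \<noteq> {}" "p \<subseteq> I \<times> I" using assms by (auto simp: fin_ne_def preorder_on_def)
  show "dynkin_map I (bC I p) C = (ac I p C :: 'k)"
  proof (cases "C \<in> adj_chambers I")
    case C: True
    show ?thesis
    proof (cases "C \<subseteq> adj_cone p")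
      case True
      obtain v where v: "v \<in> C" using chamber_nonempty[OF C] by blast
      then have "dynkin_map I (bC I p) C = (1::'k)"
        using True by (auto simp: dynkin_map_chamber[OF C v] intro!: dynkin_bC_in_cone[OF I])
      then show ?thesis using True C by (simp add: ac_def)
    next
      case False
      \<comment> \<open>A single point outside the cone suffices, because the value does not depend
        on the point of the chamber.\<close>
      then obtain v where v: "v \<in> C" "v \<notin> adj_cone p" by blast
      have "v \<in> adj_space I" using chamberD(1)[OF C v(1)] by (simp add: generic_def)
      then have "dynkin_map I (bC I p) C = (0::'k)"
        by (simp add: dynkin_map_chamber[OF C v(1)] dynkin_bC_not_in_cone[OF I _ v(2)])
      then show ?thesis using False by (simp add: ac_def)
    qed
  next
    case False then show ?thesis by (simp add: dynkin_map_def ac_def)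
  qed
qed

lemma dynkin_map_eq_0_iff:
  assumes "fin_ne I" "f \<in> Sig I"
  shows "dynkin_map I f = 0 \<longleftrightarrow> f \<in> decomposables I"
proof
  have I: "finite I" "I \<noteq> {}" using assms(1) by (auto simp: fin_ne_def)
  {
    assume *: "dynkin_map I f = 0"
    show "f \<in> decomposables I"
    proof (rule decomposables_if_dynkin_zero[OF I assms(2)])
      fix v assume "generic I v"
      then show "dynkin v I f = 0" using dynkin_map_face[of I v f] * by (simp add: zero_fun_def)
    qed
  next
    assume *: "f \<in> decomposables I"
    show "dynkin_map I f = 0"
    proof
      fix C show "dynkin_map I f C = 0 C"
      proof (cases "C \<in> adj_chambers I")
        case True
        then obtain v where v: "v \<in> C" using chamber_nonempty by blast
        then show ?thesis
          using dynkin_map_chamber[OF True v, of f] chamberD(1)[OF True v] dynkin_decomposables[OF I(1) _ *] 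
          by simp
      next
        case False then show ?thesis by (simp add: dynkin_map_def)
      qed
    qed
  }
qed

lemma dynkin_map_image_Sig:
  assumes "fin_ne I"
  shows "dynkin_map I ` (Sig I :: ('a set list \<Rightarrow> 'k::field) set) = fun_vs.span {ac I p | p. preorder_on I p}"
    (is "_ = fun_vs.span ?A")
proof
  let ?V = "dynkin_map I ` (Sig I :: ('a set list \<Rightarrow> 'k) set)"
  have fin: "finite I" using assms by (simp add: fin_ne_def)
  have "fun_vs.subspace {f. dynkin_map I f \<in> fun_vs.span ?A}"
    by (auto simp: fun_vs.subspace_def dynkin_map_add dynkin_map_fscale dynkin_map_zero
        intro: fun_vs.span_add fun_vs.span_scale fun_vs.span_zero)
  moreover have "dynkin_map I (bC I p) \<in> fun_vs.span ?A" if "preorder_on I p" for p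
    unfolding dynkin_map_bC[OF assms that] using that by (intro fun_vs.span_base) blast
  ultimately have "Sig I \<subseteq> {f. dynkin_map I f \<in> fun_vs.span ?A}"
    by (intro Sig_subset_if_bC[OF fin]) auto
  then show "dynkin_map I ` Sig I \<subseteq> fun_vs.span ?A" by blast
  show "fun_vs.span ?A \<subseteq> dynkin_map I ` Sig I"
  proof (rule fun_vs.span_minimal)
    show "?A \<subseteq> dynkin_map I ` Sig I"
    proof
      fix y assume "y \<in> ?A"
      then obtain p where p: "preorder_on I p" "y = ac I p" by blast
      have "bC I p \<in> Sig I" using fin by (simp add: Sig_def bC_apply)
      then show "y \<in> dynkin_map I ` Sig I"
        unfolding p(2) dynkin_map_bC[OF assms p(1), symmetric] by (rule imageI)
    qed
    show "fun_vs.subspace (?V)"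
      unfolding fun_vs.subspace_def
    proof (intro conjI ballI allI)
      show "0 \<in> ?V"
        using dynkin_map_zero fun_vs.subspace_0[OF Sig_subspace] by (metis image_eqI)
    next
      fix x y :: "('a \<Rightarrow> real) set \<Rightarrow> 'k" assume "x \<in> ?V" "y \<in> ?V"
      then show "x + y \<in> ?V"
        by (clarsimp simp: dynkin_map_add[symmetric]) (blast intro: Sig_add)
    next
      fix c :: 'k and x assume "x \<in> ?V"
      then show "fscale c x \<in> ?V"
        by (clarsimp simp: dynkin_map_fscale[symmetric]) (blast intro: Sig_scale)
    qed
  qed
qed

text \<open>Existence comes from the values of \<open>dynkin_map\<close> on the cone functions,
  uniqueness from the fact that these span \<open>Sig I\<close>. The \<open>restrict\<close>
  supplies the default outside \<open>Sig I\<close> that \<open>extensional\<close> demands.\<close>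

lemma is_adj_map_iff:
  assumes "fin_ne I"
  shows "is_adj_map I L \<longleftrightarrow> L = restrict (dynkin_map I) (Sig I)"
proof
  have fin: "finite I" using assms by (simp add: fin_ne_def)
  have bC: "bC I p \<in> Sig I" for p using fin by (simp add: Sig_def bC_apply)
  {
    assume L: "is_adj_map I L"
    have add: "L (f + g) = L f + L g" if "f \<in> Sig I" "g \<in> Sig I" for f g
      using L that by (simp add: is_adj_map_def linear_on_def fun_space_def adjZie_space_def)
    have scale: "L (fscale c f) = fscale c (L f)" if "f \<in> Sig I" for c f
      using L that by (simp add: is_adj_map_def linear_on_def fun_space_def adjZie_space_def)
    have "0 \<in> Sig I" by (rule fun_vs.subspace_0[OF Sig_subspace])
    then have zero: "L 0 = 0" using scale[of 0 0] by simp
    let ?V = "{f \<in> Sig I. L f = dynkin_map I f}"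
    have "fun_vs.subspace ?V"
      using \<open>0 \<in> Sig I\<close>
      by (auto simp: Sig_add Sig_scale fun_vs.subspace_def zero add scale dynkin_map_add dynkin_map_fscale dynkin_map_zero)
    moreover have "L (bC I p) = dynkin_map I (bC I p)" if "preorder_on I p" for p
      using L that by (simp add: is_adj_map_def dynkin_map_bC[OF assms that])
    ultimately have "Sig I \<subseteq> ?V" using bC by (intro Sig_subset_if_bC[OF fin]) auto
    moreover have "L \<in> extensional (Sig I)" using L by (simp add: is_adj_map_def)
    ultimately show "L = restrict (dynkin_map I) (Sig I)"
      by (intro extensionalityI[of _ "Sig I"]) auto
  next
    assume L: "L = restrict (dynkin_map I) (Sig I)"
    show "is_adj_map I L"
      unfolding is_adj_map_def L
    proof (intro conjI allI impI)
      show "linear_on (fun_space (Sig I)) (adjZie_space I) (restrict (dynkin_map I) (Sig I))"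
        by (auto simp: linear_on_def fun_space_def adjZie_space_def dynkin_map_add dynkin_map_fscale
            Sig_add Sig_scale dynkin_map_image_Sig[OF assms, symmetric])
      show "restrict (dynkin_map I) (Sig I) (bC I p) = ac I p" if "preorder_on I p" for p
        by (simp add: dynkin_map_bC[OF assms that] bC)
    qed simp
  }
qed

lemma adj_map_eq:
  assumes "fin_ne I" "f \<in> Sig I" shows "adj_map I f = dynkin_map I f"
  using assms by (simp add: adj_map_def is_adj_map_iff)

section \<open>Quotients\<close>

lemma coset_self: "fun_vs.subspace D \<Longrightarrow> f \<in> f +o D"
  using fun_vs.subspace_0 by (fastforce simp: elt_set_plus_def)

lemma mem_coset: "g \<in> f +o D \<longleftrightarrow> g - f \<in> D" for g :: "'x \<Rightarrow> 'k::field"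
  by (force simp: elt_set_plus_def algebra_simps)

lemma coset_eq_iff:
  assumes "fun_vs.subspace D" shows "f +o D = g +o D \<longleftrightarrow> f - g \<in> D"
proof
  assume "f +o D = g +o D"
  then show "f - g \<in> D" using coset_self[OF assms, of f] mem_coset by blast
next
  assume fg: "f - g \<in> D"
  have "h - f \<in> D \<longleftrightarrow> h - g \<in> D" for h
  proof
    assume "h - f \<in> D"
    then have "(h - f) + (f - g) \<in> D" using fg by (rule fun_vs.subspace_add[OF assms])
    then show "h - g \<in> D" by simp
  next
    assume "h - g \<in> D"
    then have "(h - g) - (f - g) \<in> D" using fg by (rule fun_vs.subspace_diff[OF assms])
    then show "h - f \<in> D" by simp
  qed
  then show "f +o D = g +o D" by (auto simp: mem_coset)
qed

lemma coset_add:
  assumes "fun_vs.subspace D" shows "(f +o D) + (g +o D) = (f + g) +o D"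
proof (intro equalityI subsetI)
  fix h assume "h \<in> (f +o D) + (g +o D)"
  then obtain a b where ab: "h = a + b" "a - f \<in> D" "b - g \<in> D" by (auto simp: set_plus_def mem_coset)
  have "h - (f + g) = (a - f) + (b - g)" using ab(1) by simp
  then have "h - (f + g) \<in> D" using fun_vs.subspace_add[OF assms ab(2,3)] by (simp only:)
  then show "h \<in> (f + g) +o D" by (simp add: mem_coset)
next
  fix h assume "h \<in> (f + g) +o D"
  then have "h - g \<in> f +o D" by (simp add: mem_coset algebra_simps)
  moreover have "h = (h - g) + g" by simp
  ultimately show "h \<in> (f +o D) + (g +o D)" using coset_self[OF assms, of g] by (metis set_plus_intro)
qed

lemma coset_scale:
  assumes "fun_vs.subspace D" shows "fscale c ` (f +o D) + D = fscale c f +o D"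
proof (intro equalityI subsetI)
  fix h assume "h \<in> fscale c ` (f +o D) + D"
  then obtain a d where ad: "h = fscale c a + d" "a - f \<in> D" "d \<in> D"
    by (auto simp: set_plus_def mem_coset)
  have "h - fscale c f = fscale c (a - f) + d"
    using ad(1) by (simp add: fun_vs.scale_right_diff_distrib)
  then have "h - fscale c f \<in> D"
    using fun_vs.subspace_add[OF assms fun_vs.subspace_scale[OF assms ad(2)] ad(3)] by (simp only:)
  then show "h \<in> fscale c f +o D" by (simp add: mem_coset)
next
  fix h assume "h \<in> fscale c f +o D"
  then have "h - fscale c f \<in> D" by (simp add: mem_coset)
  moreover have "h = fscale c f + (h - fscale c f)" by simp
  ultimately show "h \<in> fscale c ` (f +o D) + D" using coset_self[OF assms, of f] by (metis set_plus_intro imageI)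
qed

lemma is_vspace_fun_space:
  assumes U: "fun_vs.subspace U" shows "is_vspace (fun_space U)"
proof -
  have "\<exists>y\<in>U. x + y = 0" if "x \<in> U" for x
    using fun_vs.subspace_neg[OF U that] by (metis add.right_inverse)
  then show ?thesis
    using fun_vs.subspace_0[OF U] fun_vs.subspace_add[OF U] fun_vs.subspace_scale[OF U]
    by (simp add: is_vspace_def fun_space_def ac_simps fun_vs.scale_right_distrib
        fun_vs.scale_left_distrib)
qed

lemma is_vspace_quotient_space:
  assumes U: "fun_vs.subspace U" and D: "fun_vs.subspace D"
  shows "is_vspace (quotient_space U D)"
proof -
  have z: "0 +o D = D" by (auto simp: elt_set_plus_def)
  have mem: "f +o D \<in> (\<lambda>f. f +o D) ` U" if "f \<in> U" for f using that by (rule imageI)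
  have D_mem: "D \<in> (\<lambda>f. f +o D) ` U" using mem[OF fun_vs.subspace_0[OF U]] by (simp only: z)
  have zero_plus: "D + (f +o D) = f +o D" for f
    using coset_add[OF D, of 0 f] by (simp only: z add_0)
  have neg: "\<exists>y\<in>U. (f + y) +o D = D" if "f \<in> U" for f
    by (rule bexI[of _ "- f"]) (simp_all only: z add.right_inverse fun_vs.subspace_neg[OF U that])
  show ?thesis
    unfolding is_vspace_def quotient_space_def vspace.simps ball_simps bex_simps
      coset_add[OF D] coset_scale[OF D] zero_plus
    using D_mem neg
    by (simp add: mem fun_vs.subspace_add[OF U] fun_vs.subspace_scale[OF U]
        fun_vs.scale_right_distrib fun_vs.scale_left_distrib ac_simps)
qed

lemma zproj_add: "zproj I f + zproj I g = zproj I (f + g)"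
  by (simp add: zproj_def coset_add decomposables_subspace)

lemma zproj_eq_iff: "zproj I f = zproj I g \<longleftrightarrow> f - g \<in> decomposables I"
  by (simp add: zproj_def coset_eq_iff decomposables_subspace)

lemma vcar_Zie_space: "vcar (Zie_space I) = zproj I ` Sig I"
  by (simp add: Zie_space_def quotient_space_def zproj_def)

lemma vadd_Zie_space: "vadd (Zie_space I) (zproj I f) (zproj I g) = zproj I (f + g)"
  by (simp add: Zie_space_def quotient_space_def zproj_add)

lemma vscale_Zie_space: "vscale (Zie_space I) c (zproj I f) = zproj I (fscale c f)"
  by (simp add: Zie_space_def quotient_space_def zproj_def coset_scale decomposables_subspace)

lemma vzero_Zie_space: "vzero (Zie_space I) = zproj I 0"
  by (auto simp: Zie_space_def quotient_space_def zproj_def elt_set_plus_def)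

lemma is_vspace_Zie_space: "is_vspace (Zie_space I)"
  unfolding Zie_space_def by (rule is_vspace_quotient_space[OF Sig_subspace decomposables_subspace])

lemma mem_zprojD:
  assumes "g \<in> zproj I f" "f \<in> Sig I"
  shows "g \<in> Sig I" "zproj I g = zproj I f" "g - f \<in> decomposables I"
proof -
  show d: "g - f \<in> decomposables I" using assms(1) by (simp add: zproj_def mem_coset)
  then show "zproj I g = zproj I f" by (simp add: zproj_eq_iff)
  have "(g - f) + f \<in> Sig I"
    using d decomposables_subset_Sig assms(2) by (intro fun_vs.subspace_add[OF Sig_subspace]) auto
  then show "g \<in> Sig I" by simp
qed

lemma mem_zproj: "f \<in> zproj I f"
  unfolding zproj_def by (rule coset_self[OF decomposables_subspace])

definition zie_map :: "'a set \<Rightarrow> ('a set list \<Rightarrow> 'k::field) set \<Rightarrow> ('a \<Rightarrow> real) set \<Rightarrow> 'k" where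
  "zie_map I X = dynkin_map I (SOME f. f \<in> X)"

lemma zie_map_zproj:
  assumes "fin_ne I" "f \<in> Sig I" shows "zie_map I (zproj I f) = dynkin_map I f"
proof -
  define g where "g = (SOME g. g \<in> zproj I f)"
  have "g \<in> zproj I f" unfolding g_def by (rule someI[of "\<lambda>g. g \<in> zproj I f", OF mem_zproj])
  then have d: "g - f \<in> decomposables I" by (rule mem_zprojD(3)[OF _ assms(2)])
  then have "dynkin_map I (g - f) = 0"
    using dynkin_map_eq_0_iff[OF assms(1)] decomposables_subset_Sig by blast
  then have "dynkin_map I g = dynkin_map I f" by (simp add: dynkin_map_diff)
  then show ?thesis by (simp add: zie_map_def g_def)
qed

lemma vcar_adjZie_space: "fin_ne I \<Longrightarrow> vcar (adjZie_space I) = dynkin_map I ` Sig I"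
  by (simp add: adjZie_space_def fun_space_def dynkin_map_image_Sig)

lemma adjZie_space_ops:
  "vadd (adjZie_space I) = (+)" "vscale (adjZie_space I) = fscale" "vzero (adjZie_space I) = 0"
  by (simp_all add: adjZie_space_def fun_space_def)

lemma is_vspace_adjZie_space: "is_vspace (adjZie_space I)"
  unfolding adjZie_space_def by (rule is_vspace_fun_space) simp

lemma linear_zie_map:
  assumes "fin_ne I" shows "linear_on (Zie_space I) (adjZie_space I) (zie_map I)"
  unfolding linear_on_def vcar_Zie_space vcar_adjZie_space[OF assms] adjZie_space_ops
  by (auto simp: zie_map_zproj[OF assms] Sig_add Sig_scale vadd_Zie_space vscale_Zie_space dynkin_map_add dynkin_map_fscale)

lemma bij_zie_map:
  assumes "fin_ne I" shows "bij_betw (zie_map I) (vcar (Zie_space I)) (vcar (adjZie_space I))"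
  unfolding bij_betw_def
proof
  show "inj_on (zie_map I) (vcar (Zie_space I))"
  proof (rule inj_onI, unfold vcar_Zie_space, elim imageE)
    fix X Y f g assume *: "zie_map I X = zie_map I Y" "X = zproj I f" "f \<in> Sig I" "Y = zproj I g" "g \<in> Sig I"
    then have "dynkin_map I (f - g) = 0" by (simp add: zie_map_zproj[OF assms] dynkin_map_diff)
    moreover have "f - g \<in> Sig I" using * by (intro fun_vs.subspace_diff[OF Sig_subspace])
    ultimately have "f - g \<in> decomposables I" using dynkin_map_eq_0_iff[OF assms] by blast
    then show "X = Y" using * by (simp add: zproj_eq_iff)
  qed
  show "zie_map I ` vcar (Zie_space I) = vcar (adjZie_space I)"
    by (simp add: vcar_Zie_space vcar_adjZie_space[OF assms] image_image zie_map_zproj[OF assms] cong: image_cong_simp)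
qed

section \<open>Relabelling\<close>

lemma map_image_in_compositions:
  assumes "inj_on \<sigma> I" "F \<in> compositions I" shows "map ((`) \<sigma>) F \<in> compositions (\<sigma> ` I)"
  using assms
proof (induction F arbitrary: I)
  case Nil then show ?case by (simp add: Nil_in_compositions)
next
  case (Cons B F)
  then have B: "B \<noteq> {}" "B \<subseteq> I" "F \<in> compositions (I - B)" by (auto simp: Cons_in_compositions)
  have "map ((`) \<sigma>) F \<in> compositions (\<sigma> ` (I - B))"
    using Cons.IH[OF _ B(3)] Cons.prems(1) inj_on_subset by blast
  also have "\<sigma> ` (I - B) = \<sigma> ` I - \<sigma> ` B" using inj_on_image_set_diff[OF Cons.prems(1) _ B(2)] by simp
  finally show ?case using B by (auto simp: Cons_in_compositions)
qed

lemma map_image_comp_composition: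
  assumes "F \<in> compositions I" "\<And>i. i \<in> I \<Longrightarrow> \<tau> (\<sigma> i) = \<rho> i"
  shows "map ((`) \<tau>) (map ((`) \<sigma>) F) = map ((`) \<rho>) F"
proof -
  have "\<tau> ` \<sigma> ` B = \<rho> ` B" if "B \<in> set F" for B
    using block_composition[OF assms(1) that] assms(2) by (auto simp: image_image intro!: image_cong)
  then show ?thesis by simp
qed

lemma map_image_id_composition:
  assumes "F \<in> compositions I" "\<And>i. i \<in> I \<Longrightarrow> \<rho> i = i" shows "map ((`) \<rho>) F = F"
proof -
  have "\<rho> ` B = B" if "B \<in> set F" for B
    using block_composition[OF assms(1) that] assms(2) by (force simp: image_iff)
  then show ?thesis by (simp add: map_idI)
qed

lemma sum_compositions_image:
  assumes "inj_on \<sigma> I"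
  shows "(\<Sum>F\<in>compositions I. g (map ((`) \<sigma>) F)) = (\<Sum>F\<in>compositions (\<sigma> ` I). g F)"
proof (rule sum.reindex_bij_witness[where i = "map ((`) (inv_into I \<sigma>))" and j = "map ((`) \<sigma>)"])
  fix F assume F: "F \<in> compositions I"
  then show "map ((`) \<sigma>) F \<in> compositions (\<sigma> ` I)" by (rule map_image_in_compositions[OF assms])
  have "map ((`) (inv_into I \<sigma>)) (map ((`) \<sigma>) F) = map ((`) id) F"
    by (rule map_image_comp_composition[OF F]) (simp add: assms)
  then show "map ((`) (inv_into I \<sigma>)) (map ((`) \<sigma>) F) = F" by simp
next
  fix F assume F: "F \<in> compositions (\<sigma> ` I)"
  have "map ((`) (inv_into I \<sigma>)) F \<in> compositions (inv_into I \<sigma> ` \<sigma> ` I)"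
    by (rule map_image_in_compositions[OF inj_on_inv_into F]) simp
  then show "map ((`) (inv_into I \<sigma>)) F \<in> compositions I" using assms by simp
  have "map ((`) \<sigma>) (map ((`) (inv_into I \<sigma>)) F) = map ((`) id) F"
    by (rule map_image_comp_composition[OF F]) (simp add: f_inv_into_f)
  then show "map ((`) \<sigma>) (map ((`) (inv_into I \<sigma>)) F) = F" by simp
qed simp

lemma Sig_act_in_Sig: "Sig_act I \<sigma> f \<in> Sig I"
  by (simp add: Sig_act_def Sig_def)

lemma Sig_act_add: "Sig_act I \<sigma> (f + g) = Sig_act I \<sigma> f + Sig_act I \<sigma> g"
  by (auto simp: Sig_act_def fun_eq_iff)

lemma Sig_act_fscale: "Sig_act I \<sigma> (fscale c f) = fscale c (Sig_act I \<sigma> f)"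
  by (auto simp: Sig_act_def fun_eq_iff fscale_def)

lemma Sig_act_comp:
  assumes "inj_on \<sigma> I" shows "Sig_act I (\<tau> \<circ> \<sigma>) f = Sig_act I \<sigma> (Sig_act (\<sigma> ` I) \<tau> f)"
proof
  fix F
  show "Sig_act I (\<tau> \<circ> \<sigma>) f F = Sig_act I \<sigma> (Sig_act (\<sigma> ` I) \<tau> f) F"
  proof (cases "F \<in> compositions I")
    case True
    then have "map ((`) \<tau>) (map ((`) \<sigma>) F) = map ((`) (\<tau> \<circ> \<sigma>)) F"
      by (rule map_image_comp_composition) simp
    then show ?thesis using True map_image_in_compositions[OF assms True] by (simp add: Sig_act_def del: map_map)
  qed (simp add: Sig_act_def)
qed

lemma Sig_act_cong:
  assumes "\<And>i. i \<in> I \<Longrightarrow> \<sigma> i = \<tau> i" shows "Sig_act I \<sigma> f = Sig_act I \<tau> f"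
proof
  fix F
  show "Sig_act I \<sigma> f F = Sig_act I \<tau> f F"
  proof (cases "F \<in> compositions I")
    case True
    have "\<sigma> ` B = \<tau> ` B" if "B \<in> set F" for B
      using block_composition[OF True that] assms by (intro image_cong) auto
    then have "map ((`) \<sigma>) F = map ((`) \<tau>) F" by simp
    then show ?thesis using True by (simp only: Sig_act_def)
  qed (simp add: Sig_act_def)
qed

lemma Sig_act_id: "f \<in> Sig I \<Longrightarrow> (\<And>i. i \<in> I \<Longrightarrow> \<rho> i = i) \<Longrightarrow> Sig_act I \<rho> f = f"
  by (auto simp: Sig_act_def Sig_def fun_eq_iff map_image_id_composition)

lemma sum_push:
  assumes "inj_on \<sigma> I" "U \<subseteq> I" shows "sum (push I \<sigma> v) (\<sigma> ` U) = sum v U"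
proof -
  have "sum (push I \<sigma> v) (\<sigma> ` U) = (\<Sum>i\<in>U. push I \<sigma> v (\<sigma> i))"
    using inj_on_subset[OF assms] by (simp add: sum.reindex)
  also have "\<dots> = sum v U"
  proof (rule sum.cong[OF refl])
    fix i assume "i \<in> U"
    then have "i \<in> I" using assms(2) by blast
    then show "push I \<sigma> v (\<sigma> i) = v i" by (simp add: push_def inv_into_f_f[OF assms(1)])
  qed
  finally show ?thesis .
qed

lemma inits_map_image: "inits (map ((`) \<sigma>) F) = (`) \<sigma> ` inits F"
proof -
  have "\<Union>(set (take k (map ((`) \<sigma>) F))) = \<sigma> ` \<Union>(set (take k F))" for k
    by (simp add: take_map image_Union)
  then have "inits (map ((`) \<sigma>) F) = {\<sigma> ` \<Union>(set (take k F)) |k. 0 < k \<and> k < length F}"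
    by (simp only: inits_def length_map)
  also have "\<dots> = (`) \<sigma> ` inits F" unfolding inits_def by blast
  finally show ?thesis .
qed

lemma dynkin_Sig_act:
  assumes "inj_on \<sigma> I"
  shows "dynkin v I (Sig_act I \<sigma> f) = dynkin (push I \<sigma> v) (\<sigma> ` I) f"
proof -
  have neg: "neg_inits v F \<longleftrightarrow> neg_inits (push I \<sigma> v) (map ((`) \<sigma>) F)" if "F \<in> compositions I" for F
  proof -
    have "sum (push I \<sigma> v) (\<sigma> ` U) = sum v U" if "U \<in> inits F" for U
      using inits_psubset[OF \<open>F \<in> compositions I\<close> that] by (intro sum_push[OF assms]) blast
    then show ?thesis by (simp add: neg_inits_def inits_map_image)
  qed
  show ?thesis
    unfolding dynkin_def sum_compositions_image[OF assms, symmetric]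
    by (rule sum.cong[OF refl]) (simp add: neg Sig_act_def)
qed

lemma push_adj_face:
  assumes "finite I" "inj_on \<sigma> I"
  shows "push I \<sigma> ` adj_face I v = adj_face (\<sigma> ` I) (push I \<sigma> v)"
proof (intro equalityI subsetI)
  have sub: "\<exists>R\<subseteq>I. R' = \<sigma> ` R \<and> (R' \<noteq> {} \<longrightarrow> R \<noteq> {}) \<and> (R' \<noteq> \<sigma> ` I \<longrightarrow> R \<noteq> I)" if "R' \<subseteq> \<sigma> ` I" for R'
    using that unfolding subset_image_iff by auto
  {
    fix h assume "h \<in> push I \<sigma> ` adj_face I v"
    then obtain w where w: "h = push I \<sigma> w" "w \<in> adj_face I v" by blast
    have "sum w I = 0" using adj_face_space[OF w(2)] by (simp add: adj_space_def)
    then have "h \<in> adj_space (\<sigma> ` I)"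
      using w(1) sum_push[OF assms(2), of I w] by (simp add: adj_space_def push_def)
    moreover have "sgn (sum h R') = sgn (sum (push I \<sigma> v) R')" if R': "R' \<noteq> {}" "R' \<subset> \<sigma> ` I" for R'
    proof -
      obtain R where R: "R \<subseteq> I" "R' = \<sigma> ` R" "R \<noteq> {}" "R \<noteq> I"
        using sub[of R'] R' by auto
      then have "sgn (sum w R) = sgn (sum v R)" using adj_face_sgn[OF w(2)] by blast
      then show ?thesis using R w(1) sum_push[OF assms(2) R(1)] by simp
    qed
    ultimately show "h \<in> adj_face (\<sigma> ` I) (push I \<sigma> v)" by (simp add: adj_face_def)
  next
    fix h assume h: "h \<in> adj_face (\<sigma> ` I) (push I \<sigma> v)"
    define w where "w = (\<lambda>i. if i \<in> I then h (\<sigma> i) else 0)"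
    have hsp: "h \<in> adj_space (\<sigma> ` I)" by (rule adj_face_space[OF h])
    have hw: "h = push I \<sigma> w"
    proof
      fix j show "h j = push I \<sigma> w j"
        using hsp by (auto simp: push_def w_def adj_space_def f_inv_into_f inv_into_into)
    qed
    have sums: "sum w R = sum h (\<sigma> ` R)" if "R \<subseteq> I" for R
      unfolding hw using sum_push[OF assms(2) that] by simp
    have "sgn (sum w R) = sgn (sum v R)" if R: "R \<noteq> {}" "R \<subset> I" for R
    proof -
      have "\<sigma> ` R \<noteq> \<sigma> ` I" using inj_on_image_eq_iff[OF assms(2), of R I] R by auto
      then have "\<sigma> ` R \<noteq> {}" "\<sigma> ` R \<subset> \<sigma> ` I" using R by auto
      then have "sgn (sum h (\<sigma> ` R)) = sgn (sum (push I \<sigma> v) (\<sigma> ` R))" by (rule adj_face_sgn[OF h])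
      then show ?thesis using sums[of R] sum_push[OF assms(2), of R v] R by simp
    qed
    moreover have "w \<in> adj_space I" using hsp sums[of I] by (simp add: adj_space_def w_def)
    ultimately have "w \<in> adj_face I v" by (simp add: adj_face_def)
    then show "h \<in> push I \<sigma> ` adj_face I v" using hw by blast
  }
qed

lemma push_generic:
  assumes "finite I" "inj_on \<sigma> I" "generic I v" shows "generic (\<sigma> ` I) (push I \<sigma> v)"
  unfolding generic_def
proof (intro conjI allI impI)
  have v: "v \<in> adj_space I" using assms(3) by (simp add: generic_def)
  then have "push I \<sigma> v \<in> push I \<sigma> ` adj_face I v" using adj_face_self by blast
  then show "push I \<sigma> v \<in> adj_space (\<sigma> ` I)" unfolding push_adj_face[OF assms(1,2)] by (rule adj_face_space)
  fix R' assume R': "R' \<noteq> {} \<and> R' \<subset> \<sigma> ` I"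
  then obtain R where R: "R \<subseteq> I" "R' = \<sigma> ` R" unfolding psubset_eq subset_image_iff by blast
  then have "R \<noteq> {}" "R \<subset> I" using R' by auto
  then show "sum (push I \<sigma> v) R' \<noteq> 0"
    using assms(3) R sum_push[OF assms(2) R(1)] by (simp add: generic_def)
qed

lemma dynkin_map_Sig_act:
  assumes "fin_ne I" "inj_on \<sigma> I"
  shows "dynkin_map I (Sig_act I \<sigma> f) = adjZie_act I \<sigma> (dynkin_map (\<sigma> ` I) f)"
proof
  fix C
  have fin: "finite I" using assms by (simp add: fin_ne_def)
  show "dynkin_map I (Sig_act I \<sigma> f) C = adjZie_act I \<sigma> (dynkin_map (\<sigma> ` I) f) C"
  proof (cases "C \<in> adj_chambers I")
    case True
    then obtain v where v: "v \<in> C" using chamber_nonempty by blast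
    have g: "generic I v" and C: "C = adj_face I v" by (rule chamberD[OF True v])+
    then have "push I \<sigma> ` C = adj_face (\<sigma> ` I) (push I \<sigma> v)" by (simp add: push_adj_face[OF fin assms(2)])
    then have "dynkin_map (\<sigma> ` I) f (push I \<sigma> ` C) = dynkin (push I \<sigma> v) (\<sigma> ` I) f"
      using dynkin_map_face[OF push_generic[OF fin assms(2) g]] by simp
    then show ?thesis
      using True by (simp add: dynkin_map_chamber[OF True v] adjZie_act_def dynkin_Sig_act[OF assms(2)])
  next
    case False then show ?thesis by (simp add: dynkin_map_def adjZie_act_def)
  qed
qed

text \<open>Products need not be relabelled: the decomposables are the kernel of
  \<open>dynkin_map\<close>, and \<open>dynkin_map\<close> commutes with relabelling.\<close>

lemma Sig_act_decomposables_subset: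
  assumes "fin_ne I" "inj_on \<sigma> I"
  shows "Sig_act I \<sigma> ` decomposables (\<sigma> ` I) \<subseteq> decomposables I"
proof
  fix g assume "g \<in> Sig_act I \<sigma> ` decomposables (\<sigma> ` I)"
  then obtain f where f: "g = Sig_act I \<sigma> f" "f \<in> decomposables (\<sigma> ` I)" by blast
  have \<sigma>I: "fin_ne (\<sigma> ` I)" using assms(1) by (simp add: fin_ne_def)
  have "dynkin_map (\<sigma> ` I) f = 0"
    using dynkin_map_eq_0_iff[OF \<sigma>I] f(2) decomposables_subset_Sig by blast
  then have "dynkin_map I g = 0"
    unfolding f(1) dynkin_map_Sig_act[OF assms] by (auto simp: adjZie_act_def fun_eq_iff)
  then show "g \<in> decomposables I" using dynkin_map_eq_0_iff[OF assms(1)] f(1) Sig_act_in_Sig by blast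
qed

lemma Sig_act_zproj:
  assumes "fin_ne I" "inj_on \<sigma> I"
  shows "Sig_act I \<sigma> ` zproj (\<sigma> ` I) f = zproj I (Sig_act I \<sigma> f)"
proof (intro equalityI subsetI)
  fix g assume "g \<in> Sig_act I \<sigma> ` zproj (\<sigma> ` I) f"
  then obtain d where "d \<in> decomposables (\<sigma> ` I)" "g = Sig_act I \<sigma> (f + d)"
    by (auto simp: zproj_def elt_set_plus_def)
  then show "g \<in> zproj I (Sig_act I \<sigma> f)"
    using Sig_act_decomposables_subset[OF assms] by (auto simp: zproj_def elt_set_plus_def Sig_act_add)
next
  \<comment> \<open>The decomposable part is carried back along the inverse bijection, which
    preserves decomposables too.\<close>
  let ?\<tau> = "inv_into I \<sigma>"
  fix g assume "g \<in> zproj I (Sig_act I \<sigma> f)"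
  then obtain d where d: "d \<in> decomposables I" "g = Sig_act I \<sigma> f + d"
    by (auto simp: zproj_def elt_set_plus_def)
  let ?e = "Sig_act (\<sigma> ` I) ?\<tau> d"
  have \<sigma>I: "fin_ne (\<sigma> ` I)" using assms(1) by (simp add: fin_ne_def)
  have "?\<tau> ` \<sigma> ` I = I" using assms(2) by simp
  then have "?e \<in> decomposables (\<sigma> ` I)"
    using Sig_act_decomposables_subset[OF \<sigma>I inj_on_inv_into[OF subset_refl]] d(1) by auto
  moreover have "Sig_act I \<sigma> ?e = d"
    unfolding Sig_act_comp[OF assms(2), symmetric]
    using d(1) decomposables_subset_Sig assms(2) by (intro Sig_act_id) auto
  then have "g = Sig_act I \<sigma> (f + ?e)" using d(2) by (simp add: Sig_act_add)
  ultimately show "g \<in> Sig_act I \<sigma> ` zproj (\<sigma> ` I) f"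
    by (auto simp: zproj_def elt_set_plus_def)
qed

lemma is_cospecies_Zie: "is_cospecies Zie"
  unfolding is_cospecies_def
proof (intro conjI allI impI ballI)
  fix I :: "'a set" show "is_vspace (comp Zie I)" by (simp add: Zie_def is_vspace_Zie_space)
next
  fix I :: "'a set" and \<sigma> :: "'a \<Rightarrow> 'a"
  assume "fin_ne I \<and> inj_on \<sigma> I"
  then show "linear_on (comp Zie (\<sigma> ` I)) (comp Zie I) (act Zie I \<sigma>)"
    by (auto simp: Zie_def linear_on_def vcar_Zie_space vadd_Zie_space vscale_Zie_space
        Sig_act_zproj Sig_act_add Sig_act_fscale Sig_act_in_Sig)
next
  fix I and \<sigma> \<tau> :: "'a \<Rightarrow> 'a" and x assume *: "fin_ne I \<and> inj_on \<sigma> I \<and> (\<forall>i\<in>I. \<sigma> i = \<tau> i)"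
  then have c: "\<And>i. i \<in> I \<Longrightarrow> \<sigma> i = \<tau> i" by blast
  show "act Zie I \<sigma> x = act Zie I \<tau> x"
    by (simp add: Zie_def image_cong[OF refl Sig_act_cong[OF c]])
next
  fix I :: "'a set" and x assume "fin_ne I" "x \<in> vcar (comp Zie I)"
  then have "\<forall>f\<in>x. f \<in> Sig I" using mem_zprojD(1) by (auto simp: Zie_def vcar_Zie_space)
  then have "\<forall>f\<in>x. Sig_act I id f = f" by (simp add: Sig_act_id)
  then have "Sig_act I id ` x = id ` x" by (intro image_cong) auto
  then show "act Zie I id x = x" by (simp add: Zie_def)
next
  fix I and \<sigma> \<tau> :: "'a \<Rightarrow> 'a" and x
  assume "fin_ne I \<and> inj_on \<sigma> I \<and> inj_on \<tau> (\<sigma> ` I)"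
  then show "act Zie I (\<tau> \<circ> \<sigma>) x = act Zie I \<sigma> (act Zie (\<sigma> ` I) \<tau> x)"
    by (auto simp: Zie_def image_image intro!: image_cong Sig_act_comp)
qed

section \<open>Duals and tensor products\<close>

lemma vspaceD:
  assumes "is_vspace V"
  shows "vzero V \<in> vcar V"
    and "x \<in> vcar V \<Longrightarrow> y \<in> vcar V \<Longrightarrow> vadd V x y \<in> vcar V"
    and "x \<in> vcar V \<Longrightarrow> vscale V c x \<in> vcar V"
    and "x \<in> vcar V \<Longrightarrow> vadd V (vzero V) x = x"
  using assms unfolding is_vspace_def by blast+

lemma dualD:
  assumes "\<xi> \<in> dual V"
  shows "x \<in> vcar V \<Longrightarrow> y \<in> vcar V \<Longrightarrow> \<xi> (vadd V x y) = \<xi> x + \<xi> y"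
    and "x \<in> vcar V \<Longrightarrow> \<xi> (vscale V c x) = c * \<xi> x"
    and "x \<notin> vcar V \<Longrightarrow> \<xi> x = 0"
  using assms by (simp_all add: dual_def)

lemma dual_vzero:
  assumes "is_vspace V" "\<xi> \<in> dual V" shows "\<xi> (vzero V) = 0"
proof -
  have z: "vzero V \<in> vcar V" by (rule vspaceD(1)[OF assms(1)])
  have "\<xi> (vzero V) = \<xi> (vadd V (vzero V) (vzero V))" by (simp add: vspaceD(4)[OF assms(1) z])
  also have "\<dots> = \<xi> (vzero V) + \<xi> (vzero V)" by (rule dualD(1)[OF assms(2) z z])
  finally show ?thesis by (simp only: add_cancel_right_right)
qed

lemma linear_onD:
  assumes "linear_on V W f"
  shows "x \<in> vcar V \<Longrightarrow> f x \<in> vcar W"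
    and "x \<in> vcar V \<Longrightarrow> y \<in> vcar V \<Longrightarrow> f (vadd V x y) = vadd W (f x) (f y)"
    and "x \<in> vcar V \<Longrightarrow> f (vscale V c x) = vscale W c (f x)"
  using assms by (simp_all add: linear_on_def)

lemma pullback_in_dual:
  assumes "is_vspace V" "linear_on V W f" "\<xi> \<in> dual W"
  shows "pullback V f \<xi> \<in> dual V"
  unfolding dual_def pullback_def
  by (simp add: vspaceD[OF assms(1)] linear_onD[OF assms(2)] dualD[OF assms(3)])

lemma tensor_ops:
  "vadd (tensor V W) = (+)" "vscale (tensor V W) = fscale"
  "vcar (tensor V W) = fun_vs.span {pure_tensor V W v w | v w. v \<in> vcar V \<and> w \<in> vcar W}"
  by (simp_all add: tensor_def fun_space_def)

lemma tensor_subspace: "fun_vs.subspace (vcar (tensor V W))"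
  by (simp add: tensor_ops)

lemma pure_tensor_in_tensor: "v \<in> vcar V \<Longrightarrow> w \<in> vcar W \<Longrightarrow> pure_tensor V W v w \<in> vcar (tensor V W)"
  unfolding tensor_ops by (intro fun_vs.span_base) blast

lemma tensor_induct:
  assumes "t \<in> vcar (tensor V W)" "fun_vs.subspace P"
    "\<And>v w. v \<in> vcar V \<Longrightarrow> w \<in> vcar W \<Longrightarrow> pure_tensor V W v w \<in> P"
  shows "t \<in> P"
proof -
  have "vcar (tensor V W) \<subseteq> P"
    unfolding tensor_ops by (rule fun_vs.span_minimal[OF _ assms(2)]) (use assms(3) in blast)
  then show ?thesis using assms(1) by blast
qed

lemma tensor_outside:
  assumes "t \<in> vcar (tensor V W)" "\<not> (\<xi> \<in> dual V \<and> \<eta> \<in> dual W)" shows "t (\<xi>, \<eta>) = 0"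
proof -
  have "t \<in> {t. t (\<xi>, \<eta>) = 0}"
    by (rule tensor_induct[OF assms(1)])
      (use assms(2) in \<open>auto simp: fun_vs.subspace_def fscale_def pure_tensor_def\<close>)
  then show ?thesis by simp
qed

text \<open>The vector is the contraction of \<open>t\<close> with \<open>\<xi>\<close> in the first
  factor. A general functional on the dual space need not be an evaluation at a vector; the slices
  of a tensor are, and only therefore can separation of vectors be applied to them.\<close>

lemma tensor_slice:
  assumes W: "is_vspace W" and t: "t \<in> vcar (tensor V W)" and \<xi>: "\<xi> \<in> dual V"
  shows "\<exists>w\<in>vcar W. \<forall>\<eta>\<in>dual W. t (\<xi>, \<eta>) = \<eta> w"
proof -
  let ?P = "{t. \<exists>w\<in>vcar W. \<forall>\<eta>\<in>dual W. t (\<xi>, \<eta>) = \<eta> w}"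
  have "t \<in> ?P"
  proof (rule tensor_induct[OF t])
    show "fun_vs.subspace ?P"
      unfolding fun_vs.subspace_def
    proof (intro conjI ballI allI)
      show "0 \<in> ?P" using vspaceD(1)[OF W] dual_vzero[OF W] by fastforce
    next
      fix s s' assume "s \<in> ?P" "s' \<in> ?P"
      then obtain w w' where w: "w \<in> vcar W" "\<forall>\<eta>\<in>dual W. s (\<xi>, \<eta>) = \<eta> w"
        and w': "w' \<in> vcar W" "\<forall>\<eta>\<in>dual W. s' (\<xi>, \<eta>) = \<eta> w'" by blast
      have "vadd W w w' \<in> vcar W" by (rule vspaceD(2)[OF W w(1) w'(1)])
      moreover have "\<forall>\<eta>\<in>dual W. (s + s') (\<xi>, \<eta>) = \<eta> (vadd W w w')"
        using w w' by (simp add: dualD(1))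
      ultimately show "s + s' \<in> ?P" by blast
    next
      fix c s assume "s \<in> ?P"
      then obtain w where w: "w \<in> vcar W" "\<forall>\<eta>\<in>dual W. s (\<xi>, \<eta>) = \<eta> w" by blast
      have "vscale W c w \<in> vcar W" by (rule vspaceD(3)[OF W w(1)])
      moreover have "\<forall>\<eta>\<in>dual W. (fscale c s) (\<xi>, \<eta>) = \<eta> (vscale W c w)"
        using w by (simp add: dualD(2) fscale_def)
      ultimately show "fscale c s \<in> ?P" by blast
    qed
    fix v w assume "v \<in> vcar V" "w \<in> vcar W"
    then have "vscale W (\<xi> v) w \<in> vcar W"
      "\<forall>\<eta>\<in>dual W. pure_tensor V W v w (\<xi>, \<eta>) = \<eta> (vscale W (\<xi> v) w)"
      using \<xi> by (simp_all add: vspaceD(3)[OF W] dualD(2) pure_tensor_def)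
    then show "pure_tensor V W v w \<in> ?P" by blast
  qed
  then show ?thesis by simp
qed

lemma tensor_swap_apply: "tensor_swap t (\<eta>, \<xi>) = t (\<xi>, \<eta>)"
  by (simp add: tensor_swap_def)

lemma tensor_swap_linear:
  "tensor_swap (s + t) = tensor_swap s + tensor_swap t"
  "tensor_swap (fscale c t) = fscale c (tensor_swap t)"
  "tensor_swap 0 = 0"
  by (auto simp: tensor_swap_def fun_eq_iff fscale_def)

lemma tensor_swap_in_tensor:
  assumes "t \<in> vcar (tensor V W)" shows "tensor_swap t \<in> vcar (tensor W V)"
proof -
  have "t \<in> {t. tensor_swap t \<in> vcar (tensor W V)}"
  proof (rule tensor_induct[OF assms])
    show "fun_vs.subspace {t. tensor_swap t \<in> vcar (tensor W V)}"
      using tensor_subspace[of W V] by (simp add: fun_vs.subspace_def tensor_swap_linear)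
    fix v w assume "v \<in> vcar V" "w \<in> vcar W"
    moreover have "tensor_swap (pure_tensor V W v w) = pure_tensor W V w v"
      by (auto simp: tensor_swap_def pure_tensor_def fun_eq_iff)
    ultimately show "pure_tensor V W v w \<in> {t. tensor_swap t \<in> vcar (tensor W V)}"
      by (simp add: pure_tensor_in_tensor)
  qed
  then show ?thesis by simp
qed

text \<open>Both slices are used in turn. For fixed \<open>e' D\<close> the contraction in the
  second factor is a vector on which all \<open>e C\<close> vanish, so it is zero and
  \<open>C\<close> can be replaced by an arbitrary functional. The same argument then frees the
  second argument.\<close>

lemma tensor_separation:
  assumes V: "is_vspace V" and W: "is_vspace W" and t: "t \<in> vcar (tensor V W)"
    and e: "\<And>C. e C \<in> dual V" "\<And>v. v \<in> vcar V \<Longrightarrow> (\<And>C. C \<in> A \<Longrightarrow> e C v = 0) \<Longrightarrow> v = vzero V"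
    and e': "\<And>D. e' D \<in> dual W" "\<And>w. w \<in> vcar W \<Longrightarrow> (\<And>D. D \<in> B \<Longrightarrow> e' D w = 0) \<Longrightarrow> w = vzero W"
    and zero: "\<And>C D. C \<in> A \<Longrightarrow> D \<in> B \<Longrightarrow> t (e C, e' D) = 0"
  shows "t = 0"
proof
  fix z :: "('a \<Rightarrow> 'b) \<times> ('c \<Rightarrow> 'b)"
  obtain \<xi> \<eta> where z: "z = (\<xi>, \<eta>)" by (cases z)
  have "t (\<xi>, \<eta>) = 0"
  proof (cases "\<xi> \<in> dual V \<and> \<eta> \<in> dual W")
    case True
    have right: "t (\<xi>, e' D) = 0" if D: "D \<in> B" for D
    proof -
      from tensor_slice[OF V tensor_swap_in_tensor[OF t] e'(1)]
      obtain v where v: "v \<in> vcar V" "\<forall>\<xi>\<in>dual V. t (\<xi>, e' D) = \<xi> v"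
        by (auto simp: tensor_swap_apply)
      have "v = vzero V"
        by (rule e(2)[OF v(1)]) (use v(2) e(1) zero[OF _ D] in force)
      then show ?thesis using v(2) True dual_vzero[OF V] by simp
    qed
    from tensor_slice[OF W t] True
    obtain w where w: "w \<in> vcar W" "\<forall>\<eta>\<in>dual W. t (\<xi>, \<eta>) = \<eta> w" by blast
    have "w = vzero W"
      by (rule e'(2)[OF w(1)]) (use w(2) e'(1) right in force)
    then show ?thesis using w(2) True dual_vzero[OF W] by simp
  next
    case False then show ?thesis by (rule tensor_outside[OF t])
  qed
  then show "t z = 0 z" by (simp add: z)
qed

lemma tensor_map_apply:
  "tensor_map V W V' W' f g t (\<xi>, \<eta>) =
    (if \<xi> \<in> dual V' \<and> \<eta> \<in> dual W' then t (pullback V f \<xi>, pullback W g \<eta>) else 0)"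
  by (simp add: tensor_map_def)

lemma tensor_map_linear:
  "tensor_map V W V' W' f g (s + t) = tensor_map V W V' W' f g s + tensor_map V W V' W' f g t"
  "tensor_map V W V' W' f g (fscale c t) = fscale c (tensor_map V W V' W' f g t)"
  "tensor_map V W V' W' f g (- t) = - tensor_map V W V' W' f g t"
  "tensor_map V W V' W' f g 0 = 0"
  by (auto simp: tensor_map_def fun_eq_iff fscale_def)

lemma tensor_map_swap:
  "tensor_swap (tensor_map V W V' W' f g t) = tensor_map W V W' V' g f (tensor_swap t)"
  by (auto simp: tensor_map_def tensor_swap_def fun_eq_iff)

lemma tensor_map_pure:
  assumes "is_vspace V" "is_vspace W" "linear_on V V' f" "linear_on W W' g" "v \<in> vcar V" "w \<in> vcar W"
  shows "tensor_map V W V' W' f g (pure_tensor V W v w) = pure_tensor V' W' (f v) (g w)"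
  using pullback_in_dual[OF assms(1,3)] pullback_in_dual[OF assms(2,4)] assms(5,6)
  by (auto simp: tensor_map_def pure_tensor_def fun_eq_iff pullback_def)

lemma tensor_map_in_tensor:
  assumes "is_vspace V" "is_vspace W" "linear_on V V' f" "linear_on W W' g"
    and t: "t \<in> vcar (tensor V W)"
  shows "tensor_map V W V' W' f g t \<in> vcar (tensor V' W')"
proof -
  have "t \<in> {t. tensor_map V W V' W' f g t \<in> vcar (tensor V' W')}"
  proof (rule tensor_induct[OF t])
    show "fun_vs.subspace {t. tensor_map V W V' W' f g t \<in> vcar (tensor V' W')}"
      using tensor_subspace[of V' W'] by (simp add: fun_vs.subspace_def tensor_map_linear)
    fix v w assume vw: "v \<in> vcar V" "w \<in> vcar W"
    then show "pure_tensor V W v w \<in> {t. tensor_map V W V' W' f g t \<in> vcar (tensor V' W')}"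
      by (simp add: tensor_map_pure[OF assms(1-4)] pure_tensor_in_tensor linear_onD(1)[OF assms(3)]
          linear_onD(1)[OF assms(4)])
  qed
  then show ?thesis by simp
qed

text \<open>If the squares of both factors commute, the two composites pull functionals back to the
  same functionals. It is the naturality square for the relabelled cobracket when a structure is
  transported.\<close>

lemma tensor_map_comp_eqI:
  assumes "\<And>\<xi>. \<xi> \<in> dual V'' \<Longrightarrow> pullback V' g \<xi> \<in> dual V'" "\<And>\<eta>. \<eta> \<in> dual W'' \<Longrightarrow> pullback W' g' \<eta> \<in> dual W'"
    and "\<And>\<xi>. \<xi> \<in> dual V'' \<Longrightarrow> pullback U' h \<xi> \<in> dual U'" "\<And>\<eta>. \<eta> \<in> dual W'' \<Longrightarrow> pullback X' h' \<eta> \<in> dual X'"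
    and "\<And>v. v \<in> vcar V \<Longrightarrow> f v \<in> vcar V' \<and> k v \<in> vcar U' \<and> g (f v) = h (k v)"
    and "\<And>w. w \<in> vcar W \<Longrightarrow> f' w \<in> vcar W' \<and> k' w \<in> vcar X' \<and> g' (f' w) = h' (k' w)"
  shows "tensor_map V' W' V'' W'' g g' (tensor_map V W V' W' f f' t) =
    tensor_map U' X' V'' W'' h h' (tensor_map V W U' X' k k' t)"
proof -
  have "tensor_map V' W' V'' W'' g g' (tensor_map V W V' W' f f' t) (\<xi>, \<eta>) =
    tensor_map U' X' V'' W'' h h' (tensor_map V W U' X' k k' t) (\<xi>, \<eta>)" for \<xi> \<eta>
  proof -
    have "pullback V f (pullback V' g \<xi>) = pullback V k (pullback U' h \<xi>)"
      "pullback W f' (pullback W' g' \<eta>) = pullback W k' (pullback X' h' \<eta>)"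
      using assms(5,6) by (auto simp: pullback_def fun_eq_iff)
    then show ?thesis using assms(1-4) by (simp add: tensor_map_apply)
  qed
  then show ?thesis by (simp add: fun_eq_iff)
qed

lemma dual_bracket_in_dual:
  assumes "is_vspace (comp A (S \<union> T))"
    "linear_on (comp A (S \<union> T)) (tensor (comp A S) (comp A T)) (cobr A S T)"
  shows "dual_bracket A S T \<xi> \<eta> \<in> dual (comp A (S \<union> T))"
  unfolding dual_def dual_bracket_def
  by (simp add: vspaceD[OF assms(1)] linear_onD[OF assms(2)] tensor_ops fscale_def)

section \<open>Transport of the Lie coalgebra structure\<close>

text \<open>By surjectivity every element over \<open>B\<close> is the image of one over
  \<open>A\<close>, and \<open>\<phi>\<close> intertwines relabelling and cobrackets; functionals
  travel the other way, by \<open>pullback\<close>. Each axiom for \<open>B\<close> thus becomes the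
  image of the axiom for \<open>A\<close>.\<close>

lemma is_lie_coalgebra_transport:
  fixes A :: "('a, 'v, 'k::field) cobracket_data" and B :: "('a, 'w, 'k) cobracket_data"
  assumes A: "is_lie_coalgebra A" and iso: "lie_coalgebra_iso A B \<phi>"
    and vB: "\<And>I. fin_ne I \<Longrightarrow> is_vspace (comp B I)"
  shows "is_lie_coalgebra B"
proof -
  have cos: "is_cospecies A" using A by (simp add: is_lie_coalgebra_def)
  note cos_parts = cos[unfolded is_cospecies_def, THEN conjunct2, THEN conjunct2]
  note act_cong = cos_parts[THEN conjunct1, rule_format]
    and act_id = cos_parts[THEN conjunct2, THEN conjunct1, rule_format]
    and act_comp = cos_parts[THEN conjunct2, THEN conjunct2, rule_format]
  note lie_parts = A[unfolded is_lie_coalgebra_def, THEN conjunct2, THEN conjunct2]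
  note equivariance = lie_parts[THEN conjunct1, rule_format]
    and antisymmetry = lie_parts[THEN conjunct2, THEN conjunct1, rule_format]
    and jacobi = lie_parts[THEN conjunct2, THEN conjunct2, rule_format]
  have vA: "is_vspace (comp A I)" if "fin_ne I" for I
    using cos that by (simp add: is_cospecies_def)
  have actA: "linear_on (comp A (\<sigma> ` I)) (comp A I) (act A I \<sigma>)" if "fin_ne I" "inj_on \<sigma> I" for I \<sigma>
    using cos that by (simp add: is_cospecies_def)
  have linA: "linear_on (comp A (S \<union> T)) (tensor (comp A S) (comp A T)) (cobr A S T)"
    if "fin_ne S" "fin_ne T" "S \<inter> T = {}" for S T
    using A that by (simp add: is_lie_coalgebra_def)
  have lin\<phi>: "linear_on (comp A I) (comp B I) (\<phi> I)" if "fin_ne I" for I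
    using iso that by (simp add: lie_coalgebra_iso_def)
  have surj: "\<exists>x\<in>vcar (comp A I). y = \<phi> I x" if "fin_ne I" "y \<in> vcar (comp B I)" for I y
  proof -
    have "bij_betw (\<phi> I) (vcar (comp A I)) (vcar (comp B I))"
      using iso that(1) by (simp add: lie_coalgebra_iso_def)
    then have "y \<in> \<phi> I ` vcar (comp A I)" using that(2) by (simp add: bij_betw_def)
    then show ?thesis by blast
  qed
  have \<phi>act: "act B I \<sigma> (\<phi> (\<sigma> ` I) x) = \<phi> I (act A I \<sigma> x)"
    if "fin_ne I" "inj_on \<sigma> I" "x \<in> vcar (comp A (\<sigma> ` I))" for I \<sigma> x
    using iso that by (simp add: lie_coalgebra_iso_def)
  have \<phi>cobr: "cobr B S T (\<phi> (S \<union> T) x) =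
      tensor_map (comp A S) (comp A T) (comp B S) (comp B T) (\<phi> S) (\<phi> T) (cobr A S T x)"
    if "fin_ne S" "fin_ne T" "S \<inter> T = {}" "x \<in> vcar (comp A (S \<union> T))" for S T x
    using iso that by (simp add: lie_coalgebra_iso_def)
  have ne_image: "fin_ne (\<sigma> ` I)" if "fin_ne I" for I and \<sigma> :: "'a \<Rightarrow> 'a"
    using that by (simp add: fin_ne_def)
  have ne_Un: "fin_ne (S \<union> T)" if "fin_ne S" "fin_ne T" for S T :: "'a set"
    using that by (simp add: fin_ne_def)
  have actB: "linear_on (comp B (\<sigma> ` I)) (comp B I) (act B I \<sigma>)"
    if I: "fin_ne I" "inj_on \<sigma> I" for I \<sigma>
    unfolding linear_on_def
  proof (intro conjI ballI allI)
    note L = lin\<phi>[OF ne_image[OF I(1)], of \<sigma>] and La = actA[OF I] and L' = lin\<phi>[OF I(1)]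
      and vs = vA[OF ne_image[OF I(1)], of \<sigma>]
    fix y assume "y \<in> vcar (comp B (\<sigma> ` I))"
    then obtain x where x: "x \<in> vcar (comp A (\<sigma> ` I))" "y = \<phi> (\<sigma> ` I) x"
      using surj[OF ne_image[OF I(1)]] by blast
    show "act B I \<sigma> y \<in> vcar (comp B I)"
      by (simp add: x \<phi>act[OF I x(1)] linear_onD(1)[OF L'] linear_onD(1)[OF La])
    {
      fix c show "act B I \<sigma> (vscale (comp B (\<sigma> ` I)) c y) = vscale (comp B I) c (act B I \<sigma> y)"
        by (simp add: x \<phi>act[OF I] linear_onD(3)[OF L, symmetric] linear_onD[OF L'] linear_onD[OF La] vspaceD[OF vs])
    next
      fix y' assume "y' \<in> vcar (comp B (\<sigma> ` I))"
      then obtain x' where x': "x' \<in> vcar (comp A (\<sigma> ` I))" "y' = \<phi> (\<sigma> ` I) x'"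
        using surj[OF ne_image[OF I(1)]] by blast
      show "act B I \<sigma> (vadd (comp B (\<sigma> ` I)) y y') = vadd (comp B I) (act B I \<sigma> y) (act B I \<sigma> y')"
        by (simp add: x x' \<phi>act[OF I] linear_onD(2)[OF L, symmetric] linear_onD[OF L'] linear_onD[OF La] vspaceD[OF vs])
    }
  qed
  have cosB: "is_cospecies B"
    unfolding is_cospecies_def
  proof (intro conjI allI impI ballI)
    fix I :: "'a set" assume "fin_ne I" then show "is_vspace (comp B I)" by (rule vB)
  next
    fix I and \<sigma> :: "'a \<Rightarrow> 'a" assume "fin_ne I \<and> inj_on \<sigma> I"
    then show "linear_on (comp B (\<sigma> ` I)) (comp B I) (act B I \<sigma>)" using actB by blast
  next
    fix I and \<sigma> \<tau> :: "'a \<Rightarrow> 'a" and y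
    assume *: "fin_ne I \<and> inj_on \<sigma> I \<and> (\<forall>i\<in>I. \<sigma> i = \<tau> i)" and y: "y \<in> vcar (comp B (\<sigma> ` I))"
    have im: "\<tau> ` I = \<sigma> ` I" using * by (intro image_cong) auto
    have inj: "inj_on \<tau> I" using * inj_on_cong[of I \<sigma> \<tau>] by auto
    obtain x where x: "x \<in> vcar (comp A (\<sigma> ` I))" "y = \<phi> (\<sigma> ` I) x"
      using surj[OF ne_image[OF conjunct1[OF *]] y] by blast
    have "act A I \<sigma> x = act A I \<tau> x" by (rule act_cong[OF * x(1)])
    moreover have "act B I \<sigma> y = \<phi> I (act A I \<sigma> x)"
      unfolding x(2) by (rule \<phi>act) (use * x(1) in auto)
    moreover have "act B I \<tau> (\<phi> (\<tau> ` I) x) = \<phi> I (act A I \<tau> x)"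
      by (rule \<phi>act[OF conjunct1[OF *] inj]) (use x(1) im in simp)
    ultimately show "act B I \<sigma> y = act B I \<tau> y" by (simp only: x(2) im)
  next
    fix I :: "'a set" and y assume I: "fin_ne I" and y: "y \<in> vcar (comp B I)"
    obtain x where x: "x \<in> vcar (comp A I)" "y = \<phi> I x" using surj[OF I y] by blast
    have "act A I id x = x" by (rule act_id[OF I x(1)])
    then show "act B I id y = y" using \<phi>act[of I id x] I x by simp
  next
    fix I and \<sigma> \<tau> :: "'a \<Rightarrow> 'a" and y
    assume *: "fin_ne I \<and> inj_on \<sigma> I \<and> inj_on \<tau> (\<sigma> ` I)" and y: "y \<in> vcar (comp B (\<tau> ` \<sigma> ` I))"
    then have I: "fin_ne I" "inj_on \<sigma> I" "inj_on \<tau> (\<sigma> ` I)" "fin_ne (\<sigma> ` I)"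
      using ne_image by auto
    obtain x where x: "x \<in> vcar (comp A (\<tau> ` \<sigma> ` I))" "y = \<phi> (\<tau> ` \<sigma> ` I) x"
      using surj[OF ne_image[OF I(4)] y] by blast
    have "act A I (\<tau> \<circ> \<sigma>) x = act A I \<sigma> (act A (\<sigma> ` I) \<tau> x)"
      by (rule act_comp[OF * x(1)])
    moreover have m: "act A (\<sigma> ` I) \<tau> x \<in> vcar (comp A (\<sigma> ` I))"
      by (rule linear_onD(1)[OF actA[OF I(4,3)] x(1)])
    moreover have im: "(\<tau> \<circ> \<sigma>) ` I = \<tau> ` \<sigma> ` I" by auto
    have "act B I (\<tau> \<circ> \<sigma>) (\<phi> ((\<tau> \<circ> \<sigma>) ` I) x) = \<phi> I (act A I (\<tau> \<circ> \<sigma>) x)"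
      by (rule \<phi>act[OF I(1) comp_inj_on[OF I(2,3)]]) (simp only: im x(1))
    ultimately show "act B I (\<tau> \<circ> \<sigma>) y = act B I \<sigma> (act B (\<sigma> ` I) \<tau> y)"
      by (simp only: x(2) \<phi>act[OF I(4,3) x(1)] \<phi>act[OF I(1,2) m] im)
  qed
  have linB: "linear_on (comp B (S \<union> T)) (tensor (comp B S) (comp B T)) (cobr B S T)"
    if ST: "fin_ne S" "fin_ne T" "S \<inter> T = {}" for S T
    unfolding linear_on_def
  proof (intro conjI ballI allI)
    note U = ne_Un[OF ST(1,2)] note L = lin\<phi>[OF U] and LA = linA[OF ST] and vs = vA[OF U]
    fix y assume "y \<in> vcar (comp B (S \<union> T))"
    then obtain x where x: "x \<in> vcar (comp A (S \<union> T))" "y = \<phi> (S \<union> T) x" using surj[OF U] by blast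
    show "cobr B S T y \<in> vcar (tensor (comp B S) (comp B T))"
      unfolding x \<phi>cobr[OF ST x(1)] using linear_onD(1)[OF LA x(1)]
      by (intro tensor_map_in_tensor vA lin\<phi> ST)
    {
      fix c show "cobr B S T (vscale (comp B (S \<union> T)) c y) =
          vscale (tensor (comp B S) (comp B T)) c (cobr B S T y)"
        using vspaceD(3)[OF vs x(1), of c] x(1)
        by (simp add: x(2) linear_onD(3)[OF L, symmetric] \<phi>cobr[OF ST] linear_onD[OF LA] tensor_ops tensor_map_linear)
    next
      fix y' assume "y' \<in> vcar (comp B (S \<union> T))"
      then obtain x' where x': "x' \<in> vcar (comp A (S \<union> T))" "y' = \<phi> (S \<union> T) x'" using surj[OF U] by blast
      show "cobr B S T (vadd (comp B (S \<union> T)) y y') =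
          vadd (tensor (comp B S) (comp B T)) (cobr B S T y) (cobr B S T y')"
        using vspaceD(2)[OF vs x(1) x'(1)] x(1) x'(1)
        by (simp add: x(2) x'(2) linear_onD(2)[OF L, symmetric] \<phi>cobr[OF ST] linear_onD[OF LA] tensor_ops tensor_map_linear)
    }
  qed
  \<comment> \<open>The pullback of a dual bracket is the dual bracket of the pullbacks, so every
    summand of the co-Jacobi identity for \<open>B\<close> is one for \<open>A\<close>.\<close>
  have bracket: "cobr B (P \<union> Q) Z (\<phi> U x) (dual_bracket B P Q \<xi> \<eta>, \<zeta>) =
      cobr A (P \<union> Q) Z x (dual_bracket A P Q (pullback (comp A P) (\<phi> P) \<xi>) (pullback (comp A Q) (\<phi> Q) \<eta>),
        pullback (comp A Z) (\<phi> Z) \<zeta>)"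
    if P: "fin_ne P" "fin_ne Q" "fin_ne Z" "P \<inter> Q = {}" "P \<inter> Z = {}" "Q \<inter> Z = {}" "U = P \<union> Q \<union> Z"
      and x: "x \<in> vcar (comp A U)"
      and \<xi>: "\<xi> \<in> dual (comp B P)" "\<eta> \<in> dual (comp B Q)" "\<zeta> \<in> dual (comp B Z)"
    for P Q Z U x \<xi> \<eta> \<zeta>
  proof -
    note PQ = ne_Un[OF P(1,2)]
    have d: "(P \<union> Q) \<inter> Z = {}" using P by blast
    have "pullback (comp A (P \<union> Q)) (\<phi> (P \<union> Q)) (dual_bracket B P Q \<xi> \<eta>) =
        dual_bracket A P Q (pullback (comp A P) (\<phi> P) \<xi>) (pullback (comp A Q) (\<phi> Q) \<eta>)"
      using \<xi> by (auto simp: fun_eq_iff pullback_def[of "comp A (P \<union> Q)"] dual_bracket_def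
          linear_onD(1)[OF lin\<phi>[OF PQ]] \<phi>cobr[OF P(1,2,4)] tensor_map_apply)
    moreover have "dual_bracket B P Q \<xi> \<eta> \<in> dual (comp B (P \<union> Q))"
      by (rule dual_bracket_in_dual[OF vB[OF PQ] linB[OF P(1,2,4)]])
    ultimately show ?thesis
      using \<phi>cobr[OF PQ P(3) d, of x] x \<xi> by (simp add: P(7) tensor_map_apply)
  qed
  show ?thesis
    unfolding is_lie_coalgebra_def
  proof (intro conjI allI impI ballI)
    show "is_cospecies B" by (rule cosB)
  next
    fix S T :: "'a set" assume "fin_ne S \<and> fin_ne T \<and> S \<inter> T = {}"
    then show "linear_on (comp B (S \<union> T)) (tensor (comp B S) (comp B T)) (cobr B S T)" using linB by blast
  next
    fix S T and \<sigma> :: "'a \<Rightarrow> 'a" and y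
    assume *: "fin_ne S \<and> fin_ne T \<and> S \<inter> T = {} \<and> inj_on \<sigma> (S \<union> T)"
      and y: "y \<in> vcar (comp B (\<sigma> ` (S \<union> T)))"
    then have ST: "fin_ne S" "fin_ne T" "S \<inter> T = {}" and inj: "inj_on \<sigma> (S \<union> T)" by auto
    have injS: "inj_on \<sigma> S" "inj_on \<sigma> T" using inj by (auto intro: inj_on_subset)
    have U: "fin_ne (S \<union> T)" by (rule ne_Un[OF ST(1,2)])
    have \<sigma>ST: "fin_ne (\<sigma> ` S)" "fin_ne (\<sigma> ` T)" "\<sigma> ` S \<inter> \<sigma> ` T = {}"
      using ne_image[OF ST(1)] ne_image[OF ST(2)] inj_on_image_Int[OF inj, of S T] ST(3) by auto
    obtain x where x: "x \<in> vcar (comp A (\<sigma> ` (S \<union> T)))" "y = \<phi> (\<sigma> ` (S \<union> T)) x"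
      using surj[OF ne_image[OF U] y] by blast
    have ax: "act A (S \<union> T) \<sigma> x \<in> vcar (comp A (S \<union> T))"
      by (rule linear_onD(1)[OF actA[OF U inj] x(1)])
    have eqA: "cobr A S T (act A (S \<union> T) \<sigma> x) =
        tensor_map (comp A (\<sigma> ` S)) (comp A (\<sigma> ` T)) (comp A S) (comp A T)
          (act A S \<sigma>) (act A T \<sigma>) (cobr A (\<sigma> ` S) (\<sigma> ` T) x)"
      by (rule equivariance[OF * x(1)])
    have x': "x \<in> vcar (comp A (\<sigma> ` S \<union> \<sigma> ` T))" using x(1) by (simp add: image_Un)
    have "cobr B S T (act B (S \<union> T) \<sigma> y) =
        tensor_map (comp A S) (comp A T) (comp B S) (comp B T) (\<phi> S) (\<phi> T)
         (tensor_map (comp A (\<sigma> ` S)) (comp A (\<sigma> ` T)) (comp A S) (comp A T)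
          (act A S \<sigma>) (act A T \<sigma>) (cobr A (\<sigma> ` S) (\<sigma> ` T) x))"
      unfolding x(2) \<phi>act[OF U inj x(1)] \<phi>cobr[OF ST ax] eqA ..
    also have "\<dots> = tensor_map (comp B (\<sigma> ` S)) (comp B (\<sigma> ` T)) (comp B S) (comp B T)
          (act B S \<sigma>) (act B T \<sigma>)
         (tensor_map (comp A (\<sigma> ` S)) (comp A (\<sigma> ` T)) (comp B (\<sigma> ` S)) (comp B (\<sigma> ` T))
            (\<phi> (\<sigma> ` S)) (\<phi> (\<sigma> ` T)) (cobr A (\<sigma> ` S) (\<sigma> ` T) x))"
      using linear_onD(1)[OF actA[OF ST(1) injS(1)]] linear_onD(1)[OF actA[OF ST(2) injS(2)]]
        linear_onD(1)[OF lin\<phi>[OF \<sigma>ST(1)]] linear_onD(1)[OF lin\<phi>[OF \<sigma>ST(2)]]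
        \<phi>act[OF ST(1) injS(1)] \<phi>act[OF ST(2) injS(2)]
      by (intro tensor_map_comp_eqI pullback_in_dual vA vB ST \<sigma>ST) (auto intro: lin\<phi> actB ST injS)
    also have "\<dots> = tensor_map (comp B (\<sigma> ` S)) (comp B (\<sigma> ` T)) (comp B S) (comp B T)
          (act B S \<sigma>) (act B T \<sigma>) (cobr B (\<sigma> ` S) (\<sigma> ` T) y)"
      unfolding x(2) image_Un \<phi>cobr[OF \<sigma>ST x'] ..
    finally show "cobr B S T (act B (S \<union> T) \<sigma> y) = \<dots>" .
  next
    fix S T :: "'a set" and y assume *: "fin_ne S \<and> fin_ne T \<and> S \<inter> T = {}" and y: "y \<in> vcar (comp B (S \<union> T))"
    then have ST: "fin_ne S" "fin_ne T" "S \<inter> T = {}" and TS: "T \<inter> S = {}" by auto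
    obtain x where x: "x \<in> vcar (comp A (S \<union> T))" "y = \<phi> (S \<union> T) x"
      using surj[OF ne_Un[OF ST(1,2)] y] by blast
    have x': "x \<in> vcar (comp A (T \<union> S))" "y = \<phi> (T \<union> S) x" using x by (simp_all add: Un_commute)
    have "cobr A T S x = - tensor_swap (cobr A S T x)"
      by (rule antisymmetry[OF * x(1)])
    then have "cobr B T S y = - tensor_map (comp A T) (comp A S) (comp B T) (comp B S) (\<phi> T) (\<phi> S)
        (tensor_swap (cobr A S T x))"
      unfolding x'(2) \<phi>cobr[OF ST(2,1) TS x'(1)] by (simp add: tensor_map_linear)
    then show "cobr B T S y = - tensor_swap (cobr B S T y)"
      unfolding x(2) \<phi>cobr[OF ST x(1)] tensor_map_swap .
  next
    fix R S T :: "'a set" and y \<xi> \<eta> \<zeta>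
    assume *: "fin_ne R \<and> fin_ne S \<and> fin_ne T \<and> R \<inter> S = {} \<and> R \<inter> T = {} \<and> S \<inter> T = {}"
      and y: "y \<in> vcar (comp B (R \<union> S \<union> T))"
      and d: "\<xi> \<in> dual (comp B R)" "\<eta> \<in> dual (comp B S)" "\<zeta> \<in> dual (comp B T)"
    have U: "fin_ne (R \<union> S \<union> T)" using * by (simp add: fin_ne_def)
    obtain x where x: "x \<in> vcar (comp A (R \<union> S \<union> T))" "y = \<phi> (R \<union> S \<union> T) x" using surj[OF U y] by blast
    have dA: "pullback (comp A R) (\<phi> R) \<xi> \<in> dual (comp A R)"
      "pullback (comp A S) (\<phi> S) \<eta> \<in> dual (comp A S)" "pullback (comp A T) (\<phi> T) \<zeta> \<in> dual (comp A T)"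
      using * d by (auto intro!: pullback_in_dual vA lin\<phi>)
    let ?\<xi> = "pullback (comp A R) (\<phi> R) \<xi>" and ?\<eta> = "pullback (comp A S) (\<phi> S) \<eta>"
      and ?\<zeta> = "pullback (comp A T) (\<phi> T) \<zeta>"
    have "cobr B (R \<union> S) T y (dual_bracket B R S \<xi> \<eta>, \<zeta>) =
        cobr A (R \<union> S) T x (dual_bracket A R S ?\<xi> ?\<eta>, ?\<zeta>)"
      unfolding x(2) by (rule bracket) (use * d x(1) in auto)
    moreover have "cobr B (S \<union> T) R y (dual_bracket B S T \<eta> \<zeta>, \<xi>) =
        cobr A (S \<union> T) R x (dual_bracket A S T ?\<eta> ?\<zeta>, ?\<xi>)"
      unfolding x(2) by (rule bracket) (use * d x(1) in auto)
    moreover have "cobr B (T \<union> R) S y (dual_bracket B T R \<zeta> \<xi>, \<eta>) =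
        cobr A (T \<union> R) S x (dual_bracket A T R ?\<zeta> ?\<xi>, ?\<eta>)"
      unfolding x(2) by (rule bracket) (use * d x(1) in auto)
    ultimately show "cobr B (R \<union> S) T y (dual_bracket B R S \<xi> \<eta>, \<zeta>) +
           cobr B (S \<union> T) R y (dual_bracket B S T \<eta> \<zeta>, \<xi>) +
           cobr B (T \<union> R) S y (dual_bracket B T R \<zeta> \<xi>, \<eta>) = 0"
      using jacobi[OF * x(1) dA] by simp
  qed
qed

section \<open>The cobracket of the indecomposable quotient\<close>

text \<open>The cobracket computed from a representative \<open>f\<close>, with both tensor factors
  already projected to the quotients. Until independence of the representative is proved it depends
  on \<open>f\<close> and not on a coset.\<close>

definition cocomm :: "'a set \<Rightarrow> 'a set \<Rightarrow> ('a set list \<Rightarrow> 'k::field) \<Rightarrow>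
    (('a set list \<Rightarrow> 'k) set, ('a set list \<Rightarrow> 'k) set, 'k) tens" where
  "cocomm S T f = (\<Sum>F\<in>compositions S. \<Sum>G\<in>compositions T.
     fscale (f (F @ G) - f (G @ F)) (pure_tensor (Zie_space S) (Zie_space T) (zm S F) (zm T G)))"

lemma zm_in_Zie_space: "F \<in> compositions I \<Longrightarrow> zm I F \<in> vcar (Zie_space I)"
  by (simp add: zm_def vcar_Zie_space bM_in_Sig)

lemma cocomm_apply:
  "cocomm S T f (\<xi>, \<eta>) = (if \<xi> \<in> dual (Zie_space S) \<and> \<eta> \<in> dual (Zie_space T) then
     \<Sum>F\<in>compositions S. \<Sum>G\<in>compositions T. (f (F @ G) - f (G @ F)) * \<xi> (zm S F) * \<eta> (zm T G) else 0)"
  by (cases "\<xi> \<in> dual (Zie_space S)"; cases "\<eta> \<in> dual (Zie_space T)")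
    (simp_all add: cocomm_def sum_fun_apply fscale_apply pure_tensor_def mult.assoc)

lemma cocomm_linear:
  "cocomm S T (f + g) = cocomm S T f + cocomm S T g"
  "cocomm S T (f - g) = cocomm S T f - cocomm S T g"
  "cocomm S T (fscale c f) = fscale c (cocomm S T f)"
  by (simp_all add: fun_eq_iff cocomm_apply fscale_apply algebra_simps sum.distrib sum_subtractf
      sum_distrib_left)

lemma cocomm_in_tensor: "cocomm S T f \<in> vcar (tensor (Zie_space S) (Zie_space T))"
  unfolding cocomm_def
  by (intro fun_vs.subspace_sum[OF tensor_subspace] fun_vs.subspace_scale[OF tensor_subspace]
      pure_tensor_in_tensor zm_in_Zie_space)

lemma linear_zproj: "linear_on (fun_space (Sig I)) (Zie_space I) (zproj I)"
  by (auto simp: linear_on_def fun_space_def vcar_Zie_space vadd_Zie_space vscale_Zie_space)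

lemma pullback_zproj:
  assumes "\<xi> \<in> dual (Zie_space I)"
  shows "pullback (fun_space (Sig I)) (zproj I) \<xi> \<in> dual (fun_space (Sig I))"
    and "F \<in> compositions I \<Longrightarrow> pullback (fun_space (Sig I)) (zproj I) \<xi> (bM F) = \<xi> (zm I F)"
proof -
  show "pullback (fun_space (Sig I)) (zproj I) \<xi> \<in> dual (fun_space (Sig I))"
    by (rule pullback_in_dual[OF is_vspace_fun_space[OF Sig_subspace] linear_zproj assms])
  show "pullback (fun_space (Sig I)) (zproj I) \<xi> (bM F) = \<xi> (zm I F)" if "F \<in> compositions I"
    using bM_in_Sig[OF that, where 'b = 'b] by (simp add: pullback_def zm_def fun_space_def)
qed

text \<open>Pulled back along \<open>zproj\<close>, a functional on the quotient takes at
  \<open>bM F\<close> its value at \<open>zm I F\<close>. This turns the expression inside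
  \<open>Zie_cobr\<close> into an explicit sum.\<close>

lemma tensor_map_deconcat:
  "tensor_map (fun_space (Sig S)) (fun_space (Sig T)) (Zie_space S) (Zie_space T)
     (zproj S) (zproj T) (deconcat S T f - tensor_swap (deconcat T S f)) = cocomm S T f" (is "?L = _")
proof -
  have "?L (\<xi>, \<eta>) = cocomm S T f (\<xi>, \<eta>)" for \<xi> \<eta>
  proof (cases "\<xi> \<in> dual (Zie_space S) \<and> \<eta> \<in> dual (Zie_space T)")
    case True
    then have \<xi>: "\<xi> \<in> dual (Zie_space S)" and \<eta>: "\<eta> \<in> dual (Zie_space T)" by auto
    note p\<xi> = pullback_zproj[OF \<xi>] and p\<eta> = pullback_zproj[OF \<eta>]
    have "?L (\<xi>, \<eta>) =
        (\<Sum>F\<in>compositions S. \<Sum>G\<in>compositions T. f (F @ G) * (\<xi> (zm S F) * \<eta> (zm T G))) -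
        (\<Sum>G\<in>compositions T. \<Sum>F\<in>compositions S. f (G @ F) * (\<eta> (zm T G) * \<xi> (zm S F)))"
      using True by (simp add: tensor_map_apply tensor_swap_apply deconcat_def sum_fun_apply
          fscale_apply pure_tensor_def p\<xi> p\<eta>)
    also have "(\<Sum>G\<in>compositions T. \<Sum>F\<in>compositions S. f (G @ F) * (\<eta> (zm T G) * \<xi> (zm S F))) =
        (\<Sum>F\<in>compositions S. \<Sum>G\<in>compositions T. f (G @ F) * (\<eta> (zm T G) * \<xi> (zm S F)))"
      by (rule sum.swap)
    also have "(\<Sum>F\<in>compositions S. \<Sum>G\<in>compositions T. f (F @ G) * (\<xi> (zm S F) * \<eta> (zm T G))) - \<dots> =
        cocomm S T f (\<xi>, \<eta>)"
      using True by (simp add: cocomm_apply sum_subtractf[symmetric] algebra_simps)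
    finally show ?thesis .
  next
    case False then show ?thesis by (auto simp: tensor_map_apply cocomm_apply)
  qed
  then show ?thesis by (simp add: fun_eq_iff)
qed

text \<open>The Dynkin functional of the chamber \<open>C\<close>, viewed on the quotient; on the
  adjoint side it corresponds to evaluation at \<open>C\<close>.\<close>

definition zie_eval :: "'a set \<Rightarrow> ('a \<Rightarrow> real) set \<Rightarrow> ('a set list \<Rightarrow> 'k::field) set \<Rightarrow> 'k" where
  "zie_eval I C = pullback (Zie_space I) (zie_map I) (chamber_eval I C)"

lemma chamber_eval_in_dual: "chamber_eval I C \<in> dual (adjZie_space I)"
  by (simp add: dual_def chamber_eval_def adjZie_space_ops fscale_apply
      vspaceD(2,3)[OF is_vspace_adjZie_space, unfolded adjZie_space_ops])

lemma zie_eval_in_dual: "fin_ne I \<Longrightarrow> zie_eval I C \<in> dual (Zie_space I)"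
  unfolding zie_eval_def
  by (rule pullback_in_dual[OF is_vspace_Zie_space linear_zie_map chamber_eval_in_dual])

lemma zie_eval_zproj:
  assumes "fin_ne I" "f \<in> Sig I" shows "zie_eval I C (zproj I f) = dynkin_map I f C"
  using assms by (simp add: zie_eval_def pullback_def vcar_Zie_space chamber_eval_def
      zie_map_zproj vcar_adjZie_space)

text \<open>This restates that the common kernel of the Dynkin functionals consists of
  decomposables.\<close>

lemma zie_eval_separates:
  assumes I: "fin_ne I" and X: "X \<in> vcar (Zie_space I)"
    and zero: "\<And>C. C \<in> adj_chambers I \<Longrightarrow> zie_eval I C X = 0"
  shows "X = vzero (Zie_space I)"
proof -
  obtain f where f: "f \<in> Sig I" "X = zproj I f" using X by (auto simp: vcar_Zie_space)
  have "dynkin_map I f C = 0" for C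
    using zero[of C] zie_eval_zproj[OF I f(1)] f(2) by (cases "C \<in> adj_chambers I") (auto simp: dynkin_map_def)
  then have "dynkin_map I f = 0" by (simp add: fun_eq_iff)
  then have "f \<in> decomposables I" using dynkin_map_eq_0_iff[OF I f(1)] by blast
  then show ?thesis by (simp add: f(2) vzero_Zie_space zproj_eq_iff)
qed

lemma chamber_eval_separates:
  assumes I: "fin_ne I" and g: "g \<in> vcar (adjZie_space I)"
    and zero: "\<And>C. C \<in> adj_chambers I \<Longrightarrow> chamber_eval I C g = 0"
  shows "g = vzero (adjZie_space I)"
proof -
  obtain f where f: "g = dynkin_map I f" using g by (auto simp: vcar_adjZie_space[OF I])
  have "g C = 0" for C
    using zero[of C] g f by (cases "C \<in> adj_chambers I") (auto simp: dynkin_map_def chamber_eval_def)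
  then show ?thesis by (simp add: adjZie_space_ops fun_eq_iff)
qed

text \<open>The wall formula read in the quotient: pairing the cobracket with two chambers gives the
  jump across a wall lying over them.\<close>

lemma cocomm_eval:
  assumes ST: "fin_ne S" "fin_ne T" "S \<inter> T = {}"
    and x: "generic_wall S T x" and v: "beside S T x v" and w: "beside T S x w"
    and C: "C \<in> adj_chambers S" "(\<lambda>i. if i \<in> S then x i else 0) \<in> C"
    and D: "D \<in> adj_chambers T" "(\<lambda>i. if i \<in> T then x i else 0) \<in> D"
  shows "cocomm S T f (zie_eval S C, zie_eval T D) = dynkin v (S \<union> T) f - dynkin w (S \<union> T) f"
proof -
  have fin: "finite S" "finite T" "S \<noteq> {}" "T \<noteq> {}" using ST by (auto simp: fin_ne_def)
  have S: "zie_eval S C (zm S F) = dynkin x S (bM F)" if "F \<in> compositions S" for F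
    unfolding zm_def zie_eval_zproj[OF ST(1) bM_in_Sig[OF that]] dynkin_map_chamber[OF C]
    by (rule dynkin_restrict) simp
  have T: "zie_eval T D (zm T F) = dynkin x T (bM F)" if "F \<in> compositions T" for F
    unfolding zm_def zie_eval_zproj[OF ST(2) bM_in_Sig[OF that]] dynkin_map_chamber[OF D]
    by (rule dynkin_restrict) simp
  show ?thesis
    unfolding dynkin_wall[OF fin ST(3) x v w]
    by (simp add: cocomm_apply zie_eval_in_dual ST S T)
qed

lemma wall_over_chambers:
  assumes ST: "fin_ne S" "fin_ne T" "S \<inter> T = {}" and C: "C \<in> adj_chambers S" and D: "D \<in> adj_chambers T"
  obtains x where "generic_wall S T x" "(\<lambda>i. if i \<in> S then x i else 0) \<in> C"
    "(\<lambda>i. if i \<in> T then x i else 0) \<in> D"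
proof -
  have fin: "finite S" "finite T" "S \<noteq> {}" "T \<noteq> {}" using ST by (auto simp: fin_ne_def)
  obtain u w where uw: "C = adj_face S u" "generic S u" "D = adj_face T w" "generic T w"
    using C D by (auto simp: adj_chambers_eq)
  show ?thesis
    by (rule wall_point_exists[OF fin ST(3) uw(2,4)]) (use that uw in blast)
qed

lemma sides_exist:
  assumes ST: "fin_ne S" "fin_ne T" "S \<inter> T = {}" and x: "generic_wall S T x"
  obtains v w where "beside S T x v" "beside T S x w"
proof -
  have fin: "finite S" "finite T" "S \<noteq> {}" "T \<noteq> {}" using ST by (auto simp: fin_ne_def)
  obtain v where v: "beside S T x v" by (rule beside_exists[OF fin ST(3) x])
  have "T \<inter> S = {}" using ST by blast
  then obtain w where w: "beside T S x w"
    by (rule beside_exists[OF fin(2,1,4,3) _ generic_wall_commute[OF fin(1,2) ST(3) x]])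
  show ?thesis by (rule that[OF v w])
qed

text \<open>No deconcatenation of a quasishuffle is computed. At a pair of chambers the tensor takes
  the difference of two Dynkin functionals over \<open>S \<union> T\<close>, both of which kill
  decomposables, and such pairs separate tensors.\<close>

lemma cocomm_decomposables:
  fixes f :: "'a set list \<Rightarrow> 'k::field"
  assumes ST: "fin_ne S" "fin_ne T" "S \<inter> T = {}" and f: "f \<in> decomposables (S \<union> T)"
  shows "cocomm S T f = 0"
proof (rule tensor_separation[OF is_vspace_Zie_space is_vspace_Zie_space cocomm_in_tensor
      zie_eval_in_dual[OF ST(1)] zie_eval_separates[OF ST(1)]
      zie_eval_in_dual[OF ST(2)] zie_eval_separates[OF ST(2)]])
  fix C D assume CD: "C \<in> adj_chambers S" "D \<in> adj_chambers T"
  obtain x where x: "generic_wall S T x" "(\<lambda>i. if i \<in> S then x i else 0) \<in> C"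
    "(\<lambda>i. if i \<in> T then x i else 0) \<in> D"
    by (rule wall_over_chambers[OF ST CD])
  obtain v w where vw: "beside S T x v" "beside T S x w" by (rule sides_exist[OF ST x(1)])
  have fin: "finite S" "finite T" "finite (S \<union> T)" using ST by (auto simp: fin_ne_def)
  have TS: "T \<inter> S = {}" "T \<union> S = S \<union> T" using ST(3) by auto
  have "generic (S \<union> T) v" by (rule beside_generic[OF fin(1,2) ST(3) x(1) vw(1)])
  moreover have "generic (S \<union> T) w"
    using beside_generic[OF fin(2,1) TS(1) generic_wall_commute[OF fin(1,2) ST(3) x(1)] vw(2)]
    by (simp only: TS(2))
  ultimately show "cocomm S T f (zie_eval S C, zie_eval T D) = 0"
    unfolding cocomm_eval[OF ST x(1) vw CD(1) x(2) CD(2) x(3)]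
    using dynkin_decomposables[OF fin(3) _ f] by simp
qed

text \<open>Representatives differ by decomposables, on which \<open>cocomm\<close> vanishes, so the
  definite description in \<open>Zie_cobr\<close> has exactly one solution.\<close>

lemma Zie_cobr_zproj:
  fixes f :: "'a set list \<Rightarrow> 'k::field"
  assumes ST: "fin_ne S" "fin_ne T" "S \<inter> T = {}" and f: "f \<in> Sig (S \<union> T)"
  shows "Zie_cobr S T (zproj (S \<union> T) f) = cocomm S T f"
proof -
  have "cocomm S T g = cocomm S T f" if "g \<in> zproj (S \<union> T) f" for g
  proof -
    have "cocomm S T (g - f) = 0" by (rule cocomm_decomposables[OF ST mem_zprojD(3)[OF that f]])
    then show ?thesis by (simp add: cocomm_linear)
  qed
  then have "(\<exists>g\<in>zproj (S \<union> T) f. t = cocomm S T g) \<longleftrightarrow> t = cocomm S T f" for t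
    using mem_zproj by metis
  then show ?thesis unfolding Zie_cobr_def tensor_map_deconcat by simp
qed

lemma Sig_act_bM:
  assumes "inj_on \<sigma> I" "F \<in> compositions I" shows "Sig_act I \<sigma> (bM (map ((`) \<sigma>) F)) = bM F"
proof
  fix G
  show "Sig_act I \<sigma> (bM (map ((`) \<sigma>) F)) G = bM F G"
  proof (cases "G \<in> compositions I")
    case True
    have "H = map ((`) (inv_into I \<sigma>)) (map ((`) \<sigma>) H)" if "H \<in> compositions I" for H
    proof -
      have "map ((`) (inv_into I \<sigma>)) (map ((`) \<sigma>) H) = map ((`) id) H"
        by (rule map_image_comp_composition[OF that]) (simp add: assms(1))
      then show ?thesis by simp
    qed
    then have "map ((`) \<sigma>) G = map ((`) \<sigma>) F \<longleftrightarrow> G = F" using True assms(2) by metis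
    then show ?thesis using True by (simp add: Sig_act_def bM_def)
  next
    case False then show ?thesis using assms(2) by (auto simp: Sig_act_def bM_def)
  qed
qed

lemma sum_cocomm_delta:
  fixes g :: "'a set list \<Rightarrow> 'k::field"
  assumes "finite R" "finite S" "R \<inter> S = {}" "F \<in> compositions R" "G \<in> compositions S"
  shows "(\<Sum>H\<in>compositions (R \<union> S). g H * (bM H (F @ G) - bM H (G @ F))) = g (F @ G) - g (G @ F)"
proof -
  have fin: "finite (compositions (R \<union> S))" using assms finite_compositions by blast
  have "F @ G \<in> compositions (R \<union> S)" using append_compositions_disjoint assms by blast
  moreover have "G @ F \<in> compositions (R \<union> S)"
    using append_compositions_disjoint[OF assms(5,4)] assms(3) by (simp add: Un_commute Int_commute)
  moreover have "g H * (bM H (F @ G) - bM H (G @ F)) =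
      (if F @ G = H then g H else 0) - (if G @ F = H then g H else 0)" for H
    by (auto simp: bM_def)
  ultimately show ?thesis using fin by (simp add: sum_subtractf)
qed

text \<open>The axioms are checked here because the cobracket is an explicit sum over compositions;
  on the adjoint side it is only known as the solution of equations.\<close>

lemma is_lie_coalgebra_Zie:
  "is_lie_coalgebra (Zie :: ('a, ('a set list \<Rightarrow> 'k::field) set, 'k) cobracket_data)"
proof -
  let ?Z = "Zie :: ('a, ('a set list \<Rightarrow> 'k) set, 'k) cobracket_data"
  have Z: "comp ?Z = Zie_space" "act ?Z = (\<lambda>I \<sigma> X. Sig_act I \<sigma> ` X)" "cobr ?Z = Zie_cobr"
    by (simp_all add: Zie_def)
  have lin: "linear_on (Zie_space (S \<union> T)) (tensor (Zie_space S) (Zie_space T))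
      (Zie_cobr S T :: ('a set list \<Rightarrow> 'k) set \<Rightarrow> _)"
    if ST: "fin_ne S" "fin_ne T" "S \<inter> T = {}" for S T :: "'a set"
    unfolding linear_on_def vcar_Zie_space
    by (auto simp: Zie_cobr_zproj[OF ST] cocomm_in_tensor tensor_ops(1,2) vadd_Zie_space vscale_Zie_space
        Sig_add Sig_scale cocomm_linear)
  \<comment> \<open>The iterated cobracket as a sum over triples of compositions: inserting the
    inner cocommutator selects \<open>H = F @ G\<close> and \<open>H = G @ F\<close>, and the outer
    one places \<open>K\<close> behind or in front.\<close>
  have bracket: "Zie_cobr (P \<union> Q) W (zproj U f) (dual_bracket ?Z P Q \<xi> \<eta>, \<zeta>) =
      (\<Sum>F\<in>compositions P. \<Sum>G\<in>compositions Q. \<Sum>K\<in>compositions W.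
         (f (F @ G @ K) - f (K @ F @ G) - f (G @ F @ K) + f (K @ G @ F)) *
           (\<xi> (zm P F) * \<eta> (zm Q G) * \<zeta> (zm W K)))"
    if P: "fin_ne P" "fin_ne Q" "fin_ne W" "P \<inter> Q = {}" "P \<inter> W = {}" "Q \<inter> W = {}" "P \<union> Q \<union> W = U"
      and f: "f \<in> Sig U"
      and d: "\<xi> \<in> dual (Zie_space P)" "\<eta> \<in> dual (Zie_space Q)" "\<zeta> \<in> dual (Zie_space W)"
    for P Q W U :: "'a set" and f :: "'a set list \<Rightarrow> 'k" and \<xi> \<eta> \<zeta>
  proof -
    let ?b = "dual_bracket ?Z P Q \<xi> \<eta>"
    have PQ: "fin_ne (P \<union> Q)" "(P \<union> Q) \<inter> W = {}" using P by (auto simp: fin_ne_def)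
    have fin: "finite P" "finite Q" using P by (auto simp: fin_ne_def)
    have b: "?b \<in> dual (Zie_space (P \<union> Q))"
      using dual_bracket_in_dual[of ?Z P Q] lin[OF P(1,2,4)] by (simp add: Z is_vspace_Zie_space)
    have b_zm: "?b (zm (P \<union> Q) H) = (\<Sum>F\<in>compositions P. \<Sum>G\<in>compositions Q.
        (bM H (F @ G) - bM H (G @ F)) * \<xi> (zm P F) * \<eta> (zm Q G))" if H: "H \<in> compositions (P \<union> Q)" for H
    proof -
      have "Zie_cobr P Q (zm (P \<union> Q) H) = cocomm P Q (bM H :: _ \<Rightarrow> 'k)"
        unfolding zm_def by (rule Zie_cobr_zproj[OF P(1,2,4) bM_in_Sig[OF H]])
      then show ?thesis using d by (simp add: dual_bracket_def Z zm_in_Zie_space[OF H] cocomm_apply)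
    qed
    have "Zie_cobr (P \<union> Q) W (zproj U f) (?b, \<zeta>) =
        (\<Sum>H\<in>compositions (P \<union> Q). \<Sum>K\<in>compositions W. (f (H @ K) - f (K @ H)) * ?b (zm (P \<union> Q) H) * \<zeta> (zm W K))"
      using Zie_cobr_zproj[OF PQ(1) P(3) PQ(2), of f] f b d by (simp add: P(7) cocomm_apply)
    also have "\<dots> = (\<Sum>H\<in>compositions (P \<union> Q). \<Sum>K\<in>compositions W. \<Sum>F\<in>compositions P. \<Sum>G\<in>compositions Q.
        (f (H @ K) - f (K @ H)) * (bM H (F @ G) - bM H (G @ F)) * (\<xi> (zm P F) * \<eta> (zm Q G) * \<zeta> (zm W K)))"
      by (intro sum.cong[OF refl]) (simp add: b_zm sum_distrib_left sum_distrib_right mult_ac)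
    also have "\<dots> = (\<Sum>F\<in>compositions P. \<Sum>G\<in>compositions Q. \<Sum>K\<in>compositions W. \<Sum>H\<in>compositions (P \<union> Q).
        (f (H @ K) - f (K @ H)) * (bM H (F @ G) - bM H (G @ F)) * (\<xi> (zm P F) * \<eta> (zm Q G) * \<zeta> (zm W K)))"
      unfolding sum.cartesian_product
      by (rule sum.reindex_bij_witness[where i = "\<lambda>(F, G, K, H). (H, K, F, G)" and j = "\<lambda>(H, K, F, G). (F, G, K, H)"]) auto
    also have "\<dots> = (\<Sum>F\<in>compositions P. \<Sum>G\<in>compositions Q. \<Sum>K\<in>compositions W.
         (f (F @ G @ K) - f (K @ F @ G) - f (G @ F @ K) + f (K @ G @ F)) *
           (\<xi> (zm P F) * \<eta> (zm Q G) * \<zeta> (zm W K)))"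
    proof (intro sum.cong[OF refl])
      fix F G K assume "F \<in> compositions P" "G \<in> compositions Q"
      from sum_cocomm_delta[OF fin P(4) this, of "\<lambda>H. f (H @ K) - f (K @ H)"]
      show "(\<Sum>H\<in>compositions (P \<union> Q). (f (H @ K) - f (K @ H)) * (bM H (F @ G) - bM H (G @ F)) *
          (\<xi> (zm P F) * \<eta> (zm Q G) * \<zeta> (zm W K))) =
          (f (F @ G @ K) - f (K @ F @ G) - f (G @ F @ K) + f (K @ G @ F)) *
           (\<xi> (zm P F) * \<eta> (zm Q G) * \<zeta> (zm W K))"
        unfolding sum_distrib_right[symmetric] by simp
    qed
    finally show ?thesis .
  qed
  show ?thesis
    unfolding is_lie_coalgebra_def Z
  proof (intro conjI allI impI ballI)
    show "is_cospecies ?Z" by (rule is_cospecies_Zie)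
  next
    fix S T :: "'a set" assume "fin_ne S \<and> fin_ne T \<and> S \<inter> T = {}"
    then show "linear_on (Zie_space (S \<union> T)) (tensor (Zie_space S) (Zie_space T))
      (Zie_cobr S T :: ('a set list \<Rightarrow> 'k) set \<Rightarrow> _)" using lin by blast
  next
    fix S T :: "'a set" and \<sigma> :: "'a \<Rightarrow> 'a" and X :: "('a set list \<Rightarrow> 'k) set"
    assume *: "fin_ne S \<and> fin_ne T \<and> S \<inter> T = {} \<and> inj_on \<sigma> (S \<union> T)"
      and X: "X \<in> vcar (Zie_space (\<sigma> ` (S \<union> T)))"
    then have ST: "fin_ne S" "fin_ne T" "S \<inter> T = {}" and inj: "inj_on \<sigma> (S \<union> T)" by auto
    have injS: "inj_on \<sigma> S" "inj_on \<sigma> T" using inj by (auto intro: inj_on_subset)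
    have U: "fin_ne (S \<union> T)" using ST by (simp add: fin_ne_def)
    have \<sigma>ST: "fin_ne (\<sigma> ` S)" "fin_ne (\<sigma> ` T)" "\<sigma> ` S \<inter> \<sigma> ` T = {}"
      using ST inj_on_image_Int[OF inj, of S T] by (auto simp: fin_ne_def)
    obtain f where f: "f \<in> Sig (\<sigma> ` S \<union> \<sigma> ` T)" "X = zproj (\<sigma> ` (S \<union> T)) f"
      using X by (auto simp: vcar_Zie_space image_Un)
    have L: "Zie_cobr S T (Sig_act (S \<union> T) \<sigma> ` X) = cocomm S T (Sig_act (S \<union> T) \<sigma> f)"
      unfolding f(2) Sig_act_zproj[OF U inj] by (rule Zie_cobr_zproj[OF ST Sig_act_in_Sig])
    have R: "Zie_cobr (\<sigma> ` S) (\<sigma> ` T) X = cocomm (\<sigma> ` S) (\<sigma> ` T) f"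
      unfolding f(2) image_Un by (rule Zie_cobr_zproj[OF \<sigma>ST f(1)])
    have act_lin: "linear_on (Zie_space (\<sigma> ` I)) (Zie_space I) (\<lambda>X. Sig_act I \<sigma> ` X :: ('a set list \<Rightarrow> 'k) set)"
      if "fin_ne I" "inj_on \<sigma> I" for I
      using is_cospecies_Zie[where 'a = 'a and 'b = 'k] that by (simp add: is_cospecies_def Z)
    have pb_zm: "pullback (Zie_space (\<sigma> ` I)) (\<lambda>X. Sig_act I \<sigma> ` X) \<xi> (zm (\<sigma> ` I) (map ((`) \<sigma>) F)) = \<xi> (zm I F)"
      if "fin_ne I" "inj_on \<sigma> I" "F \<in> compositions I" for I F and \<xi> :: "('a set list \<Rightarrow> 'k) set \<Rightarrow> 'k"
      using zm_in_Zie_space[OF map_image_in_compositions[OF that(2,3)], where 'b = 'k]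
      by (simp add: pullback_def zm_def Sig_act_zproj[OF that(1,2)] Sig_act_bM[OF that(2,3)])
    have "cocomm S T (Sig_act (S \<union> T) \<sigma> f) (\<xi>, \<eta>) =
        tensor_map (Zie_space (\<sigma> ` S)) (Zie_space (\<sigma> ` T)) (Zie_space S) (Zie_space T)
          (\<lambda>X. Sig_act S \<sigma> ` X) (\<lambda>X. Sig_act T \<sigma> ` X) (cocomm (\<sigma> ` S) (\<sigma> ` T) f) (\<xi>, \<eta>)" for \<xi> \<eta>
    proof (cases "\<xi> \<in> dual (Zie_space S) \<and> \<eta> \<in> dual (Zie_space T)")
      case True
      have "pullback (Zie_space (\<sigma> ` S)) (\<lambda>X. Sig_act S \<sigma> ` X) \<xi> \<in> dual (Zie_space (\<sigma> ` S))"
        "pullback (Zie_space (\<sigma> ` T)) (\<lambda>X. Sig_act T \<sigma> ` X) \<eta> \<in> dual (Zie_space (\<sigma> ` T))"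
        using True by (auto intro!: pullback_in_dual is_vspace_Zie_space act_lin ST injS)
      moreover have "Sig_act (S \<union> T) \<sigma> f (F @ G) = f (map ((`) \<sigma>) F @ map ((`) \<sigma>) G)"
        "Sig_act (S \<union> T) \<sigma> f (G @ F) = f (map ((`) \<sigma>) G @ map ((`) \<sigma>) F)"
        if "F \<in> compositions S" "G \<in> compositions T" for F G
        using append_compositions_disjoint[OF that ST(3)] append_compositions_disjoint[OF that(2,1)] ST(3)
        by (simp_all add: Sig_act_def Un_commute Int_commute)
      ultimately show ?thesis
        using True by (simp add: tensor_map_apply cocomm_apply sum_compositions_image[OF injS(1), symmetric]
            sum_compositions_image[OF injS(2), symmetric] pb_zm[OF ST(1) injS(1)] pb_zm[OF ST(2) injS(2)])
    next
      case False then show ?thesis by (auto simp: tensor_map_apply cocomm_apply)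
    qed
    then show "Zie_cobr S T (Sig_act (S \<union> T) \<sigma> ` X) =
        tensor_map (Zie_space (\<sigma> ` S)) (Zie_space (\<sigma> ` T)) (Zie_space S) (Zie_space T)
          ((`) (Sig_act S \<sigma>)) ((`) (Sig_act T \<sigma>)) (Zie_cobr (\<sigma> ` S) (\<sigma> ` T) X)"
      unfolding L R by (simp add: fun_eq_iff)
  next
    fix S T :: "'a set" and X :: "('a set list \<Rightarrow> 'k) set"
    assume *: "fin_ne S \<and> fin_ne T \<and> S \<inter> T = {}" and X: "X \<in> vcar (Zie_space (S \<union> T))"
    then have ST: "fin_ne S" "fin_ne T" "S \<inter> T = {}" and TS: "T \<inter> S = {}" "T \<union> S = S \<union> T" by auto
    obtain f where f: "f \<in> Sig (S \<union> T)" "X = zproj (S \<union> T) f" using X by (auto simp: vcar_Zie_space)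
    have L: "Zie_cobr T S X = cocomm T S f"
      using Zie_cobr_zproj[OF ST(2,1) TS(1), of f] f by (simp only: TS(2))
    have R: "Zie_cobr S T X = cocomm S T f" unfolding f(2) by (rule Zie_cobr_zproj[OF ST f(1)])
    have "cocomm T S f (\<eta>, \<xi>) = - cocomm S T f (\<xi>, \<eta>)" for \<xi> \<eta>
    proof (cases "\<xi> \<in> dual (Zie_space S) \<and> \<eta> \<in> dual (Zie_space T)")
      case True
      then have "cocomm T S f (\<eta>, \<xi>) = (\<Sum>F\<in>compositions S. \<Sum>G\<in>compositions T.
          (f (G @ F) - f (F @ G)) * \<eta> (zm T G) * \<xi> (zm S F))"
        by (simp add: cocomm_apply) (rule sum.swap)
      then show ?thesis using True by (simp add: cocomm_apply sum_negf[symmetric] algebra_simps)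
    next
      case False then show ?thesis by (auto simp: cocomm_apply)
    qed
    then show "Zie_cobr T S X = - tensor_swap (Zie_cobr S T X)"
      unfolding L R by (simp add: fun_eq_iff tensor_swap_apply)
  next
    fix R S T :: "'a set" and X :: "('a set list \<Rightarrow> 'k) set"
      and \<xi> \<eta> \<zeta> :: "('a set list \<Rightarrow> 'k) set \<Rightarrow> 'k"
    assume *: "fin_ne R \<and> fin_ne S \<and> fin_ne T \<and> R \<inter> S = {} \<and> R \<inter> T = {} \<and> S \<inter> T = {}"
      and X: "X \<in> vcar (Zie_space (R \<union> S \<union> T))"
      and d: "\<xi> \<in> dual (Zie_space R)" "\<eta> \<in> dual (Zie_space S)" "\<zeta> \<in> dual (Zie_space T)"
    obtain f where f: "f \<in> Sig (R \<union> S \<union> T)" "X = zproj (R \<union> S \<union> T) f" using X by (auto simp: vcar_Zie_space)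
    let ?p = "\<lambda>F G K. \<xi> (zm R F) * \<eta> (zm S G) * \<zeta> (zm T K)"
    have 1: "Zie_cobr (R \<union> S) T X (dual_bracket ?Z R S \<xi> \<eta>, \<zeta>) =
      (\<Sum>F\<in>compositions R. \<Sum>G\<in>compositions S. \<Sum>K\<in>compositions T.
         (f (F @ G @ K) - f (K @ F @ G) - f (G @ F @ K) + f (K @ G @ F)) * ?p F G K)"
      unfolding f(2) by (rule bracket) (use * f d in auto)
    have "Zie_cobr (S \<union> T) R X (dual_bracket ?Z S T \<eta> \<zeta>, \<xi>) =
      (\<Sum>G\<in>compositions S. \<Sum>K\<in>compositions T. \<Sum>F\<in>compositions R.
         (f (G @ K @ F) - f (F @ G @ K) - f (K @ G @ F) + f (F @ K @ G)) *
           (\<eta> (zm S G) * \<zeta> (zm T K) * \<xi> (zm R F)))"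
      unfolding f(2) by (rule bracket) (use * f d in auto)
    also have "\<dots> = (\<Sum>F\<in>compositions R. \<Sum>G\<in>compositions S. \<Sum>K\<in>compositions T.
         (f (G @ K @ F) - f (F @ G @ K) - f (K @ G @ F) + f (F @ K @ G)) * ?p F G K)"
      unfolding sum.cartesian_product
      by (rule sum.reindex_bij_witness[where i = "\<lambda>(F, G, K). (G, K, F)" and j = "\<lambda>(G, K, F). (F, G, K)"])
        (auto simp: mult_ac)
    finally have 2: "Zie_cobr (S \<union> T) R X (dual_bracket ?Z S T \<eta> \<zeta>, \<xi>) = \<dots>" .
    have "Zie_cobr (T \<union> R) S X (dual_bracket ?Z T R \<zeta> \<xi>, \<eta>) =
      (\<Sum>K\<in>compositions T. \<Sum>F\<in>compositions R. \<Sum>G\<in>compositions S.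
         (f (K @ F @ G) - f (G @ K @ F) - f (F @ K @ G) + f (G @ F @ K)) *
           (\<zeta> (zm T K) * \<xi> (zm R F) * \<eta> (zm S G)))"
      unfolding f(2) by (rule bracket) (use * f d in auto)
    also have "\<dots> = (\<Sum>F\<in>compositions R. \<Sum>G\<in>compositions S. \<Sum>K\<in>compositions T.
         (f (K @ F @ G) - f (G @ K @ F) - f (F @ K @ G) + f (G @ F @ K)) * ?p F G K)"
      unfolding sum.cartesian_product
      by (rule sum.reindex_bij_witness[where i = "\<lambda>(F, G, K). (K, F, G)" and j = "\<lambda>(K, F, G). (F, G, K)"])
        (auto simp: mult_ac)
    finally have 3: "Zie_cobr (T \<union> R) S X (dual_bracket ?Z T R \<zeta> \<xi>, \<eta>) = \<dots>" .
    \<comment> \<open>After reindexing, the three sums run over the same triples, and for each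
      triple the twelve signed coefficients cancel in pairs.\<close>
    show "Zie_cobr (R \<union> S) T X (dual_bracket ?Z R S \<xi> \<eta>, \<zeta>) +
           Zie_cobr (S \<union> T) R X (dual_bracket ?Z S T \<eta> \<zeta>, \<xi>) +
           Zie_cobr (T \<union> R) S X (dual_bracket ?Z T R \<zeta> \<xi>, \<eta>) = 0"
      unfolding 1 2 3 sum.distrib[symmetric]
      by (intro sum.neutral ballI) (simp add: algebra_simps)
  qed
qed

section \<open>The isomorphism\<close>

text \<open>All points of a wall face have the same signs on subsets of \<open>S\<close>, so one
  point of the wall decides the chamber over \<open>S\<close>. The relation
  \<open>in_product\<close> asks for every point of the wall, whereas the construction of walls
  provides one.\<close>

lemma face_restrict_in_chamber:
  assumes ST: "S \<noteq> {}" "T \<noteq> {}" "S \<inter> T = {}" "sum x S = 0"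
    and C: "C \<in> adj_chambers S" "(\<lambda>i. if i \<in> S then x i else 0) \<in> C"
    and y: "y \<in> adj_face (S \<union> T) x"
  shows "(\<lambda>i. if i \<in> S then y i else 0) \<in> C"
proof -
  have sums: "sum (\<lambda>i. if i \<in> S then z i else 0) R = sum z R" if "R \<subseteq> S" for R and z :: "'a \<Rightarrow> real"
    using that by (intro sum.cong) auto
  have sg: "sgn (sum y R) = sgn (sum x R)" if "R \<noteq> {}" "R \<subseteq> S" for R
    using adj_face_sgn[OF y that(1)] that(2) ST by blast
  have "sum y S = 0" using sg[of S] ST by (simp add: sgn_zero_iff)
  then have "(\<lambda>i. if i \<in> S then y i else 0) \<in> adj_space S"
    using sums[of S y] by (simp add: adj_space_def)
  moreover have "sgn (sum (\<lambda>i. if i \<in> S then y i else 0) R) = sgn (sum (\<lambda>i. if i \<in> S then x i else 0) R)"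
    if "R \<noteq> {} \<and> R \<subset> S" for R
    using sums[of R] sg[of R] that by (simp add: psubset_imp_subset)
  ultimately have "(\<lambda>i. if i \<in> S then y i else 0) \<in> adj_face S (\<lambda>i. if i \<in> S then x i else 0)"
    by (simp add: adj_face_def)
  then show ?thesis using chamberD(2)[OF C] by simp
qed

text \<open>By the wall formula the tensor carried over from \<open>Zie\<close> has the prescribed
  jumps as its values, which gives existence for the definite description. For uniqueness, some wall
  lies over each pair of chambers, so the equations prescribe the values at all pairs, and these
  determine a tensor.\<close>

lemma adjZie_cobr_zie_map:
  fixes X :: "('a set list \<Rightarrow> 'k::field) set"
  assumes ST: "fin_ne S" "fin_ne T" "S \<inter> T = {}" and X: "X \<in> vcar (Zie_space (S \<union> T))"
  shows "adjZie_cobr S T (zie_map (S \<union> T) X) =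
    tensor_map (Zie_space S) (Zie_space T) (adjZie_space S) (adjZie_space T)
      (zie_map S) (zie_map T) (Zie_cobr S T X)" (is "_ = ?t")
proof -
  have U: "fin_ne (S \<union> T)" using ST by (simp add: fin_ne_def)
  have fin: "finite S" "finite T" "S \<noteq> {}" "T \<noteq> {}" using ST by (auto simp: fin_ne_def)
  have TS: "T \<inter> S = {}" "T \<union> S = S \<union> T" using ST(3) by auto
  obtain f where f: "f \<in> Sig (S \<union> T)" "X = zproj (S \<union> T) f" using X by (auto simp: vcar_Zie_space)
  have cobr: "Zie_cobr S T X = cocomm S T f" unfolding f(2) by (rule Zie_cobr_zproj[OF ST f(1)])
  have t_in: "?t \<in> vcar (tensor (adjZie_space S) (adjZie_space T))"
    unfolding cobr by (intro tensor_map_in_tensor is_vspace_Zie_space linear_zie_map ST cocomm_in_tensor)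
  have t_eval: "?t (chamber_eval S C, chamber_eval T D) = cocomm S T f (zie_eval S C, zie_eval T D)" for C D
    by (simp add: cobr tensor_map_apply chamber_eval_in_dual zie_eval_def)
  have t_wall: "?t (chamber_eval S C, chamber_eval T D) =
      zie_map (S \<union> T) X (adj_side S T W) - zie_map (S \<union> T) X (adj_side T S W)"
    if W: "W \<in> adj_walls S T" and C: "C \<in> adj_chambers S" and D: "D \<in> adj_chambers T"
      and prod: "in_product S T W C D" for W C D
  proof -
    obtain x where x: "W = adj_face (S \<union> T) x" "generic_wall S T x" using W by (auto simp: adj_walls_eq)
    have "x \<in> W" unfolding x(1) using x(2) by (intro adj_face_self) (simp add: generic_wall_def)
    then have xCD: "(\<lambda>i. if i \<in> S then x i else 0) \<in> C" "(\<lambda>i. if i \<in> T then x i else 0) \<in> D"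
      using prod by (auto simp: in_product_def)
    obtain v w where vw: "beside S T x v" "beside T S x w" by (rule sides_exist[OF ST x(2)])
    have x': "generic_wall T S x" by (rule generic_wall_commute[OF fin(1,2) ST(3) x(2)])
    have v: "adj_side S T W = adj_face (S \<union> T) v" "generic (S \<union> T) v"
      unfolding x(1) by (rule adj_side_eq[OF fin(1,2) ST(3) x(2) vw(1)] beside_generic[OF fin(1,2) ST(3) x(2) vw(1)])+
    have w: "adj_side T S W = adj_face (S \<union> T) w" "generic (S \<union> T) w"
      using adj_side_eq[OF fin(2,1) TS(1) x' vw(2)] beside_generic[OF fin(2,1) TS(1) x' vw(2)]
      by (simp_all only: x(1) TS(2))
    have "zie_map (S \<union> T) X = dynkin_map (S \<union> T) f"
      unfolding f(2) by (rule zie_map_zproj[OF U f(1)])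
    then show ?thesis
      unfolding t_eval cocomm_eval[OF ST x(2) vw C xCD(1) D xCD(2)]
      by (simp only: v(1) w(1) dynkin_map_face[OF v(2)] dynkin_map_face[OF w(2)])
  qed
  show ?thesis
    unfolding adjZie_cobr_def
  proof (rule the_equality, use t_in t_wall in blast)
    fix s assume s: "s \<in> vcar (tensor (adjZie_space S) (adjZie_space T)) \<and>
      (\<forall>W\<in>adj_walls S T. \<forall>C\<in>adj_chambers S. \<forall>D\<in>adj_chambers T. in_product S T W C D \<longrightarrow>
         s (chamber_eval S C, chamber_eval T D) =
         zie_map (S \<union> T) X (adj_side S T W) - zie_map (S \<union> T) X (adj_side T S W))"
    then have "s - ?t \<in> vcar (tensor (adjZie_space S) (adjZie_space T))"
      using t_in by (intro fun_vs.subspace_diff[OF tensor_subspace]) auto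
    then have "s - ?t = 0"
    proof (rule tensor_separation[OF is_vspace_adjZie_space is_vspace_adjZie_space _
          chamber_eval_in_dual chamber_eval_separates[OF ST(1)]
          chamber_eval_in_dual chamber_eval_separates[OF ST(2)]])
      fix C D assume CD: "C \<in> adj_chambers S" "D \<in> adj_chambers T"
      obtain x where x: "generic_wall S T x" "(\<lambda>i. if i \<in> S then x i else 0) \<in> C"
        "(\<lambda>i. if i \<in> T then x i else 0) \<in> D"
        by (rule wall_over_chambers[OF ST CD])
      let ?W = "adj_face (S \<union> T) x"
      have W: "?W \<in> adj_walls S T" using x(1) by (auto simp: adj_walls_eq)
      have xS: "sum x S = 0" using x(1) by (simp add: generic_wall_def)
      have xT: "sum x T = 0"
        using generic_wall_commute[OF fin(1,2) ST(3) x(1)] by (simp add: generic_wall_def)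
      have prod: "in_product S T ?W C D"
        unfolding in_product_def
      proof (intro ballI conjI)
        fix y assume y: "y \<in> ?W"
        show "(\<lambda>i. if i \<in> S then y i else 0) \<in> C"
          by (rule face_restrict_in_chamber[OF fin(3,4) ST(3) xS CD(1) x(2) y])
        have "y \<in> adj_face (T \<union> S) x" using y by (simp only: TS(2))
        then show "(\<lambda>i. if i \<in> T then y i else 0) \<in> D"
          by (rule face_restrict_in_chamber[OF fin(4,3) TS(1) xT CD(2) x(3)])
      qed
      have "s (chamber_eval S C, chamber_eval T D) =
          zie_map (S \<union> T) X (adj_side S T ?W) - zie_map (S \<union> T) X (adj_side T S ?W)"
        using s W CD prod by blast
      then show "(s - ?t) (chamber_eval S C, chamber_eval T D) = 0"
        using t_wall[OF W CD prod] by simp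
    qed
    then show "s = ?t" by simp
  qed
qed

lemma lie_coalgebra_iso_zie_map:
  "lie_coalgebra_iso (Zie :: ('a, ('a set list \<Rightarrow> 'k::field) set, 'k) cobracket_data) adjZie zie_map"
  unfolding lie_coalgebra_iso_def
proof (intro conjI allI impI ballI)
  fix I :: "'a set" assume "fin_ne I"
  then show "linear_on (comp (Zie :: ('a, ('a set list \<Rightarrow> 'k) set, 'k) cobracket_data) I) (comp adjZie I) (zie_map I)"
    "bij_betw (zie_map I) (vcar (comp (Zie :: ('a, ('a set list \<Rightarrow> 'k) set, 'k) cobracket_data) I)) (vcar (comp adjZie I))"
    by (simp_all add: Zie_def adjZie_def linear_zie_map bij_zie_map)
next
  fix I :: "'a set" and \<sigma> :: "'a \<Rightarrow> 'a" and X :: "('a set list \<Rightarrow> 'k) set"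
  assume *: "fin_ne I \<and> inj_on \<sigma> I" and X: "X \<in> vcar (comp Zie (\<sigma> ` I))"
  then have I: "fin_ne I" "inj_on \<sigma> I" "fin_ne (\<sigma> ` I)" by (auto simp: fin_ne_def)
  obtain f where f: "f \<in> Sig (\<sigma> ` I)" "X = zproj (\<sigma> ` I) f" using X by (auto simp: Zie_def vcar_Zie_space)
  show "zie_map I (act Zie I \<sigma> X) = act adjZie I \<sigma> (zie_map (\<sigma> ` I) X)"
    by (simp add: Zie_def adjZie_def f Sig_act_zproj[OF I(1,2)] zie_map_zproj[OF I(1) Sig_act_in_Sig]
        zie_map_zproj[OF I(3)] dynkin_map_Sig_act[OF I(1,2)])
next
  fix S T :: "'a set" and X :: "('a set list \<Rightarrow> 'k) set"
  assume "fin_ne S \<and> fin_ne T \<and> S \<inter> T = {}" "X \<in> vcar (comp Zie (S \<union> T))"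
  then show "cobr adjZie S T (zie_map (S \<union> T) X) =
      tensor_map (comp Zie S) (comp Zie T) (comp adjZie S) (comp adjZie T) (zie_map S) (zie_map T) (cobr Zie S T X)"
    using adjZie_cobr_zie_map[of S T X] by (simp add: Zie_def adjZie_def)
qed

section \<open>The \<open>P\<close> family and uniqueness of the map\<close>

lemma restr_block:
  assumes "F \<in> compositions I" "B \<in> set F" shows "restr F B = [B]"
proof -
  obtain A D where F: "F = A @ [B] @ D" using split_list[OF assms(2)] by auto
  then obtain X Y where XY: "A \<in> compositions X" "[B] @ D \<in> compositions Y" "X \<inter> Y = {}"
    using assms(1) append_in_compositions by metis
  then have B: "B \<noteq> {}" "B \<subseteq> Y" "D \<in> compositions (Y - B)" by (auto simp: Cons_in_compositions)
  have "restr A B = []" "restr D B = []"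
    using Union_composition[OF XY(1)] Union_composition[OF B(3)] XY(3) B(2)
    by (intro restr_disjoint; blast)+
  then show ?thesis using B(1) by (simp add: F restr_append restr_Cons)
qed

text \<open>Each lump of \<open>F\<close> contains just one lump of \<open>F\<close>, so the
  diagonal coefficient of the \<open>P\<close> family is 1, as the triangular spanning argument
  requires.\<close>

lemma quot_fact_self: "F \<in> compositions I \<Longrightarrow> quot_fact F F = 1"
  by (simp add: quot_fact_def restr_block)

lemma bC_in_Sig: "finite I \<Longrightarrow> bC I p \<in> Sig I"
  by (simp add: Sig_def bC_apply)

lemma bP_in_Sig: "bP I F \<in> Sig I"
  unfolding bP_def
  by (intro fun_vs.subspace_sum[OF Sig_subspace] fun_vs.subspace_scale[OF Sig_subspace] bM_in_Sig) simp

lemma Sig_subset_if_bP: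
  assumes "finite I" "fun_vs.subspace V" "\<And>F. F \<in> compositions I \<Longrightarrow> bP I F \<in> V"
  shows "Sig I \<subseteq> V"
  by (rule Sig_subset_if_triangular[OF assms(1,2), where c = "\<lambda>F G. 1 / of_nat (quot_fact F G)"])
    (use assms(3) in \<open>simp_all add: bP_def quot_fact_self\<close>)

text \<open>Each of the three families spans \<open>Sig I\<close>, so agreement on any one of them
  extends by linearity to the quotient.\<close>

lemma zie_map_unique:
  fixes \<psi> :: "('a set list \<Rightarrow> 'k::field_char_0) set \<Rightarrow> ('a \<Rightarrow> real) set \<Rightarrow> 'k"
  assumes I: "fin_ne I" and \<psi>: "linear_on (Zie_space I) (adjZie_space I) \<psi>"
    and basis: "(\<forall>p. preorder_on I p \<longrightarrow> \<psi> (zc I p) = zie_map I (zc I p)) \<or>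
      (\<forall>F\<in>compositions I. \<psi> (zp I F) = zie_map I (zp I F)) \<or>
      (\<forall>F\<in>compositions I. \<psi> (zm I F) = zie_map I (zm I F))"
    and X: "X \<in> vcar (Zie_space I)"
  shows "\<psi> X = zie_map I X"
proof -
  have fin: "finite I" using I by (simp add: fin_ne_def)
  let ?V = "{f \<in> Sig I. \<psi> (zproj I f) = zie_map I (zproj I f)}"
  have mem: "zproj I f \<in> vcar (Zie_space I)" if "f \<in> Sig I" for f
    using that by (simp add: vcar_Zie_space)
  have add: "h (zproj I (f + g)) = h (zproj I f) + h (zproj I g)"
    if "linear_on (Zie_space I) (adjZie_space I) h" "f \<in> Sig I" "g \<in> Sig I"
    for h :: "('a set list \<Rightarrow> 'k) set \<Rightarrow> ('a \<Rightarrow> real) set \<Rightarrow> 'k" and f g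
    using linear_onD(2)[OF that(1) mem[OF that(2)] mem[OF that(3)]]
    by (simp add: vadd_Zie_space adjZie_space_ops)
  have scale: "h (zproj I (fscale c f)) = fscale c (h (zproj I f))"
    if "linear_on (Zie_space I) (adjZie_space I) h" "f \<in> Sig I"
    for h :: "('a set list \<Rightarrow> 'k) set \<Rightarrow> ('a \<Rightarrow> real) set \<Rightarrow> 'k" and f c
    using linear_onD(3)[OF that(1) mem[OF that(2)], of c]
    by (simp add: vscale_Zie_space adjZie_space_ops)
  note \<phi> = linear_zie_map[OF I]
  have Sig0: "0 \<in> Sig I" by (rule fun_vs.subspace_0[OF Sig_subspace])
  have zero: "h (zproj I 0) = 0"
    if "linear_on (Zie_space I) (adjZie_space I) h"
    for h :: "('a set list \<Rightarrow> 'k) set \<Rightarrow> ('a \<Rightarrow> real) set \<Rightarrow> 'k"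
    using scale[OF that Sig0, of 0] by simp
  have V: "fun_vs.subspace ?V"
    unfolding fun_vs.subspace_def
    by (auto simp: Sig0 zero[OF \<psi>] zero[OF \<phi>] Sig_add Sig_scale add[OF \<psi>] add[OF \<phi>] scale[OF \<psi>] scale[OF \<phi>])
  from basis have "Sig I \<subseteq> ?V"
  proof (elim disjE)
    assume "\<forall>p. preorder_on I p \<longrightarrow> \<psi> (zc I p) = zie_map I (zc I p)"
    then show ?thesis using bC_in_Sig[OF fin] by (intro Sig_subset_if_bC[OF fin V]) (simp add: zc_def)
  next
    assume "\<forall>F\<in>compositions I. \<psi> (zp I F) = zie_map I (zp I F)"
    then show ?thesis by (intro Sig_subset_if_bP[OF fin V]) (simp add: zp_def bP_in_Sig)
  next
    assume "\<forall>F\<in>compositions I. \<psi> (zm I F) = zie_map I (zm I F)"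
    then show ?thesis by (intro Sig_subset_if_bM[OF fin V]) (simp add: zm_def bM_in_Sig)
  qed
  then show ?thesis using X by (auto simp: vcar_Zie_space)
qed

lemma is_lie_coalgebra_adjZie:
  "is_lie_coalgebra (adjZie :: ('a, ('a \<Rightarrow> real) set \<Rightarrow> 'k::field, 'k) cobracket_data)"
  by (rule is_lie_coalgebra_transport[OF is_lie_coalgebra_Zie lie_coalgebra_iso_zie_map])
    (simp add: adjZie_def is_vspace_adjZie_space)

theorem mainTheorem14:
  shows "is_lie_coalgebra (Zie :: ('a, ('a set list \<Rightarrow> 'k::field_char_0) set, 'k) cobracket_data) \<and>
    is_lie_coalgebra (adjZie :: ('a, ('a \<Rightarrow> real) set \<Rightarrow> 'k, 'k) cobracket_data) \<and>
    (\<forall>I. fin_ne I \<longrightarrow>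
       (\<exists>!L :: ('a set list \<Rightarrow> 'k) \<Rightarrow> (('a \<Rightarrow> real) set \<Rightarrow> 'k). is_adj_map I L)) \<and>
    (\<exists>\<phi> :: 'a set \<Rightarrow> ('a set list \<Rightarrow> 'k) set \<Rightarrow> (('a \<Rightarrow> real) set \<Rightarrow> 'k).
       lie_coalgebra_iso Zie adjZie \<phi> \<and>
       (\<forall>I. fin_ne I \<longrightarrow>
          (\<forall>p. preorder_on I p \<longrightarrow> \<phi> I (zc I p) = ac I p) \<and>
          (\<forall>F\<in>compositions I. \<phi> I (zp I F) = ap I F) \<and>
          (\<forall>F\<in>compositions I. \<phi> I (zm I F) = am I F) \<and>
          (\<forall>\<psi>. linear_on (Zie_space I) (adjZie_space I) \<psi> \<and>
             ((\<forall>p. preorder_on I p \<longrightarrow> \<psi> (zc I p) = ac I p) \<or>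
              (\<forall>F\<in>compositions I. \<psi> (zp I F) = ap I F) \<or>
              (\<forall>F\<in>compositions I. \<psi> (zm I F) = am I F)) \<longrightarrow>
             (\<forall>x\<in>vcar (Zie_space I). \<psi> x = \<phi> I x))))"
proof (intro conjI exI[of _ zie_map] allI impI)
  show "is_lie_coalgebra (Zie :: ('a, ('a set list \<Rightarrow> 'k) set, 'k) cobracket_data)"
    by (rule is_lie_coalgebra_Zie)
  show "is_lie_coalgebra (adjZie :: ('a, ('a \<Rightarrow> real) set \<Rightarrow> 'k, 'k) cobracket_data)"
    by (rule is_lie_coalgebra_adjZie)
  show "lie_coalgebra_iso (Zie :: ('a, ('a set list \<Rightarrow> 'k) set, 'k) cobracket_data) adjZie zie_map"
    by (rule lie_coalgebra_iso_zie_map)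
next
  fix I :: "'a set" assume "fin_ne I"
  then show "\<exists>!L :: ('a set list \<Rightarrow> 'k) \<Rightarrow> (('a \<Rightarrow> real) set \<Rightarrow> 'k). is_adj_map I L"
    by (simp add: is_adj_map_iff)
next
  fix I :: "'a set" assume I: "fin_ne I"
  have fin: "finite I" using I by (simp add: fin_ne_def)
  have zc: "zie_map I (zc I p) = (ac I p :: _ \<Rightarrow> 'k)" if "preorder_on I p" for p
    unfolding zc_def by (simp add: zie_map_zproj[OF I bC_in_Sig[OF fin]] dynkin_map_bC[OF I that])
  \<comment> \<open>\<open>ap\<close> and \<open>am\<close> are images under \<open>adj_map\<close>,
    which agrees on \<open>Sig I\<close> with \<open>dynkin_map\<close>, and \<open>zie_map\<close>
    is the map that \<open>dynkin_map\<close> induces on the quotient.\<close>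
  have zp: "zie_map I (zp I F) = (ap I F :: _ \<Rightarrow> 'k)" for F
    by (simp add: zp_def ap_def zie_map_zproj[OF I bP_in_Sig] adj_map_eq[OF I bP_in_Sig])
  have zm: "zie_map I (zm I F) = (am I F :: _ \<Rightarrow> 'k)" if "F \<in> compositions I" for F
    by (simp add: zm_def am_def zie_map_zproj[OF I bM_in_Sig[OF that]] adj_map_eq[OF I bM_in_Sig[OF that]])
  show "zie_map I (zc I p) = (ac I p :: _ \<Rightarrow> 'k)" if "preorder_on I p" for p by (rule zc[OF that])
  show "\<forall>F\<in>compositions I. zie_map I (zp I F) = (ap I F :: _ \<Rightarrow> 'k)" using zp by blast
  show "\<forall>F\<in>compositions I. zie_map I (zm I F) = (am I F :: _ \<Rightarrow> 'k)" using zm by blast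
  fix \<psi> :: "('a set list \<Rightarrow> 'k) set \<Rightarrow> ('a \<Rightarrow> real) set \<Rightarrow> 'k"
  assume \<psi>: "linear_on (Zie_space I) (adjZie_space I) \<psi> \<and>
    ((\<forall>p. preorder_on I p \<longrightarrow> \<psi> (zc I p) = ac I p) \<or>
     (\<forall>F\<in>compositions I. \<psi> (zp I F) = ap I F) \<or>
     (\<forall>F\<in>compositions I. \<psi> (zm I F) = am I F))"
  have "(\<forall>p. preorder_on I p \<longrightarrow> \<psi> (zc I p) = zie_map I (zc I p)) \<or>
     (\<forall>F\<in>compositions I. \<psi> (zp I F) = zie_map I (zp I F)) \<or>
     (\<forall>F\<in>compositions I. \<psi> (zm I F) = zie_map I (zm I F))"
    using \<psi> by (simp add: zc zp zm)
  then show "\<forall>x\<in>vcar (Zie_space I). \<psi> x = zie_map I x"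
    using zie_map_unique[OF I] \<psi> by blast
qed

end
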